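(* The following is a complete list of the free and nearly free line arrangements with $d=4$ lines (i.e. every free or nearly free arrangement in $A(4)$ belongs to one of the sets below). (1) The set $A(4,6)$ is open, 8-dimensional, and consists only of nearly free arrangements with exponents $d_1=d_2=2$. (2) The set $A(4, 7)$ is irreducible, 7-dimensional, and consists only of free arrangements with exponents $d_1=1, d_2=2$. (3) The set $A(4, 9)$ is irreducible, 6-dimensional, and consists only of free arrangements with exponents $d_1=0, d_2=3$.
   Context: $S=\mathbb{C}[x,y,z]$. $A(d)\subset\mathbb{P}(S_d)$ is the space of arrangements $\mathcal{A}:f=0$ of $d$ distinct lines in the complex projective plane ($f$ a product of $d$ pairwise non-proportional linear forms), with the Zariski topology; $A(d,\tau)$ is the subset of arrangements with total Tjurina number $\tau$, where for a line arrangement $\tau(f)=\sum_p(m_p-1)^2$, sum over the multiple points $p$, of multiplicity $m_p\ge 2$. Open means open in $A(4)$. $AR(f)$ is the graded $S$-module of triples $(a,b,c)\in S^3$ with $af_x+bf_y+cf_z=0$. The arrangement is free with exponents $d_1\le d_2$ if $AR(f)\cong S(-d_1)\oplus S(-d_2)$, $0\le d_1\le d_2$. It is nearly free with exponents $d_1\le d_2$ if $M(f)=S/(f_x,f_y,f_z)$ has a minimal graded free resolution $$0 \to S(-d-d_2) \to S(-d-d_1+1) \oplus S^2(-d-d_2+1) \to S^3(-d+1) \xrightarrow{(f_x,f_y,f_z)} S$$ with $1\le d_1\le d_2$. *)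

theory Defs
  imports
    "HOL-Analysis.Analysis"
    "HOL-Library.Poly_Mapping"
    "HOL-Library.Extended_Nat"
begin

section \<open>Polynomials with complex coefficients\<close>

text \<open>
  A polynomial in variables indexed by the type \<open>'v\<close> is a finitely supported map from monomials
  to coefficients, a monomial being a finitely supported map from variables to exponents; ring
  operations come from the library instances for such maps.
  The ring $S = C[x,y,z]$ is \<open>S\<close>, where the indices \<open>1, 2, 3 :: 3\<close>
  stand for $x, y, z$.
\<close>

type_synonym 'v cpoly = "('v \<Rightarrow>\<^sub>0 nat) \<Rightarrow>\<^sub>0 complex"

type_synonym S = "3 cpoly"

definition mon_degree :: "('v \<Rightarrow>\<^sub>0 nat) \<Rightarrow> nat" where
  "mon_degree m = (\<Sum>i\<in>Poly_Mapping.keys m. Poly_Mapping.lookup m i)"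

text \<open>The degrees are integers because of the twists below; the component of negative degree
  is \<open>{0}\<close>, and \<open>0\<close> belongs to every component.\<close>

definition hom_part :: "int \<Rightarrow> 'v cpoly set" where
  "hom_part k = {P. \<forall>m\<in>Poly_Mapping.keys P. int (mon_degree m) = k}"

definition mon_eval :: "('v \<Rightarrow>\<^sub>0 nat) \<Rightarrow> ('v \<Rightarrow> complex) \<Rightarrow> complex" where
  "mon_eval m x = (\<Prod>i\<in>Poly_Mapping.keys m. x i ^ Poly_Mapping.lookup m i)"

definition poly_eval :: "'v cpoly \<Rightarrow> ('v \<Rightarrow> complex) \<Rightarrow> complex" where
  "poly_eval P x = (\<Sum>m\<in>Poly_Mapping.keys P. Poly_Mapping.lookup P m * mon_eval m x)"

definition poly_scale :: "complex \<Rightarrow> 'v cpoly \<Rightarrow> 'v cpoly" where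
  "poly_scale c P = Poly_Mapping.single 0 c * P"

text \<open>Subtraction of exponents truncates at \<open>0\<close>, but in that case the coefficient vanishes.\<close>

definition pd :: "'v \<Rightarrow> 'v cpoly \<Rightarrow> 'v cpoly" where
  "pd i P = (\<Sum>m\<in>Poly_Mapping.keys P.
     Poly_Mapping.single (m - Poly_Mapping.single i 1)
       (of_nat (Poly_Mapping.lookup m i) * Poly_Mapping.lookup P m))"


section \<open>Projective spaces and the Zariski topology\<close>

text \<open>The point of projective space represented by a nonzero vector \<open>v\<close> is the set of
  its nonzero multiples.\<close>

definition proj_point :: "(complex \<Rightarrow> 'b \<Rightarrow> 'b) \<Rightarrow> 'b \<Rightarrow> 'b set" where
  "proj_point smul v = {smul c v | c. c \<noteq> 0}"

definition P2 :: "(complex ^ 3) set set" where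
  "P2 = {proj_point (*s) v | v. v \<noteq> 0}"

abbreviation poly_point :: "S \<Rightarrow> S set" where
  "poly_point f \<equiv> proj_point poly_scale f"

definition PS :: "nat \<Rightarrow> S set set" where
  "PS d = {poly_point f | f. f \<in> hom_part (int d) \<and> f \<noteq> 0}"

text \<open>The homogeneous coordinates of the class of \<open>f\<close> in $P(S_d)$ are the coefficients of \<open>f\<close>,
  so the coordinate functions are indexed by the monomials in $x,y,z$. The coordinates belonging
  to monomials of degree other than \<open>d\<close> vanish identically and have no effect.\<close>

definition zero_locus :: "nat \<Rightarrow> (3 \<Rightarrow>\<^sub>0 nat) cpoly set \<Rightarrow> S set set" where
  "zero_locus d F =
     {p \<in> PS d. \<forall>P\<in>F. \<forall>f\<in>p. poly_eval P (Poly_Mapping.lookup f) = 0}"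

definition zariski_open :: "nat \<Rightarrow> S set set \<Rightarrow> bool" where
  "zariski_open d U \<longleftrightarrow>
     (\<exists>F. F \<subseteq> (\<Union>k. hom_part k) \<and> U = PS d - zero_locus d F)"

definition zariski :: "nat \<Rightarrow> S set topology" where
  "zariski d = topology (zariski_open d)"

text \<open>Krull dimension of a topological space. The empty space gets dimension \<open>0\<close>.\<close>

definition irreducible_in :: "'a topology \<Rightarrow> 'a set \<Rightarrow> bool" where
  "irreducible_in X Z \<longleftrightarrow> Z \<subseteq> topspace X \<and> Z \<noteq> {} \<and>
     (\<forall>C D. closedin X C \<longrightarrow> closedin X D \<longrightarrow> Z \<subseteq> C \<union> D \<longrightarrow> Z \<subseteq> C \<or> Z \<subseteq> D)"

definition krull_dim :: "'a topology \<Rightarrow> enat" where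
  "krull_dim X = Sup {enat n | n. \<exists>Z.
     (\<forall>i\<le>n. closedin X (Z i) \<and> irreducible_in X (Z i)) \<and> (\<forall>i<n. Z i \<subset> Z (Suc i))}"


section \<open>Line arrangements\<close>

definition arrangement_poly :: "nat \<Rightarrow> S \<Rightarrow> bool" where
  "arrangement_poly d f \<longleftrightarrow> (\<exists>l :: nat \<Rightarrow> S.
     (\<forall>i<d. l i \<in> hom_part 1 \<and> l i \<noteq> 0) \<and>
     (\<forall>i<d. \<forall>j<d. i \<noteq> j \<longrightarrow> (\<nexists>c. l i = poly_scale c (l j))) \<and>
     f = (\<Prod>i<d. l i))"

definition arr :: "nat \<Rightarrow> S set set" where
  "arr d = {poly_point f | f. arrangement_poly d f}"

definition line_of :: "S \<Rightarrow> (complex ^ 3) set set" where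
  "line_of l = {p \<in> P2. \<forall>v\<in>p. poly_eval l (($) v) = 0}"

definition lines_of :: "S \<Rightarrow> (complex ^ 3) set set set" where
  "lines_of f = {line_of l | l. l \<in> hom_part 1 \<and> l \<noteq> 0 \<and> l dvd f}"

definition mult_at :: "S \<Rightarrow> (complex ^ 3) set \<Rightarrow> nat" where
  "mult_at f p = card {L \<in> lines_of f. p \<in> L}"

text \<open>Total Tjurina number of a line arrangement: its singular points are the multiple points,
  and the one of multiplicity $m$ contributes $(m-1)^2$.\<close>

definition tjurina :: "S \<Rightarrow> nat" where
  "tjurina f = (\<Sum>p\<in>{p \<in> P2. mult_at f p \<ge> 2}. (mult_at f p - 1)\<^sup>2)"

definition arr_tau :: "nat \<Rightarrow> nat \<Rightarrow> S set set" where
  "arr_tau d t = {poly_point f | f. arrangement_poly d f \<and> tjurina f = t}"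


section \<open>Free and nearly free arrangements\<close>

text \<open>The graded free module $S(-e_1) \oplus \dots \oplus S(-e_n)$ is the module \<open>S ^ 'n\<close> with
  homogeneous components \<open>twisted_part e k\<close>, as $S(-e)_k = S_{k-e}$.\<close>

definition twisted_part :: "int ^ 'n \<Rightarrow> int \<Rightarrow> (S ^ 'n) set" where
  "twisted_part e k = {v. \<forall>i. v $ i \<in> hom_part (k - e $ i)}"

definition graded_hom ::
    "int ^ 'n::finite \<Rightarrow> int ^ 'm::finite \<Rightarrow> (S ^ 'n \<Rightarrow> S ^ 'm) \<Rightarrow> bool" where
  "graded_hom e e' \<phi> \<longleftrightarrow>
     module_hom (*s) (*s) \<phi> \<and> (\<forall>k. \<phi> ` twisted_part e k \<subseteq> twisted_part e' k)"

text \<open>The image lies in $m F$ for the irrelevant ideal $m = (x,y,z)$, i.e. all constant terms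
  vanish: this is the minimality condition on the maps of a graded free resolution.\<close>

definition minimal_map :: "(S ^ 'n \<Rightarrow> S ^ 'm) \<Rightarrow> bool" where
  "minimal_map \<phi> \<longleftrightarrow> (\<forall>v i. Poly_Mapping.lookup (\<phi> v $ i) 0 = 0)"

definition jac_map :: "S \<Rightarrow> S ^ 3 \<Rightarrow> S ^ 1" where
  "jac_map f v = vector [v $ 1 * pd 1 f + v $ 2 * pd 2 f + v $ 3 * pd 3 f]"

definition AR :: "S \<Rightarrow> (S ^ 3) set" where
  "AR f = {v. v $ 1 * pd 1 f + v $ 2 * pd 2 f + v $ 3 * pd 3 f = 0}"

definition AR_part :: "S \<Rightarrow> int \<Rightarrow> (S ^ 3) set" where
  "AR_part f k = {v \<in> AR f. \<forall>i. v $ i \<in> hom_part k}"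

definition free_arr :: "S \<Rightarrow> nat \<Rightarrow> nat \<Rightarrow> bool" where
  "free_arr f d1 d2 \<longleftrightarrow> d1 \<le> d2 \<and>
     (\<exists>\<phi> :: S ^ 2 \<Rightarrow> S ^ 3.
        module_hom (*s) (*s) \<phi> \<and> bij_betw \<phi> UNIV (AR f) \<and>
        (\<forall>k. \<phi> ` twisted_part (vector [int d1, int d2]) k = AR_part f k))"

text \<open>A minimal graded free resolution of the Milnor algebra $M(f) = S/(f_x,f_y,f_z)$, of the form
  \[0 \to S(-d-d_2) \to S(-d-d_1+1) \oplus S^2(-d-d_2+1) \to S^3(-d+1) \to S\]
  with last map $(f_x,f_y,f_z)$, where $d = \deg f$. Exactness at $M(f)$, the cokernel of the last
  map, holds by definition.\<close>

definition nearly_free_arr :: "nat \<Rightarrow> S \<Rightarrow> nat \<Rightarrow> nat \<Rightarrow> bool" where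
  "nearly_free_arr d f d1 d2 \<longleftrightarrow> 1 \<le> d1 \<and> d1 \<le> d2 \<and>
     (let D = int d; D1 = int d1; D2 = int d2;
          e3 = (vector [D + D2] :: int ^ 1);
          e2 = (vector [D + D1 - 1, D + D2 - 1, D + D2 - 1] :: int ^ 3);
          e1 = (vector [D - 1, D - 1, D - 1] :: int ^ 3);
          e0 = (vector [0] :: int ^ 1)
      in \<exists>\<phi>3 \<phi>2.
        graded_hom e3 e2 \<phi>3 \<and> graded_hom e2 e1 \<phi>2 \<and> graded_hom e1 e0 (jac_map f) \<and>
        inj \<phi>3 \<and> range \<phi>3 = {v. \<phi>2 v = 0} \<and> range \<phi>2 = {v. jac_map f v = 0} \<and>
        minimal_map \<phi>3 \<and> minimal_map \<phi>2 \<and> minimal_map (jac_map f))"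


section \<open>The Zariski topology is a topology\<close>

lemma mon_eval_superset:
  assumes "finite A" "Poly_Mapping.keys m \<subseteq> A"
  shows "mon_eval m x = (\<Prod>i\<in>A. x i ^ Poly_Mapping.lookup m i)"
  unfolding mon_eval_def
  by (rule prod.mono_neutral_left) (use assms in \<open>auto simp: in_keys_iff\<close>)

lemma mon_eval_add: "mon_eval (m + n) x = mon_eval m x * mon_eval n x"
proof -
  let ?A = "Poly_Mapping.keys m \<union> Poly_Mapping.keys n"
  have "mon_eval (m + n) x = (\<Prod>i\<in>?A. x i ^ Poly_Mapping.lookup (m + n) i)"
    by (rule mon_eval_superset) (auto simp: keys_add in_keys_iff lookup_add)
  moreover have "mon_eval m x = (\<Prod>i\<in>?A. x i ^ Poly_Mapping.lookup m i)"
    "mon_eval n x = (\<Prod>i\<in>?A. x i ^ Poly_Mapping.lookup n i)"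
    by (auto intro!: mon_eval_superset)
  ultimately show ?thesis
    by (simp add: lookup_add power_add prod.distrib)
qed

lemma poly_eval_superset:
  assumes "finite A" "Poly_Mapping.keys P \<subseteq> A"
  shows "poly_eval P x = (\<Sum>m\<in>A. Poly_Mapping.lookup P m * mon_eval m x)"
  unfolding poly_eval_def
  by (rule sum.mono_neutral_left) (use assms in \<open>auto simp: in_keys_iff\<close>)

lemma poly_eval_0 [simp]: "poly_eval 0 x = 0"
  by (simp add: poly_eval_def)

lemma poly_eval_single: "poly_eval (Poly_Mapping.single m c) x = c * mon_eval m x"
  by (subst poly_eval_superset[of "{m}"]) auto

lemma poly_eval_1 [simp]: "poly_eval 1 x = 1"
  using poly_eval_single[of 0 1 x] by (simp add: mon_eval_def)

lemma poly_eval_add: "poly_eval (P + Q) x = poly_eval P x + poly_eval Q x"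
proof -
  let ?A = "Poly_Mapping.keys P \<union> Poly_Mapping.keys Q"
  have "poly_eval (P + Q) x = (\<Sum>m\<in>?A. Poly_Mapping.lookup (P + Q) m * mon_eval m x)"
    by (rule poly_eval_superset) (use keys_add[of P Q] in auto)
  moreover have "poly_eval P x = (\<Sum>m\<in>?A. Poly_Mapping.lookup P m * mon_eval m x)"
    "poly_eval Q x = (\<Sum>m\<in>?A. Poly_Mapping.lookup Q m * mon_eval m x)"
    by (auto intro!: poly_eval_superset)
  ultimately show ?thesis
    by (simp add: lookup_add algebra_simps sum.distrib)
qed

lemma poly_eval_sum: "poly_eval (\<Sum>i\<in>I. P i) x = (\<Sum>i\<in>I. poly_eval (P i) x)"
  by (induction I rule: infinite_finite_induct) (auto simp: poly_eval_add)

lemma cpoly_expand: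
  "P = (\<Sum>m\<in>Poly_Mapping.keys P. Poly_Mapping.single m (Poly_Mapping.lookup P m))"
  by (rule poly_mapping_eqI)
     (auto simp: lookup_sum lookup_single when_def in_keys_iff)

lemma poly_eval_mult: "poly_eval (P * Q) x = poly_eval P x * poly_eval Q x"
proof -
  have "P * Q = (\<Sum>m\<in>Poly_Mapping.keys P. Poly_Mapping.single m (Poly_Mapping.lookup P m)) *
     (\<Sum>n\<in>Poly_Mapping.keys Q. Poly_Mapping.single n (Poly_Mapping.lookup Q n))"
    using cpoly_expand by metis
  also have "\<dots> = (\<Sum>m\<in>Poly_Mapping.keys P. \<Sum>n\<in>Poly_Mapping.keys Q.
      Poly_Mapping.single (m + n) (Poly_Mapping.lookup P m * Poly_Mapping.lookup Q n))"
    by (simp add: sum_product mult_single)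
  finally have "poly_eval (P * Q) x = (\<Sum>m\<in>Poly_Mapping.keys P. \<Sum>n\<in>Poly_Mapping.keys Q.
      (Poly_Mapping.lookup P m * Poly_Mapping.lookup Q n) * (mon_eval m x * mon_eval n x))"
    by (simp add: poly_eval_sum poly_eval_single mon_eval_add)
  then show ?thesis
    unfolding poly_eval_def by (simp add: sum_product mult.assoc mult.left_commute)
qed

lemma mon_degree_superset:
  assumes "finite A" "Poly_Mapping.keys m \<subseteq> A"
  shows "mon_degree m = (\<Sum>i\<in>A. Poly_Mapping.lookup m i)"
  unfolding mon_degree_def
  by (rule sum.mono_neutral_left) (use assms in \<open>auto simp: in_keys_iff\<close>)

lemma mon_degree_add: "mon_degree (m + n) = mon_degree m + mon_degree n"
proof -
  let ?A = "Poly_Mapping.keys m \<union> Poly_Mapping.keys n"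
  have "mon_degree (m + n) = (\<Sum>i\<in>?A. Poly_Mapping.lookup (m + n) i)"
    by (rule mon_degree_superset) (auto simp: keys_add in_keys_iff lookup_add)
  moreover have "mon_degree m = (\<Sum>i\<in>?A. Poly_Mapping.lookup m i)"
    "mon_degree n = (\<Sum>i\<in>?A. Poly_Mapping.lookup n i)"
    by (auto intro!: mon_degree_superset)
  ultimately show ?thesis
    by (simp add: lookup_add sum.distrib)
qed

lemma hom_part_mult:
  assumes "P \<in> hom_part j" "Q \<in> hom_part k"
  shows "P * Q \<in> hom_part (j + k)"
  unfolding hom_part_def
proof (intro CollectI ballI)
  fix m assume "m \<in> Poly_Mapping.keys (P * Q)"
  then obtain a b where "a \<in> Poly_Mapping.keys P" "b \<in> Poly_Mapping.keys Q" "m = a + b"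
    using keys_mult[of P Q] by blast
  with assms show "int (mon_degree m) = j + k"
    unfolding hom_part_def mon_degree_add[of a b] \<open>m = a + b\<close> by auto
qed

lemma one_in_hom_part: "1 \<in> hom_part 0"
  by (auto simp: hom_part_def mon_degree_def)

lemma lookup_poly_scale: "Poly_Mapping.lookup (poly_scale c P) m = c * Poly_Mapping.lookup P m"
  unfolding poly_scale_def
  by (simp flip: mult_map_scale_conv_mult add: map.rep_eq when_def)

lemma mon_eval_scale: "mon_eval m (\<lambda>i. c * x i) = c ^ mon_degree m * mon_eval m x"
  by (simp add: mon_eval_def mon_degree_def power_mult_distrib prod.distrib power_sum)

lemma poly_eval_scale:
  assumes "P \<in> hom_part k"
  shows "poly_eval P (\<lambda>i. c * x i) = c ^ nat k * poly_eval P x"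
  using assms unfolding poly_eval_def hom_part_def
  by (auto simp: mon_eval_scale sum_distrib_left intro!: sum.cong)

lemma PS_eval_zero_iff:
  assumes "p \<in> PS d" "P \<in> hom_part k" "f \<in> p" "g \<in> p"
  shows "poly_eval P (Poly_Mapping.lookup f) = 0 \<longleftrightarrow> poly_eval P (Poly_Mapping.lookup g) = 0"
proof -
  obtain h where h: "p = {poly_scale c h | c. c \<noteq> 0}"
    using assms(1) by (auto simp: PS_def proj_point_def)
  have "poly_eval P (Poly_Mapping.lookup f') = 0 \<longleftrightarrow> poly_eval P (Poly_Mapping.lookup h) = 0"
    if "f' \<in> p" for f'
  proof -
    from that h obtain c where c: "c \<noteq> 0" "f' = poly_scale c h" by auto
    have "Poly_Mapping.lookup f' = (\<lambda>i. c * Poly_Mapping.lookup h i)"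
      by (auto simp: c lookup_poly_scale)
    then show ?thesis using poly_eval_scale[OF assms(2)] c by simp
  qed
  then show ?thesis using assms by blast
qed

lemma istopology_zariski_open: "istopology (zariski_open d)"
  unfolding istopology_def
proof (intro conjI allI impI)
  fix U V assume "zariski_open d U" "zariski_open d V"
  then obtain F G where F: "F \<subseteq> (\<Union>k. hom_part k)" "U = PS d - zero_locus d F"
    and G: "G \<subseteq> (\<Union>k. hom_part k)" "V = PS d - zero_locus d G"
    unfolding zariski_open_def by blast
  define H where "H = {P * Q | P Q. P \<in> F \<and> Q \<in> G}"
  have "H \<subseteq> (\<Union>k. hom_part k)"
  proof
    fix R assume "R \<in> H"
    then obtain P Q where PQ: "P \<in> F" "Q \<in> G" "R = P * Q" unfolding H_def by blast
    then obtain j k where "P \<in> hom_part j" "Q \<in> hom_part k" using F(1) G(1) by blast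
    then have "R \<in> hom_part (j + k)" using PQ hom_part_mult by blast
    then show "R \<in> (\<Union>k. hom_part k)" by blast
  qed
  moreover have "U \<inter> V = PS d - zero_locus d H"
  proof (intro subset_antisym subsetI)
    fix p assume p: "p \<in> U \<inter> V"
    then have pP: "p \<in> PS d" using F by auto
    obtain P f where P: "P \<in> F" "f \<in> p" "poly_eval P (Poly_Mapping.lookup f) \<noteq> 0"
      using p F by (auto simp: zero_locus_def)
    obtain Q g where Q: "Q \<in> G" "g \<in> p" "poly_eval Q (Poly_Mapping.lookup g) \<noteq> 0"
      using p G by (auto simp: zero_locus_def)
    obtain k where "Q \<in> hom_part k" using Q G by blast
    then have "poly_eval Q (Poly_Mapping.lookup f) \<noteq> 0"
      using PS_eval_zero_iff[OF pP _ P(2) Q(2)] Q by blast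
    then have "poly_eval (P * Q) (Poly_Mapping.lookup f) \<noteq> 0"
      using P by (simp add: poly_eval_mult)
    moreover have "P * Q \<in> H" using P Q H_def by blast
    ultimately show "p \<in> PS d - zero_locus d H"
      using pP P(2) unfolding zero_locus_def by blast
  next
    fix p assume p: "p \<in> PS d - zero_locus d H"
    then obtain P Q f where "P \<in> F" "Q \<in> G" "f \<in> p"
      "poly_eval (P * Q) (Poly_Mapping.lookup f) \<noteq> 0"
      unfolding zero_locus_def H_def by blast
    then show "p \<in> U \<inter> V"
      using p F G by (auto simp: poly_eval_mult zero_locus_def)
  qed
  ultimately show "zariski_open d (U \<inter> V)"
    unfolding zariski_open_def by blast
next
  fix \<U> assume "\<forall>U\<in>\<U>. zariski_open d U"
  then obtain F where F: "\<And>U. U \<in> \<U> \<Longrightarrow> F U \<subseteq> (\<Union>k. hom_part k)"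
     "\<And>U. U \<in> \<U> \<Longrightarrow> U = PS d - zero_locus d (F U)"
    unfolding zariski_open_def by metis
  have "\<Union>\<U> = (\<Union>U\<in>\<U>. PS d - zero_locus d (F U))"
    using F(2) by blast
  also have "\<dots> = PS d - zero_locus d (\<Union>U\<in>\<U>. F U)"
    by (auto simp: zero_locus_def)
  finally have "\<Union>\<U> = PS d - zero_locus d (\<Union>U\<in>\<U>. F U)" .
  moreover have "(\<Union>U\<in>\<U>. F U) \<subseteq> (\<Union>k. hom_part k)"
    using F(1) by (rule UN_least)
  ultimately show "zariski_open d (\<Union>\<U>)"
    unfolding zariski_open_def by (intro exI conjI)
qed

lemma openin_zariski: "openin (zariski d) = zariski_open d"
  by (simp add: zariski_def istopology_zariski_open)

lemma poly_point_nonempty: "poly_point f \<noteq> {}"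
  by (auto simp: proj_point_def intro: exI[of _ 1])

lemma topspace_zariski [simp]: "topspace (zariski d) = PS d"
proof -
  have "zero_locus d {1} = {}"
    using poly_point_nonempty by (auto simp: zero_locus_def PS_def)
  then have "zariski_open d (PS d)"
    unfolding zariski_open_def using one_in_hom_part by (intro exI[of _ "{1}"]) auto
  moreover have "U \<subseteq> PS d" if "zariski_open d U" for U
    using that unfolding zariski_open_def by blast
  ultimately show ?thesis
    unfolding topspace_def openin_zariski by blast
qed

lemma closedin_zariski:
  "closedin (zariski d) C \<longleftrightarrow> (\<exists>F. F \<subseteq> (\<Union>k. hom_part k) \<and> C = zero_locus d F)"
proof -
  have "zero_locus d F \<subseteq> PS d" for F by (auto simp: zero_locus_def)
  then show ?thesis
    unfolding closedin_def openin_zariski topspace_zariski zariski_open_def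
    by (metis Diff_Diff_Int inf.absorb_iff2)
qed

end

theory Submission
  imports Defs "HOL-Computational_Algebra.Polynomial"
begin

text \<open>
  Four distinct lines are of one of three types: no three of them are concurrent, exactly three
  are, or all four are (\<open>arrangement_4_cases\<close>). The multiple points are then six
  double points, or a triple point and three double points, or one quadruple point, so that $\tau$
  is $6$, $7$ or $9$; in particular the list is complete because it exhausts $A(4)$
  (\<open>arr_4\<close>).

  \<^emph>\<open>Freeness.\<close> An element of $AR(f)$ is a derivation \<open>v\<close> with
  \<open>v(f) = 0\<close>. For $f = l_0 l_1 l_2 l_3$ with distinct lines, unique factorisation
  shows that this happens exactly when each $l_i$ divides $v(l_i) = l_i g_i$ and $g_0 + g_1 + g_2
  + g_3 = 0$ (\<open>der_prod4_eq_0_iff\<close>). As \<open>v\<close> is determined by its values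
  on three independent linear forms, it remains to solve the linear relations between the $l_i$
  for the $g_i$. Concurrent lines reduce this to syzygies of two linear forms and give two free
  generators (\<open>free_triple4\<close>, \<open>free_pencil4\<close>). For generic lines one may
  take $l_3 = l_0 + l_1 + l_2$; then the vector of the $g_i - g_3$ is an arbitrary syzygy of
  $(l_0, l_1, l_2)$, and the Koszul complex is the resolution (\<open>nearly_free_sum4\<close>).

  \<^emph>\<open>Openness.\<close> The second partial derivatives of a quartic with a triple point
  all vanish there, so they do not span the space of quadrics; for generic lines they do. Hence
  $A(4,6)$ is the part of $A(4)$ where the catalecticant determinant does not vanish
  (\<open>openin_arr_tau_4_6\<close>).

  \<^emph>\<open>Irreducibility and dimension.\<close> Each stratum is the image of a nonempty
  open set of parameters under a polynomial map, and a set is irreducible if any two of its points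
  lie on a polynomial curve almost all of whose points belong to it, because a polynomial in one
  variable has finitely many roots (\<open>irreducible_in_param\<close>). Imposing linear
  conditions on the parameters one after another gives a flag of irreducible subsets, told apart
  by the values of \<open>f\<close> at suitable points, and their closures bound the Krull
  dimension from below (\<open>krull_dim_flag\<close>). For the upper bound, a chain $Z_0 \subset
  \dots \subset Z_n$ provides \<open>n + 1\<close> forms of a common degree that are algebraically
  independent on $Z_n$ (\<open>flag_monomials_independent\<close>), hence about $K^n$ linearly
  independent forms of degree proportional to \<open>K\<close>. Pulled back to the parameters
  these are multihomogeneous, and the dimension of that space of multihomogeneous polynomials is
  bounded by a polynomial in \<open>K\<close> of degree $8$, $7$ or $6$
  (\<open>krull_dim_le\<close>).
\<close>

section \<open>Constants, linear forms and homogeneous parts\<close>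

abbreviation "lookup \<equiv> Poly_Mapping.lookup"
abbreviation "keys \<equiv> Poly_Mapping.keys"
abbreviation "single \<equiv> Poly_Mapping.single"

abbreviation con :: "complex \<Rightarrow> 'v cpoly" where
  "con c \<equiv> single 0 c"

definition var :: "'v \<Rightarrow> 'v cpoly" where
  "var i = single (single i 1) 1"

lemma con_add: "con (a + b) = con a + con b"
  by (rule single_add)

lemma con_mult: "con (a * b) = con a * con b"
  by (simp add: mult_single)

lemma con_uminus: "con (- a) = - con a"
  by (rule single_uminus)

lemma con_diff: "con (a - b) = con a - con b"
  by (rule single_diff)

lemmas con_simps = con_add con_mult con_uminus con_diff

lemma con_eq_0_iff [simp]: "con c = 0 \<longleftrightarrow> c = 0"
  by (metis lookup_single_eq single_zero lookup_zero)

lemma con_inverse_mult: "c \<noteq> 0 \<Longrightarrow> con (inverse c) * con c = 1"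
  by (simp flip: con_mult)

lemma hom_part_0 [simp]: "0 \<in> hom_part k"
  by (simp add: hom_part_def)

lemma hom_part_add: "P \<in> hom_part k \<Longrightarrow> Q \<in> hom_part k \<Longrightarrow> P + Q \<in> hom_part k"
  using keys_add[of P Q] by (auto simp: hom_part_def)

lemma hom_part_uminus: "P \<in> hom_part k \<Longrightarrow> - P \<in> hom_part k"
  by (auto simp: hom_part_def in_keys_iff)

lemma hom_part_diff: "P \<in> hom_part k \<Longrightarrow> Q \<in> hom_part k \<Longrightarrow> P - Q \<in> hom_part k"
  using hom_part_add[of P k "- Q"] hom_part_uminus[of Q k] by simp

lemma hom_part_sum: "(\<And>i. i \<in> I \<Longrightarrow> P i \<in> hom_part k) \<Longrightarrow> (\<Sum>i\<in>I. P i) \<in> hom_part k"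
  by (induction I rule: infinite_finite_induct) (auto intro: hom_part_add)

lemma hom_part_con: "con c \<in> hom_part 0"
  by (auto simp: hom_part_def mon_degree_def)

lemma hom_part_con_mult: "P \<in> hom_part k \<Longrightarrow> con c * P \<in> hom_part k"
  using hom_part_mult[OF hom_part_con[of c], of P k] by simp

lemma mon_degree_single: "mon_degree (single i n) = n"
  by (simp add: mon_degree_def)

lemma hom_part_var: "var i \<in> hom_part 1"
  by (auto simp: hom_part_def var_def mon_degree_single)

lemma hom_part_power: "P \<in> hom_part k \<Longrightarrow> P ^ n \<in> hom_part (int n * k)"
proof (induction n)
  case 0
  then show ?case by (simp add: one_in_hom_part)
next
  case (Suc n)
  then show ?case
    using hom_part_mult[of P k "P ^ n" "int n * k"] by (simp add: algebra_simps)
qed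

lemma hom_part_neg: "k < 0 \<Longrightarrow> hom_part k = {0}"
  unfolding hom_part_def
  by (auto simp: set_eq_iff in_keys_iff intro!: poly_mapping_eqI)

lemma poly_eval_uminus: "poly_eval (- P) x = - poly_eval P x"
  using poly_eval_add[of P "- P" x] by (simp add: eq_neg_iff_add_eq_0 add.commute)

lemma poly_eval_diff: "poly_eval (P - Q) x = poly_eval P x - poly_eval Q x"
  using poly_eval_add[of P "- Q" x] by (simp add: poly_eval_uminus)

lemma poly_eval_con [simp]: "poly_eval (con c) x = c"
  by (simp add: poly_eval_single mon_eval_def)

lemma poly_eval_var [simp]: "poly_eval (var i) x = x i"
  by (simp add: var_def poly_eval_single mon_eval_def)

lemma poly_eval_power: "poly_eval (P ^ n) x = poly_eval P x ^ n"
  by (induction n) (auto simp: poly_eval_mult)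

lemma poly_eval_prod: "poly_eval (\<Prod>i\<in>I. P i) x = (\<Prod>i\<in>I. poly_eval (P i) x)"
  by (induction I rule: infinite_finite_induct) (auto simp: poly_eval_mult)

lemmas poly_eval_simps = poly_eval_add poly_eval_mult poly_eval_diff poly_eval_uminus

text \<open>The dual pairing of covectors \<open>u\<close>, the coefficients of linear forms, with
  vectors: bilinear, unlike the Hermitian inner product.\<close>

definition bil :: "complex ^ 3 \<Rightarrow> complex ^ 3 \<Rightarrow> complex" where
  "bil u v = u $ 1 * v $ 1 + u $ 2 * v $ 2 + u $ 3 * v $ 3"

definition crs :: "complex ^ 3 \<Rightarrow> complex ^ 3 \<Rightarrow> complex ^ 3" where
  "crs u v = vector [u $ 2 * v $ 3 - u $ 3 * v $ 2, u $ 3 * v $ 1 - u $ 1 * v $ 3,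
     u $ 1 * v $ 2 - u $ 2 * v $ 1]"

definition det3 :: "complex ^ 3 \<Rightarrow> complex ^ 3 \<Rightarrow> complex ^ 3 \<Rightarrow> complex" where
  "det3 u v w = bil (crs u v) w"

definition lin :: "complex ^ 3 \<Rightarrow> S" where
  "lin u = con (u $ 1) * var 1 + con (u $ 2) * var 2 + con (u $ 3) * var 3"

lemma crs_nth [simp]:
  "crs u v $ 1 = u $ 2 * v $ 3 - u $ 3 * v $ 2"
  "crs u v $ 2 = u $ 3 * v $ 1 - u $ 1 * v $ 3"
  "crs u v $ 3 = u $ 1 * v $ 2 - u $ 2 * v $ 1"
  by (simp_all add: crs_def)

lemma vec3_eq_iff: "(u :: 'a ^ 3) = v \<longleftrightarrow> u $ 1 = v $ 1 \<and> u $ 2 = v $ 2 \<and> u $ 3 = v $ 3"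
  by (simp add: vec_eq_iff forall_3)

lemma poly_eval_lin [simp]: "poly_eval (lin u) (($) v) = bil u v"
  by (simp add: lin_def bil_def poly_eval_simps)

lemma hom_part_lin: "lin u \<in> hom_part 1"
  unfolding lin_def by (intro hom_part_add hom_part_con_mult hom_part_var)

lemma single_1_eq_iff: "single i (Suc 0) = single j (Suc 0) \<longleftrightarrow> i = j"
  by (metis One_nat_def lookup_single_eq lookup_single_not_eq zero_neq_one)

lemma lookup_lin: "lookup (lin u) (single i 1) = u $ i"
  using exhaust_3[of i]
  by (auto simp: lin_def var_def lookup_add mult_single lookup_single when_def single_1_eq_iff)

lemma mon_eqI3:
  fixes m n :: "3 \<Rightarrow>\<^sub>0 nat"
  assumes "lookup m 1 = lookup n 1"
    "lookup m 2 = lookup n 2"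
    "lookup m 3 = lookup n 3"
  shows "m = n"
  by (rule poly_mapping_eqI) (use assms in \<open>metis exhaust_3\<close>)

lemma mon_degree_3:
  fixes m :: "3 \<Rightarrow>\<^sub>0 nat"
  shows "mon_degree m = lookup m 1 + lookup m 2 + lookup m 3"
  by (subst mon_degree_superset[of UNIV]) (auto simp: sum_3)

lemma mon_degree_1_cases:
  fixes m :: "3 \<Rightarrow>\<^sub>0 nat"
  assumes "mon_degree m = 1"
  obtains i where "m = single i 1"
proof -
  have "m = single 1 1 \<or> m = single 2 1 \<or> m = single 3 1"
    using assms unfolding mon_degree_3
    by (auto intro!: mon_eqI3 simp: lookup_single)
  then show ?thesis using that by blast
qed

lemma hom_part_1_lin:
  assumes "l \<in> hom_part 1"
  obtains u where "l = lin u"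
proof -
  define u where "u = (\<chi> i. lookup l (single i 1))"
  have "l = lin u"
  proof (rule poly_mapping_eqI)
    fix m
    show "lookup l m = lookup (lin u) m"
    proof (cases "mon_degree m = 1")
      case True
      then obtain i where "m = single i 1" by (rule mon_degree_1_cases)
      then show ?thesis by (simp only: lookup_lin) (simp add: u_def)
    next
      case False
      then have "m \<notin> keys l" "m \<notin> keys (lin u)"
        using assms hom_part_lin[of u] by (auto simp: hom_part_def)
      then show ?thesis by (simp add: in_keys_iff)
    qed
  qed
  then show ?thesis by (rule that)
qed

lemma lin_inj: "lin u = lin v \<longleftrightarrow> u = v"
  by (metis lookup_lin vec_eq_iff)

lemma lin_0 [simp]: "lin 0 = 0"
  by (simp add: lin_def)

lemma lin_eq_0_iff [simp]: "lin u = 0 \<longleftrightarrow> u = 0"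
  using lin_inj[of u 0] by simp

lemma lin_add: "lin (u + v) = lin u + lin v"
  by (simp add: lin_def con_simps algebra_simps)

lemma lin_scale: "lin (c *s u) = con c * lin u"
  by (simp add: lin_def con_simps algebra_simps)

lemma poly_scale_lin: "poly_scale c (lin u) = lin (c *s u)"
  by (simp add: poly_scale_def lin_scale)

section \<open>Partial derivatives\<close>

lemma pd_superset:
  assumes "finite A" "keys P \<subseteq> A"
  shows "pd i P = (\<Sum>m\<in>A. single (m - single i 1)
     (of_nat (lookup m i) * lookup P m))"
  unfolding pd_def by (rule sum.mono_neutral_left) (use assms in \<open>auto simp: in_keys_iff\<close>)

lemma pd_add: "pd i (P + Q) = pd i P + pd i Q"
proof -
  let ?A = "keys P \<union> keys Q"
  have "keys (P + Q) \<subseteq> ?A" by (rule keys_add)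
  then show ?thesis
    using pd_superset[of ?A P i] pd_superset[of ?A Q i] pd_superset[of ?A "P + Q" i]
    by (simp add: lookup_add algebra_simps single_add sum.distrib)
qed

lemma pd_0 [simp]: "pd i 0 = 0"
  by (simp add: pd_def)

lemma pd_sum: "pd i (\<Sum>j\<in>J. P j) = (\<Sum>j\<in>J. pd i (P j))"
  by (induction J rule: infinite_finite_induct) (auto simp: pd_add)

lemma pd_single: "pd i (single m c) =
    single (m - single i 1) (of_nat (lookup m i) * c)"
  by (subst pd_superset[of "{m}"]) auto

lemma pd_mult_single:
  "pd i (single m c * single n d) =
     pd i (single m c) * single n d +
     single m c * pd i (single n d)"
proof -
  let ?s = "single i (1::nat)"
  have shift: "(a + b) - ?s = (a - ?s) + b" if "lookup a i \<noteq> 0" for a b :: "'a \<Rightarrow>\<^sub>0 nat"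
    by (rule poly_mapping_eqI)
       (use that in \<open>auto simp: lookup_add lookup_minus lookup_single when_def\<close>)
  have "single ((m - ?s) + n) (of_nat (lookup m i) * (c * d)) =
      single ((m + n) - ?s) (of_nat (lookup m i) * (c * d))"
    by (cases "lookup m i = 0") (simp_all add: shift del: One_nat_def)
  moreover have "single (m + (n - ?s)) (of_nat (lookup n i) * (c * d)) =
      single ((m + n) - ?s) (of_nat (lookup n i) * (c * d))"
    using shift[of n m] by (cases "lookup n i = 0") (simp_all add: add.commute del: One_nat_def)
  ultimately show ?thesis
    by (simp add: pd_single mult_single lookup_add algebra_simps single_add del: One_nat_def)
qed

lemma pd_mult: "pd i (P * Q) = pd i P * Q + P * pd i Q"
proof -
  let ?s = "\<lambda>P m. single m (lookup P m)"
  let ?P = "\<Sum>m\<in>keys P. ?s P m" and ?Q = "\<Sum>n\<in>keys Q. ?s Q n"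
  have "pd i (?P * ?Q) = pd i ?P * ?Q + ?P * pd i ?Q"
    unfolding sum_product pd_sum pd_mult_single sum.distrib ..
  then show ?thesis
    by (simp flip: cpoly_expand)
qed

lemma pd_con [simp]: "pd i (con c) = 0"
  by (simp add: pd_single)

lemma pd_var: "pd i (var j) = (if i = j then 1 else 0)"
  by (simp add: var_def pd_single lookup_single)

lemma pd_lin [simp]: "pd i (lin u) = con (u $ i)"
  using exhaust_3[of i] by (auto simp: lin_def pd_add pd_mult pd_var)

lemma lookup_pd:
  "lookup (pd i P) m =
     of_nat (Suc (lookup m i)) * lookup P (m + single i 1)"
proof -
  let ?s = "single i (1::nat)"
  have eq: "(n - ?s = m \<and> lookup n i \<noteq> 0) \<longleftrightarrow> n = m + ?s" for n
  proof
    assume "n - ?s = m \<and> lookup n i \<noteq> 0"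
    then show "n = m + ?s"
      by (intro poly_mapping_eqI) (auto simp: lookup_add lookup_minus lookup_single when_def)
  qed (auto simp: lookup_add)
  have "lookup (pd i P) m = (\<Sum>n\<in>keys P.
      if n = m + ?s then of_nat (lookup n i) * lookup P n else 0)"
    unfolding pd_def lookup_sum lookup_single when_def
  proof (intro sum.cong refl)
    fix n
    show "(if n - ?s = m then of_nat (lookup n i) * lookup P n else 0) =
      (if n = m + ?s then of_nat (lookup n i) * lookup P n else 0)"
      using eq[of n] by (cases "lookup n i = 0") (auto simp del: One_nat_def)
  qed
  also have "\<dots> = of_nat (Suc (lookup m i)) * lookup P (m + ?s)"
    by (simp add: lookup_add in_keys_iff del: One_nat_def)
  finally show ?thesis .
qed

lemma hom_part_pd: "P \<in> hom_part k \<Longrightarrow> pd i P \<in> hom_part (k - 1)"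
  unfolding hom_part_def
proof (intro CollectI ballI)
  fix m assume P: "P \<in> {P. \<forall>m\<in>keys P. int (mon_degree m) = k}"
    and "m \<in> keys (pd i P)"
  then have "m + single i 1 \<in> keys P"
    by (simp add: in_keys_iff lookup_pd del: One_nat_def)
  then have "int (mon_degree (m + single i 1)) = k" using P by blast
  then show "int (mon_degree m) = k - 1"
    by (simp add: mon_degree_add mon_degree_single)
qed

section \<open>Substitution\<close>

definition psubst :: "('v \<Rightarrow> 'w cpoly) \<Rightarrow> 'v cpoly \<Rightarrow> 'w cpoly" where
  "psubst g P = (\<Sum>m\<in>keys P. con (lookup P m) *
     (\<Prod>i\<in>keys m. g i ^ lookup m i))"

lemma psubst_superset:
  assumes "finite A" "keys P \<subseteq> A"
  shows "psubst g P = (\<Sum>m\<in>A. con (lookup P m) *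
     (\<Prod>i\<in>keys m. g i ^ lookup m i))"
  unfolding psubst_def by (rule sum.mono_neutral_left) (use assms in \<open>auto simp: in_keys_iff\<close>)

lemma psubst_add: "psubst g (P + Q) = psubst g P + psubst g Q"
proof -
  let ?A = "keys P \<union> keys Q"
  have "keys (P + Q) \<subseteq> ?A" by (rule keys_add)
  then show ?thesis
    using psubst_superset[of ?A P g] psubst_superset[of ?A Q g] psubst_superset[of ?A "P + Q" g]
    by (simp add: lookup_add con_simps algebra_simps sum.distrib)
qed

lemma psubst_0 [simp]: "psubst g 0 = 0"
  by (simp add: psubst_def)

lemma psubst_sum: "psubst g (\<Sum>j\<in>J. P j) = (\<Sum>j\<in>J. psubst g (P j))"
  by (induction J rule: infinite_finite_induct) (auto simp: psubst_add)

lemma psubst_single: "psubst g (single m c) =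
    con c * (\<Prod>i\<in>keys m. g i ^ lookup m i)"
  by (subst psubst_superset[of "{m}"]) auto

lemma psubst_mult: "psubst g (P * Q) = psubst g P * psubst g Q"
proof -
  have mon: "(\<Prod>i\<in>keys (m + n). g i ^ lookup (m + n) i) =
     (\<Prod>i\<in>keys m. g i ^ lookup m i) *
     (\<Prod>i\<in>keys n. g i ^ lookup n i)" for m n
  proof -
    let ?A = "keys m \<union> keys n"
    have *: "(\<Prod>i\<in>keys k. g i ^ lookup k i) =
        (\<Prod>i\<in>?A. g i ^ lookup k i)" if "keys k \<subseteq> ?A" for k
      by (rule prod.mono_neutral_left) (use that in \<open>auto simp: in_keys_iff\<close>)
    show ?thesis
      using *[of m] *[of n] *[of "m + n"] keys_add[of m n]
      by (simp add: lookup_add power_add prod.distrib)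
  qed
  let ?s = "\<lambda>P m. single m (lookup P m)"
  let ?P = "\<Sum>m\<in>keys P. ?s P m" and ?Q = "\<Sum>n\<in>keys Q. ?s Q n"
  have "psubst g (?P * ?Q) = psubst g ?P * psubst g ?Q"
    unfolding sum_product psubst_sum mult_single psubst_single mon con_mult
    by (intro sum.cong refl) (simp only: add_0_left con_mult mult_ac)
  then show ?thesis
    by (simp flip: cpoly_expand)
qed

lemma psubst_con [simp]: "psubst g (con c) = con c"
  by (simp add: psubst_single)

lemma psubst_var [simp]: "psubst g (var i) = g i"
  by (simp add: var_def psubst_single)

text \<open>Substitution respects congruence modulo an ideal. Applied to a substitution that is the
  identity modulo \<open>l\<close>, this produces a normal form modulo \<open>l\<close> and replaces
  division with remainder.\<close>

lemma psubst_cong_mod: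
  fixes l :: "'v cpoly"
  assumes "\<And>i. l dvd g i - var i"
  shows "l dvd psubst g P - P"
proof -
  have mon: "l dvd (\<Prod>i\<in>keys m. g i ^ lookup m i) - single m 1" for m
  proof -
    have pow: "l dvd a ^ n - b ^ n" if "l dvd a - b" for a b :: "'v cpoly" and n
    proof (induction n)
      case (Suc n)
      have "a ^ Suc n - b ^ Suc n = a * (a ^ n - b ^ n) + (a - b) * b ^ n"
        by (simp add: algebra_simps)
      then show ?case using Suc that by (simp del: power_Suc)
    qed simp
    have pr: "l dvd (\<Prod>i\<in>A. a i) - (\<Prod>i\<in>A. b i)" if "\<And>i. l dvd a i - b i" "finite A"
      for a b :: "'v \<Rightarrow> 'v cpoly" and A
      using that(2)
    proof induction
      case (insert i A)
      have "(\<Prod>i\<in>insert i A. a i) - (\<Prod>i\<in>insert i A. b i) =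
          a i * ((\<Prod>i\<in>A. a i) - (\<Prod>i\<in>A. b i)) + (a i - b i) * (\<Prod>i\<in>A. b i)"
        using insert by (simp add: algebra_simps)
      then show ?case using insert that(1) by simp
    qed simp
    have "single m 1 = (\<Prod>i\<in>keys m. var i ^ lookup m i)"
    proof -
      have p: "var i ^ n = single (single i n) (1::complex)" for i :: 'v and n
        by (induction n) (auto simp: var_def mult_single simp flip: single_add)
      have q: "(\<Prod>i\<in>A. single (h i) (1::complex)) = single (\<Sum>i\<in>A. h i) 1"
        if "finite A" for A and h :: "'v \<Rightarrow> 'v \<Rightarrow>\<^sub>0 nat"
        using that by induction (auto simp: mult_single)
      have "m = (\<Sum>i\<in>keys m. single i (lookup m i))"
        by (rule poly_mapping_eqI) (auto simp: lookup_sum lookup_single when_def in_keys_iff)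
      then show ?thesis by (simp add: p q)
    qed
    then show ?thesis using pr[OF pow[OF assms]] by simp
  qed
  have "psubst g P - P = psubst g P - (\<Sum>m\<in>keys P. single m (lookup P m))"
    by (simp flip: cpoly_expand)
  also have "\<dots> = (\<Sum>m\<in>keys P. con (lookup P m) *
     ((\<Prod>i\<in>keys m. g i ^ lookup m i) - single m 1))"
    unfolding psubst_def sum_subtractf[symmetric] by (simp add: algebra_simps mult_single)
  finally show ?thesis
    by (simp add: dvd_sum dvd_mult mon)
qed

section \<open>Forms on irreducible subsets of projective space\<close>

definition vanish :: "(3 \<Rightarrow>\<^sub>0 nat) cpoly \<Rightarrow> S set set \<Rightarrow> bool" where
  "vanish P Z \<longleftrightarrow> (\<forall>p\<in>Z. \<forall>f\<in>p. poly_eval P (lookup f) = 0)"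

lemma mon_degree_eq_0_iff: "mon_degree m = 0 \<longleftrightarrow> m = 0"
  by (auto simp: mon_degree_def in_keys_iff intro!: poly_mapping_eqI)

lemma hom_part_0_con:
  assumes "P \<in> hom_part 0"
  shows "P = con (lookup P 0)"
proof (rule poly_mapping_eqI)
  fix m
  have "m = 0" if "lookup P m \<noteq> 0"
    using assms that by (auto simp: hom_part_def in_keys_iff mon_degree_eq_0_iff)
  then show "lookup P m = lookup (con (lookup P 0)) m"
    by (cases "m = 0") (auto simp: lookup_single when_def)
qed

lemma vanish_mono: "vanish P Z \<Longrightarrow> Y \<subseteq> Z \<Longrightarrow> vanish P Y"
  by (auto simp: vanish_def)

lemma mem_zero_locus: "p \<in> zero_locus d F \<longleftrightarrow> p \<in> PS d \<and> (\<forall>P\<in>F. vanish P {p})"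
  by (auto simp: zero_locus_def vanish_def)

lemma zero_locus_vanish: "Z \<subseteq> zero_locus d F \<longleftrightarrow> Z \<subseteq> PS d \<and> (\<forall>P\<in>F. vanish P Z)"
  by (auto simp: zero_locus_def vanish_def)

lemma closedin_zero_locus:
  "F \<subseteq> (\<Union>k. hom_part k) \<Longrightarrow> closedin (zariski d) (zero_locus d F)"
  by (auto simp: closedin_zariski)

lemma self_in_poly_point: "f \<in> poly_point f"
  unfolding proj_point_def
  by (intro CollectI exI[of _ 1]) (simp add: poly_scale_def)

lemma vanish_poly_point:
  assumes "poly_point f \<in> PS d" "P \<in> hom_part k"
  shows "vanish P {poly_point f} \<longleftrightarrow> poly_eval P (lookup f) = 0"
  using PS_eval_zero_iff[OF assms _ self_in_poly_point] self_in_poly_point[of f]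
  unfolding vanish_def by blast

lemma irreducible_in_point:
  assumes "irreducible_in (zariski d) Z"
  obtains p f where "p \<in> Z" "p \<in> PS d" "p = poly_point f" "f \<noteq> 0" "f \<in> p"
proof -
  obtain p where "p \<in> Z" "p \<in> PS d" using assms by (auto simp: irreducible_in_def)
  moreover from this obtain f where "p = poly_point f" "f \<noteq> 0" unfolding PS_def by blast
  ultimately show ?thesis using that self_in_poly_point by blast
qed

text \<open>The homogeneous coordinate ring of an irreducible set has no zero divisors: the zero
  loci of the two factors cover the set.\<close>

lemma irreducible_vanish_mult:
  assumes irr: "irreducible_in (zariski d) Z"
    and P: "P \<in> hom_part j" and Q: "Q \<in> hom_part k" and PQ: "vanish (P * Q) Z"
  shows "vanish P Z \<or> vanish Q Z"
proof -
  have sub: "Z \<subseteq> PS d" using irr by (auto simp: irreducible_in_def)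
  have "Z \<subseteq> zero_locus d {P} \<union> zero_locus d {Q}"
  proof
    fix p assume p: "p \<in> Z"
    then have pP: "p \<in> PS d" using sub by auto
    then obtain f where f: "p = poly_point f" by (auto simp: PS_def)
    have "poly_eval (P * Q) (lookup f) = 0"
      using PQ p self_in_poly_point[of f] unfolding vanish_def f by blast
    then show "p \<in> zero_locus d {P} \<union> zero_locus d {Q}"
      using vanish_poly_point[OF pP[unfolded f] P] vanish_poly_point[OF pP[unfolded f] Q] pP
      unfolding mem_zero_locus Un_iff poly_eval_mult f by (metis mult_eq_0_iff singletonD)
  qed
  moreover have "closedin (zariski d) (zero_locus d {P})" "closedin (zariski d) (zero_locus d {Q})"
    using P Q by (auto intro!: closedin_zero_locus)
  ultimately have "Z \<subseteq> zero_locus d {P} \<or> Z \<subseteq> zero_locus d {Q}"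
    using irr unfolding irreducible_in_def by blast
  then show ?thesis by (auto simp: zero_locus_vanish)
qed

lemma irreducible_vanish_power:
  assumes irr: "irreducible_in (zariski d) Z" and P: "P \<in> hom_part k" and "vanish (P ^ n) Z"
  shows "vanish P Z"
  using assms(3)
proof (induction n)
  case 0
  obtain p f where "p \<in> Z" "f \<in> p" using irreducible_in_point[OF irr] by blast
  with 0 have False by (auto simp: vanish_def)
  then show ?case ..
next
  case (Suc n)
  then show ?case
    using irreducible_vanish_mult[OF irr P hom_part_power[OF P], of n] by auto
qed

text \<open>Irreducibility is intrinsic, so that it can be tested in the projective space
  itself.\<close>

lemma irreducible_in_subtopology:
  assumes "Z \<subseteq> A"
  shows "irreducible_in (subtopology T A) Z \<longleftrightarrow> irreducible_in T Z"
  unfolding irreducible_in_def closedin_subtopology topspace_subtopology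
proof (intro conj_cong iffI allI impI)
  fix C D
  assume *: "\<forall>C D. (\<exists>T'. closedin T T' \<and> C = T' \<inter> A) \<longrightarrow> (\<exists>T'. closedin T T' \<and> D = T' \<inter> A) \<longrightarrow>
    Z \<subseteq> C \<union> D \<longrightarrow> Z \<subseteq> C \<or> Z \<subseteq> D" and "closedin T C" "closedin T D" "Z \<subseteq> C \<union> D"
  then have "Z \<subseteq> C \<inter> A \<or> Z \<subseteq> D \<inter> A"
    using assms by (intro *[rule_format]) blast+
  then show "Z \<subseteq> C \<or> Z \<subseteq> D" by blast
next
  fix C D
  assume *: "\<forall>C D. closedin T C \<longrightarrow> closedin T D \<longrightarrow> Z \<subseteq> C \<union> D \<longrightarrow> Z \<subseteq> C \<or> Z \<subseteq> D"
    and "\<exists>T'. closedin T T' \<and> C = T' \<inter> A" "\<exists>T'. closedin T T' \<and> D = T' \<inter> A" "Z \<subseteq> C \<union> D"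
  then obtain C' D' where "closedin T C'" "closedin T D'" "C = C' \<inter> A" "D = D' \<inter> A" by blast
  then show "Z \<subseteq> C \<or> Z \<subseteq> D"
    using *[rule_format, of C' D'] \<open>Z \<subseteq> C \<union> D\<close> assms by blast
qed (use assms in auto)

lemma irreducible_in_closure:
  assumes "irreducible_in T Y"
  shows "irreducible_in T (T closure_of Y)"
proof -
  have "Y \<subseteq> T closure_of Y" using assms by (simp add: closure_of_subset irreducible_in_def)
  then show ?thesis
    using assms closure_of_minimal[of Y _ T] closure_of_subset_topspace[of T Y]
    unfolding irreducible_in_def by (metis subset_empty subset_trans)
qed

section \<open>Bounding the Krull dimension from above\<close>

text \<open>The monomial $\prod_i G_i^{j_i} H^{K - j_i}$, where the list holds the exponents
  $j_{n-1}, \dots, j_0$. The powers of \<open>H\<close> make all monomials with exponents at most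
  \<open>K\<close> homogeneous of the same degree.\<close>

fun flag_monomial :: "(nat \<Rightarrow> 'v cpoly) \<Rightarrow> 'v cpoly \<Rightarrow> nat \<Rightarrow> nat list \<Rightarrow> 'v cpoly" where
  "flag_monomial G H K [] = 1"
| "flag_monomial G H K (j # js) = flag_monomial G H K js * (H ^ (K - j) * G (length js) ^ j)"

definition exps :: "nat \<Rightarrow> nat \<Rightarrow> nat list set" where
  "exps K n = {js. set js \<subseteq> {..K} \<and> length js = n}"

lemma finite_exps: "finite (exps K n)"
  unfolding exps_def by (rule finite_lists_length_eq) simp

lemma card_exps: "card (exps K n) = (K + 1) ^ n"
  unfolding exps_def by (subst card_lists_length_eq) auto

lemma sum_exps_Suc:
  "(\<Sum>js\<in>exps K (Suc n). h js) = (\<Sum>j\<le>K. \<Sum>js\<in>exps K n. h (j # js))"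
proof -
  have "exps K (Suc n) = (\<lambda>(j, js). j # js) ` ({..K} \<times> exps K n)"
    by (auto simp: exps_def image_iff length_Suc_conv)
  moreover have "inj_on (\<lambda>(j, js). j # js) ({..K} \<times> exps K n)" by (auto simp: inj_on_def)
  ultimately show ?thesis
    by (simp add: sum.reindex sum.cartesian_product comp_def case_prod_unfold)
qed

lemma hom_part_flag_monomial:
  assumes "\<And>i. i < n \<Longrightarrow> G i \<in> hom_part e" "H \<in> hom_part e" "js \<in> exps K n"
  shows "flag_monomial G H K js \<in> hom_part (int (n * K) * e)"
  using assms(1,3)
proof (induction js arbitrary: n)
  case Nil
  then show ?case by (auto simp: exps_def one_in_hom_part)
next
  case (Cons j js)
  then obtain m where m: "n = Suc m" "length js = m" "js \<in> exps K m" "j \<le> K"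
    by (auto simp: exps_def)
  have "flag_monomial G H K js \<in> hom_part (int (m * K) * e)"
    using Cons m by auto
  moreover have "H ^ (K - j) \<in> hom_part (int (K - j) * e)" using assms(2) by (rule hom_part_power)
  moreover have "G m ^ j \<in> hom_part (int j * e)" using Cons.prems(1) m by (intro hom_part_power) auto
  ultimately have "flag_monomial G H K (j # js) \<in>
     hom_part (int (m * K) * e + (int (K - j) * e + int j * e))"
    by (simp add: m) (intro hom_part_mult)
  moreover have "int (m * K) * e + (int (K - j) * e + int j * e) = int (n * K) * e"
    using m by (simp add: algebra_simps of_nat_diff)
  ultimately show ?case by simp
qed

text \<open>Forms $G_i$ that separate the consecutive members of a chain of irreducible sets are
  algebraically independent on the last member. Order a vanishing combination by powers of the last
  form: its lowest part is divisible by a power of that form, which can be cancelled since the large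
  set is irreducible, and on the next smaller set only the coefficient of that power survives, to
  which the induction hypothesis applies.\<close>

lemma flag_monomials_independent:
  assumes irr: "\<And>i. i \<le> n \<Longrightarrow> irreducible_in (zariski d) (Z i)"
    and sub: "\<And>i. i < n \<Longrightarrow> Z i \<subseteq> Z (Suc i)"
    and G: "\<And>i. i < n \<Longrightarrow> G i \<in> hom_part e" "\<And>i. i < n \<Longrightarrow> vanish (G i) (Z i)"
      "\<And>i. i < n \<Longrightarrow> \<not> vanish (G i) (Z (Suc i))"
    and H: "H \<in> hom_part e" "\<not> vanish H (Z 0)"
  shows "vanish (\<Sum>js\<in>exps K n. con (c js) * flag_monomial G H K js) (Z n) \<Longrightarrow>
     js \<in> exps K n \<Longrightarrow> c js = 0"
  using irr sub G
proof (induction n arbitrary: c js)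
  case 0
  have "irreducible_in (zariski d) (Z 0)" using 0 by auto
  then obtain p f where p: "p \<in> Z 0" "f \<in> p" by (rule irreducible_in_point)
  moreover have "exps K 0 = {[]}" by (auto simp: exps_def)
  ultimately show ?case using 0(1,2) p by (auto simp: vanish_def poly_eval_mult)
next
  case (Suc n)
  define R where "R j = (\<Sum>js\<in>exps K n. con (c (j # js)) * flag_monomial G H K js)" for j
  have H0: "\<not> vanish H (Z n)"
  proof -
    have "Z 0 \<subseteq> Z i" if "i \<le> n" for i
      using that by (induction i) (use Suc.prems(4) in \<open>auto simp: subset_iff\<close>)
    then show ?thesis using H(2) vanish_mono by blast
  qed
  have R_hom: "R j \<in> hom_part (int (n * K) * e)" for j
    unfolding R_def
    by (intro hom_part_sum hom_part_con_mult hom_part_flag_monomial H Suc.prems) auto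
  have split: "(\<Sum>js\<in>exps K (Suc n). con (c js) * flag_monomial G H K js) =
      (\<Sum>j\<le>K. R j * H ^ (K - j) * G n ^ j)"
    unfolding sum_exps_Suc R_def sum_distrib_right
    by (intro sum.cong refl) (auto simp: exps_def mult.assoc)
  have zero: "\<forall>js\<in>exps K n. c (j # js) = 0" if "j \<le> K" for j
    using that
  proof (induction j rule: less_induct)
    case (less j)
    \<comment> \<open>What remains after cancelling the power \<open>j\<close> of the last form.\<close>
    define T where "T = (\<Sum>i\<in>{j..K}. R i * H ^ (K - i) * G n ^ (i - j))"
    have "R i = 0" if "i < j" for i
      using less that unfolding R_def by (intro sum.neutral) auto
    then have "(\<Sum>i\<le>K. R i * H ^ (K - i) * G n ^ i) = (\<Sum>i\<in>{j..K}. R i * H ^ (K - i) * G n ^ i)"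
      by (intro sum.mono_neutral_right) auto
    also have "\<dots> = G n ^ j * T"
      unfolding T_def sum_distrib_left
      by (intro sum.cong refl) (auto simp: algebra_simps simp flip: power_add)
    finally have "vanish (G n ^ j * T) (Z (Suc n))" using Suc.prems(1) split by simp
    moreover have "G n ^ j \<in> hom_part (int j * e)" using Suc.prems by (intro hom_part_power) auto
    moreover have "T \<in> hom_part (int (n * K) * e + int (K - j) * e)"
      unfolding T_def
    proof (intro hom_part_sum)
      fix i assume i: "i \<in> {j..K}"
      have "R i * H ^ (K - i) * G n ^ (i - j) \<in>
          hom_part (int (n * K) * e + int (K - i) * e + int (i - j) * e)"
        using Suc.prems by (intro hom_part_mult hom_part_power R_hom H) auto
      moreover have "int (n * K) * e + int (K - i) * e + int (i - j) * e =
          int (n * K) * e + int (K - j) * e"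
        using i by (simp add: algebra_simps of_nat_diff)
      ultimately show "R i * H ^ (K - i) * G n ^ (i - j) \<in>
          hom_part (int (n * K) * e + int (K - j) * e)" by (simp only:)
    qed
    moreover have "\<not> vanish (G n ^ j) (Z (Suc n))"
      using irreducible_vanish_power[of d "Z (Suc n)" "G n" e j] Suc.prems by auto
    ultimately have "vanish T (Z (Suc n))"
      using irreducible_vanish_mult[of d "Z (Suc n)"] Suc.prems(3)[of "Suc n"] by blast
    then have "vanish T (Z n)" using vanish_mono Suc.prems(4) by blast
    moreover have "poly_eval T (lookup f) = poly_eval (R j * H ^ (K - j)) (lookup f)"
      if "f \<in> p" "p \<in> Z n" for f p
    proof -
      have "poly_eval (G n) (lookup f) = 0"
        using Suc.prems(6)[of n] that by (auto simp: vanish_def)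
      then have "poly_eval T (lookup f) = (\<Sum>i\<in>{j..K}.
          poly_eval (R i * H ^ (K - i)) (lookup f) * 0 ^ (i - j))"
        unfolding T_def poly_eval_sum by (intro sum.cong refl) (simp add: poly_eval_mult poly_eval_power)
      also have "\<dots> = (\<Sum>i\<in>{j}. poly_eval (R i * H ^ (K - i)) (lookup f) * 0 ^ (i - j))"
        using less.prems by (intro sum.mono_neutral_right) auto
      finally show ?thesis by simp
    qed
    ultimately have "vanish (R j * H ^ (K - j)) (Z n)" by (auto simp: vanish_def)
    then have "vanish (R j) (Z n) \<or> vanish (H ^ (K - j)) (Z n)"
      using Suc.prems(3)[of n] by (intro irreducible_vanish_mult[OF _ R_hom hom_part_power[OF H(1)]]) auto
    then have "vanish (R j) (Z n)"
      using irreducible_vanish_power[of d "Z n" H e "K - j"] Suc.prems H H0 by auto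
    then show ?case
      unfolding R_def using Suc.IH[of "\<lambda>js. c (j # js)"] Suc.prems by auto
  qed
  obtain j js' where "js = j # js'" "js' \<in> exps K n" "j \<le> K"
    using Suc.prems(2) by (auto simp: exps_def length_Suc_conv)
  then show ?case using zero by auto
qed

lemma more_unknowns_than_equations:
  fixes a :: "'i \<Rightarrow> 'e \<Rightarrow> complex"
  assumes "finite E" "finite I" "card E < card I"
  shows "\<exists>c. (\<exists>i\<in>I. c i \<noteq> 0) \<and> (\<forall>e\<in>E. (\<Sum>i\<in>I. c i * a i e) = 0)"
  using assms
proof (induction E arbitrary: I a rule: finite_induct)
  case empty
  then show ?case by (intro exI[of _ "\<lambda>_. 1"]) (auto simp: card_gt_0_iff)
next
  case (insert e0 E)
  show ?case
  proof (cases "\<forall>i\<in>I. a i e0 = 0")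
    case True
    have "card E < card I" using insert by auto
    then obtain c where "\<exists>i\<in>I. c i \<noteq> 0" "\<forall>e\<in>E. (\<Sum>i\<in>I. c i * a i e) = 0"
      using insert.IH[of I a] insert.prems by auto
    then show ?thesis using True by (intro exI[of _ c]) auto
  next
    case False
    then obtain i0 where i0: "i0 \<in> I" "a i0 e0 \<noteq> 0" by auto
    define r where "r i = a i e0 / a i0 e0" for i
    have "card E < card (I - {i0})" using insert i0 by auto
    then obtain c where c: "\<exists>i\<in>I - {i0}. c i \<noteq> 0"
      "\<forall>e\<in>E. (\<Sum>i\<in>I - {i0}. c i * (a i e - r i * a i0 e)) = 0"
      using insert.IH[of "I - {i0}" "\<lambda>i e. a i e - r i * a i0 e"] insert.prems by auto
    define c' where "c' i = (if i = i0 then - (\<Sum>i\<in>I - {i0}. c i * r i) else c i)" for i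
    have *: "(\<Sum>i\<in>I. c' i * a i e) = (\<Sum>i\<in>I - {i0}. c i * (a i e - r i * a i0 e))" for e
    proof -
      have "(\<Sum>i\<in>I. c' i * a i e) = c' i0 * a i0 e + (\<Sum>i\<in>I - {i0}. c' i * a i e)"
        using insert.prems i0 by (simp add: sum.remove)
      also have "(\<Sum>i\<in>I - {i0}. c' i * a i e) = (\<Sum>i\<in>I - {i0}. c i * a i e)"
        by (intro sum.cong) (auto simp: c'_def)
      finally show ?thesis
        by (simp add: c'_def algebra_simps sum_subtractf sum_distrib_left)
    qed
    have "\<exists>i\<in>I. c' i \<noteq> 0" using c(1) by (auto simp: c'_def)
    moreover have "(\<Sum>i\<in>I. c' i * a i e0) = 0" using i0 unfolding * by (simp add: r_def)
    ultimately show ?thesis using c(2) * by (intro exI[of _ c']) auto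
  qed
qed

definition monf :: "nat \<Rightarrow> (nat \<Rightarrow> nat) \<Rightarrow> (nat \<Rightarrow> complex) \<Rightarrow> complex" where
  "monf N e \<theta> = (\<Prod>j<N. \<theta> j ^ e j)"

text \<open>The linear span of the parameter monomials with exponents in \<open>D\<close>; for
  infinite \<open>D\<close> this is the zero space, as the sum is then \<open>0\<close>.\<close>

definition monspan :: "nat \<Rightarrow> (nat \<Rightarrow> nat) set \<Rightarrow> ((nat \<Rightarrow> complex) \<Rightarrow> complex) set" where
  "monspan N D = {g. \<exists>a. \<forall>\<theta>. g \<theta> = (\<Sum>e\<in>D. a e * monf N e \<theta>)}"

lemma monspan_add: "g \<in> monspan N D \<Longrightarrow> h \<in> monspan N D \<Longrightarrow> (\<lambda>\<theta>. g \<theta> + h \<theta>) \<in> monspan N D"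
proof -
  assume "g \<in> monspan N D" "h \<in> monspan N D"
  then obtain a b where "\<forall>\<theta>. g \<theta> = (\<Sum>e\<in>D. a e * monf N e \<theta>)" "\<forall>\<theta>. h \<theta> = (\<Sum>e\<in>D. b e * monf N e \<theta>)"
    unfolding monspan_def by blast
  then have "\<forall>\<theta>. g \<theta> + h \<theta> = (\<Sum>e\<in>D. (a e + b e) * monf N e \<theta>)"
    by (simp add: algebra_simps sum.distrib)
  then show ?thesis unfolding monspan_def by (intro CollectI exI[of _ "\<lambda>e. a e + b e"])
qed

lemma monspan_scale: "g \<in> monspan N D \<Longrightarrow> (\<lambda>\<theta>. c * g \<theta>) \<in> monspan N D"
proof -
  assume "g \<in> monspan N D"
  then obtain a where "\<forall>\<theta>. g \<theta> = (\<Sum>e\<in>D. a e * monf N e \<theta>)"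
    unfolding monspan_def by blast
  then have "\<forall>\<theta>. c * g \<theta> = (\<Sum>e\<in>D. (c * a e) * monf N e \<theta>)"
    by (simp add: sum_distrib_left algebra_simps)
  then show ?thesis unfolding monspan_def by (intro CollectI exI[of _ "\<lambda>e. c * a e"])
qed

lemma monspan_0: "(\<lambda>\<theta>. 0) \<in> monspan N D"
  unfolding monspan_def by (intro CollectI exI[of _ "\<lambda>_. 0"]) auto

lemma monspan_sum:
  "(\<And>i. i \<in> I \<Longrightarrow> g i \<in> monspan N D) \<Longrightarrow> (\<lambda>\<theta>. \<Sum>i\<in>I. g i \<theta>) \<in> monspan N D"
  by (induction I rule: infinite_finite_induct) (auto intro: monspan_add monspan_0)

lemma monspan_monf: "finite D \<Longrightarrow> e \<in> D \<Longrightarrow> monf N e \<in> monspan N D"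
  unfolding monspan_def
  by (intro CollectI exI[of _ "\<lambda>e'. if e' = e then 1 else 0"])
     (simp add: if_distrib[of "\<lambda>x. x * _"] cong: if_cong)

lemma monspan_mult:
  assumes g: "g \<in> monspan N D" and h: "h \<in> monspan N D'"
    and D: "finite D''" "\<And>e e'. e \<in> D \<Longrightarrow> e' \<in> D' \<Longrightarrow> (\<lambda>j. e j + e' j) \<in> D''"
  shows "(\<lambda>\<theta>. g \<theta> * h \<theta>) \<in> monspan N D''"
proof -
  obtain a b where ab: "\<forall>\<theta>. g \<theta> = (\<Sum>e\<in>D. a e * monf N e \<theta>)" "\<forall>\<theta>. h \<theta> = (\<Sum>e\<in>D'. b e * monf N e \<theta>)"
    using g h unfolding monspan_def by blast
  have "(\<lambda>\<theta>. g \<theta> * h \<theta>) = (\<lambda>\<theta>. \<Sum>e\<in>D. \<Sum>e'\<in>D'. (a e * b e') * monf N (\<lambda>j. e j + e' j) \<theta>)"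
    using ab by (simp add: sum_product monf_def power_add prod.distrib mult_ac)
  moreover have "\<dots> \<in> monspan N D''"
    by (intro monspan_sum monspan_scale monspan_monf D)
  ultimately show ?thesis by simp
qed

text \<open>If the exponent sets are graded additively and the coordinates of \<open>F\<close> have
  degree one, then a form of degree \<open>k\<close> in these coordinates has degree
  \<open>k\<close> as a function of the parameters.\<close>

lemma monspan_form:
  assumes E: "\<And>k. finite (E k)" "(\<lambda>_. 0) \<in> E 0"
      "\<And>j k e e'. e \<in> E j \<Longrightarrow> e' \<in> E k \<Longrightarrow> (\<lambda>i. e i + e' i) \<in> E (j + k)"
    and F: "\<And>m. (\<lambda>\<theta>. F \<theta> m) \<in> monspan N (E 1)"
    and P: "P \<in> hom_part (int k)"
  shows "(\<lambda>\<theta>. poly_eval P (F \<theta>)) \<in> monspan N (E k)"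
proof -
  have one: "(\<lambda>\<theta>. 1) \<in> monspan N (E 0)"
    using monspan_monf[OF E(1) E(2), of N] by (simp add: monf_def[abs_def])
  have pow: "(\<lambda>\<theta>. F \<theta> m ^ n) \<in> monspan N (E n)" for m n
  proof (induction n)
    case (Suc n)
    have "(\<lambda>\<theta>. F \<theta> m * F \<theta> m ^ n) \<in> monspan N (E (Suc n))"
      by (rule monspan_mult[OF F Suc E(1)]) (use E(3)[of _ 1 _ n] in simp)
    then show ?case by simp
  qed (simp add: one)
  have pr: "(\<lambda>\<theta>. \<Prod>m\<in>A. F \<theta> m ^ r m) \<in> monspan N (E (\<Sum>m\<in>A. r m))" if "finite A" for A r
    using that
  proof induction
    case (insert m A)
    have "(\<lambda>\<theta>. F \<theta> m ^ r m * (\<Prod>m\<in>A. F \<theta> m ^ r m)) \<in> monspan N (E (r m + (\<Sum>m\<in>A. r m)))"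
      by (rule monspan_mult[OF pow insert.IH E(1)]) (rule E(3))
    then show ?case using insert by simp
  qed (simp add: one)
  show ?thesis
    unfolding poly_eval_def
  proof (intro monspan_sum monspan_scale)
    fix M assume "M \<in> keys P"
    then have "mon_degree M = k" using P by (auto simp: hom_part_def)
    then show "(\<lambda>\<theta>. mon_eval M (F \<theta>)) \<in> monspan N (E k)"
      using pr[of "keys M" "lookup M"]
      by (simp add: mon_eval_def mon_degree_def)
  qed
qed

text \<open>A chain of length \<open>n\<close> yields $(K+1)^n$ independent forms of a degree
  proportional to \<open>K\<close>. Their pullbacks along \<open>\<Phi>\<close> lie in a space of
  dimension $O(K^r)$, and a linear relation between the pullbacks is a relation on the whole set,
  hence on the chain. Comparing the growth in \<open>K\<close> gives $n \le r$. The map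
  \<open>\<Phi>\<close> may take values outside of \<open>X\<close>, which keeps degenerate
  parameters harmless.\<close>

lemma krull_dim_le:
  fixes \<Phi> :: "(nat \<Rightarrow> complex) \<Rightarrow> S"
  assumes X: "X \<subseteq> PS d"
    and cover: "\<And>p. p \<in> X \<Longrightarrow> \<exists>\<theta>. p = poly_point (\<Phi> \<theta>)"
    and E: "\<And>k. finite (E k)" "(\<lambda>_. 0) \<in> E 0"
      "\<And>j k e e'. e \<in> E j \<Longrightarrow> e' \<in> E k \<Longrightarrow> (\<lambda>i. e i + e' i) \<in> E (j + k)"
    and card: "\<And>k. card (E k) \<le> (c * k + 1) ^ r"
    and F: "\<And>m. (\<lambda>\<theta>. lookup (\<Phi> \<theta>) m) \<in> monspan N (E 1)"
  shows "krull_dim (subtopology (zariski d) X) \<le> enat r"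
  unfolding krull_dim_def
proof (rule Sup_least, clarify)
  fix n Z
  assume Z: "\<forall>i\<le>n. closedin (subtopology (zariski d) X) (Z i) \<and> irreducible_in (subtopology (zariski d) X) (Z i)"
    and strict: "\<forall>i<n. Z i \<subset> Z (Suc i)"
  have ZX: "Z i \<subseteq> X" if "i \<le> n" for i
    using Z that closedin_subset[of "subtopology (zariski d) X" "Z i"] X by auto
  have irr: "irreducible_in (zariski d) (Z i)" if "i \<le> n" for i
    using Z that irreducible_in_subtopology[OF ZX[OF that]] by blast
  have sep: "\<exists>P. \<exists>k>0. P \<in> hom_part (int k) \<and> vanish P (Z i) \<and> \<not> vanish P (Z (Suc i))" if i: "i < n" for i
  proof -
    obtain F where F: "F \<subseteq> (\<Union>k. hom_part k)" "Z i = zero_locus d F \<inter> X"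
      using Z i unfolding closedin_subtopology closedin_zariski by (metis less_imp_le)
    have "\<not> Z (Suc i) \<subseteq> zero_locus d F" using strict[rule_format, OF i] F(2) ZX[of "Suc i"] i by auto
    then obtain P where P: "P \<in> F" "\<not> vanish P (Z (Suc i))"
      using irr[of "Suc i"] i by (auto simp: zero_locus_vanish irreducible_in_def)
    have van: "vanish P (Z i)" using F P irr[of i] i
      using zero_locus_vanish[of "Z i" d F] by auto
    obtain k where k: "P \<in> hom_part k" using P F by blast
    have "k > 0"
    proof (rule ccontr)
      assume "\<not> k > 0"
      have "P \<noteq> 0" using P by (auto simp: vanish_def)
      then have "k = 0" using k hom_part_neg[of k] \<open>\<not> k > 0\<close> by (cases "k < 0") auto
      obtain a where a: "P = con a" using hom_part_0_con k \<open>k = 0\<close> by blast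
      obtain p f where "p \<in> Z i" "f \<in> p"
        using irreducible_in_point[OF irr[of i]] i by (metis less_imp_le)
      then have "a = 0" using van by (auto simp: vanish_def a)
      then show False using \<open>P \<noteq> 0\<close> a by simp
    qed
    then show ?thesis using k van P(2)
      by (intro exI[of _ P] exI[of _ "nat k"]) auto
  qed
  then obtain P k where Pk: "\<And>i. i < n \<Longrightarrow> k i > 0 \<and> P i \<in> hom_part (int (k i)) \<and>
      vanish (P i) (Z i) \<and> \<not> vanish (P i) (Z (Suc i))"
    by metis
  \<comment> \<open>Powers bring the separating forms to a common degree, as the flag monomials require.\<close>
  define \<kappa> where "\<kappa> = (\<Prod>i<n. k i)"
  define G where "G i = P i ^ (\<kappa> div k i)" for i
  have \<kappa>: "\<kappa> > 0" using Pk by (auto simp: \<kappa>_def)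
  have dvd: "k i dvd \<kappa>" if "i < n" for i using that by (auto simp: \<kappa>_def)
  have G1: "G i \<in> hom_part (int \<kappa>)" if "i < n" for i
    using hom_part_power[of "P i" "int (k i)" "\<kappa> div k i"] Pk[OF that] dvd[OF that]
    by (simp add: G_def flip: of_nat_mult)
  have G2: "vanish (G i) (Z i)" if i: "i < n" for i
  proof -
    have "\<kappa> div k i > 0" using dvd[OF i] \<kappa> Pk[OF i] by (simp add: dvd_imp_le div_greater_zero_iff)
    then show ?thesis using Pk[OF i] by (auto simp: G_def vanish_def poly_eval_power)
  qed
  have G3: "\<not> vanish (G i) (Z (Suc i))" if i: "i < n" for i
    using irreducible_vanish_power[OF irr[of "Suc i"], of "P i"] i Pk[OF i] by (auto simp: G_def)
  \<comment> \<open>A power of a coordinate that is not zero at some point of the smallest member of the chain.\<close>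
  obtain H where H: "H \<in> hom_part (int \<kappa>)" "\<not> vanish H (Z 0)"
  proof -
    obtain p f where p: "p \<in> Z 0" and f: "p = poly_point f" "f \<noteq> 0"
      by (rule irreducible_in_point[OF irr[of 0, OF le0]])
    have "\<exists>m. lookup f m \<noteq> 0"
    proof (rule ccontr)
      assume "\<not> ?thesis"
      then have "f = 0" by (intro poly_mapping_eqI) simp
      then show False using f(2) by simp
    qed
    then obtain m where m: "lookup f m \<noteq> 0" by blast
    have "poly_eval (var m ^ \<kappa>) (lookup f) \<noteq> 0"
      using m by (simp add: poly_eval_power)
    then have "\<not> vanish (var m ^ \<kappa>) (Z 0)"
      using p self_in_poly_point[of f] unfolding vanish_def f(1) by blast
    then show ?thesis using that[of "var m ^ \<kappa>"] hom_part_power[OF hom_part_var[of m], of \<kappa>] by simp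
  qed
  have pullback: "(\<lambda>\<theta>. poly_eval P (lookup (\<Phi> \<theta>))) \<in> monspan N (E k)"
    if "P \<in> hom_part (int k)" for P k
    by (rule monspan_form[OF E(1) E(2) _ F that]) (rule E(3))
  define C where "C = c * (n * \<kappa>) + 1"
  have growth: "(K + 1) ^ n \<le> (C * (K + 1)) ^ r" for K
  proof -
    have deg: "flag_monomial G H K js \<in> hom_part (int (n * K * \<kappa>))" if "js \<in> exps K n" for js
      using hom_part_flag_monomial[OF G1 H(1) that] by simp
    then have "\<forall>js\<in>exps K n. \<exists>a. \<forall>\<theta>. poly_eval (flag_monomial G H K js) (lookup (\<Phi> \<theta>)) =
        (\<Sum>e\<in>E (n * K * \<kappa>). a e * monf N e \<theta>)"
      using pullback unfolding monspan_def by blast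
    then obtain a where a: "\<And>js \<theta>. js \<in> exps K n \<Longrightarrow>
        poly_eval (flag_monomial G H K js) (lookup (\<Phi> \<theta>)) =
        (\<Sum>e\<in>E (n * K * \<kappa>). a js e * monf N e \<theta>)"
      by metis
    have "\<not> card (E (n * K * \<kappa>)) < card (exps K n)"
    proof
      assume "card (E (n * K * \<kappa>)) < card (exps K n)"
      then obtain b where b: "\<exists>js\<in>exps K n. b js \<noteq> 0"
        "\<forall>e\<in>E (n * K * \<kappa>). (\<Sum>js\<in>exps K n. b js * a js e) = 0"
        using more_unknowns_than_equations[OF E(1) finite_exps] by blast
      let ?Q = "\<Sum>js\<in>exps K n. con (b js) * flag_monomial G H K js"
      have Q0: "poly_eval ?Q (lookup (\<Phi> \<theta>)) = 0" for \<theta>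
      proof -
        have "poly_eval ?Q (lookup (\<Phi> \<theta>)) =
            (\<Sum>js\<in>exps K n. \<Sum>e\<in>E (n * K * \<kappa>). b js * a js e * monf N e \<theta>)"
          by (simp add: poly_eval_sum poly_eval_mult a sum_distrib_left mult.assoc)
        also have "\<dots> = (\<Sum>e\<in>E (n * K * \<kappa>). (\<Sum>js\<in>exps K n. b js * a js e) * monf N e \<theta>)"
          by (subst sum.swap) (simp add: sum_distrib_right)
        also have "\<dots> = 0" using b(2) by simp
        finally show ?thesis .
      qed
      have Qh: "?Q \<in> hom_part (int (n * K * \<kappa>))"
        by (intro hom_part_sum hom_part_con_mult deg)
      have "vanish ?Q {p}" if p: "p \<in> Z n" for p
      proof -
        have pX: "p \<in> X" using p ZX[of n] by auto
        then obtain \<theta> where "p = poly_point (\<Phi> \<theta>)" using cover by blast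
        then show ?thesis using vanish_poly_point[OF _ Qh] Q0 pX X by blast
      qed
      then have "vanish ?Q (Z n)" by (auto simp: vanish_def)
      then have "b js = 0" if "js \<in> exps K n" for js
        using flag_monomials_independent[where n = n and Z = Z and G = G and e = "int \<kappa>" and H = H
            and K = K and c = b and js = js and d = d] irr strict G1 G2 G3 H that
        by auto
      then show False using b(1) by blast
    qed
    then have "(K + 1) ^ n \<le> (c * (n * K * \<kappa>) + 1) ^ r"
      using card[of "n * K * \<kappa>"] by (simp add: card_exps)
    also have "\<dots> \<le> (C * (K + 1)) ^ r"
      by (intro power_mono) (auto simp: C_def algebra_simps)
    finally show ?thesis .
  qed
  show "enat n \<le> enat r"
  proof (rule ccontr)
    assume "\<not> enat n \<le> enat r"
    then have "Suc r \<le> n" by simp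
    \<comment> \<open>For this \<open>K\<close> the factor $C^r$ is smaller than $K + 1$.\<close>
    define K where "K = C ^ r"
    have "(K + 1) ^ r * (K + 1) = (K + 1) ^ Suc r" by simp
    also have "\<dots> \<le> (K + 1) ^ n" using \<open>Suc r \<le> n\<close> by (intro power_increasing) auto
    also have "\<dots> \<le> (C * (K + 1)) ^ r" by (rule growth)
    also have "\<dots> = (K + 1) ^ r * K" by (simp only: K_def power_mult_distrib mult.commute)
    finally show False by simp
  qed
qed

section \<open>Rational curves, irreducibility and a lower bound for the Krull dimension\<close>

text \<open>Polynomiality along lines is all that the irreducibility proof uses of a polynomial
  function, and it is evidently stable under ring operations.\<close>

definition linepoly :: "((nat \<Rightarrow> complex) \<Rightarrow> complex) \<Rightarrow> bool" where
  "linepoly g \<longleftrightarrow> (\<forall>a b. \<exists>p. \<forall>t. g (\<lambda>j. (1 - t) * a j + t * b j) = poly p t)"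

lemma linepoly_const: "linepoly (\<lambda>_. c)"
  unfolding linepoly_def by (intro allI exI[of _ "[:c:]"]) simp

lemma linepoly_coord: "linepoly (\<lambda>\<theta>. \<theta> j)"
  unfolding linepoly_def
proof (intro allI)
  fix a b :: "nat \<Rightarrow> complex"
  show "\<exists>p. \<forall>t. (1 - t) * a j + t * b j = poly p t"
    by (intro exI[of _ "[:a j, b j - a j:]"]) (simp add: algebra_simps)
qed

lemma linepoly_add: "linepoly g \<Longrightarrow> linepoly h \<Longrightarrow> linepoly (\<lambda>\<theta>. g \<theta> + h \<theta>)"
  unfolding linepoly_def by (metis poly_add)

lemma linepoly_mult: "linepoly g \<Longrightarrow> linepoly h \<Longrightarrow> linepoly (\<lambda>\<theta>. g \<theta> * h \<theta>)"
  unfolding linepoly_def by (metis poly_mult)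

lemma linepoly_diff: "linepoly g \<Longrightarrow> linepoly h \<Longrightarrow> linepoly (\<lambda>\<theta>. g \<theta> - h \<theta>)"
  unfolding linepoly_def by (metis poly_diff)

lemma linepoly_sum: "(\<And>i. i \<in> I \<Longrightarrow> linepoly (g i)) \<Longrightarrow> linepoly (\<lambda>\<theta>. \<Sum>i\<in>I. g i \<theta>)"
  by (induction I rule: infinite_finite_induct) (auto intro: linepoly_add linepoly_const)

lemma linepoly_prod: "(\<And>i. i \<in> I \<Longrightarrow> linepoly (g i)) \<Longrightarrow> linepoly (\<lambda>\<theta>. \<Prod>i\<in>I. g i \<theta>)"
  by (induction I rule: infinite_finite_induct) (auto intro: linepoly_mult linepoly_const)

lemma linepoly_power: "linepoly g \<Longrightarrow> linepoly (\<lambda>\<theta>. g \<theta> ^ n)"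
  by (induction n) (auto intro: linepoly_mult linepoly_const)

lemma linepoly_monspan:
  assumes "g \<in> monspan N D"
  shows "linepoly g"
proof -
  obtain a where "g = (\<lambda>\<theta>. \<Sum>e\<in>D. a e * monf N e \<theta>)" using assms by (auto simp: monspan_def)
  then show ?thesis
    unfolding monf_def
    by (auto intro!: linepoly_sum linepoly_mult linepoly_prod linepoly_power linepoly_const linepoly_coord)
qed

lemma linepoly_poly_eval:
  assumes "\<And>m. linepoly (\<lambda>\<theta>. F \<theta> m)"
  shows "linepoly (\<lambda>\<theta>. poly_eval P (F \<theta>))"
  unfolding poly_eval_def mon_eval_def
  by (intro linepoly_sum linepoly_mult linepoly_prod linepoly_power linepoly_const assms)

text \<open>If \<open>Y\<close> is covered by two closed sets but by neither alone, there are a form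
  vanishing on the first set but not at some $\Phi(a)$, and a form vanishing on the second but not
  at some $\Phi(b)$. Neither vanishes identically on the curve that joins the two points, so both
  are nonzero at some point of the curve inside \<open>Y\<close>. The good parameters are those
  where one of the functions in \<open>H\<close> does not vanish.\<close>

lemma irreducible_in_param:
  fixes \<Phi> :: "(nat \<Rightarrow> complex) \<Rightarrow> S"
  assumes F: "\<And>m. linepoly (\<lambda>\<theta>. lookup (\<Phi> \<theta>) m)"
    and A: "\<And>a b t. A a \<Longrightarrow> A b \<Longrightarrow> A (\<lambda>j. (1 - t) * a j + t * b j)"
    and H: "\<And>h. h \<in> H \<Longrightarrow> linepoly h"
    and PS: "\<And>\<theta> h. h \<in> H \<Longrightarrow> h \<theta> \<noteq> 0 \<Longrightarrow> poly_point (\<Phi> \<theta>) \<in> PS d"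
    and ex: "A \<theta>0" "h0 \<in> H" "h0 \<theta>0 \<noteq> 0"
  shows "irreducible_in (zariski d) {poly_point (\<Phi> \<theta>) | \<theta>. A \<theta> \<and> (\<exists>h\<in>H. h \<theta> \<noteq> 0)}" (is "irreducible_in _ ?Y")
  unfolding irreducible_in_def
proof (intro conjI allI impI)
  show "?Y \<subseteq> topspace (zariski d)" using PS by auto
  show "?Y \<noteq> {}" using ex by blast
next
  fix C D assume CD: "closedin (zariski d) C" "closedin (zariski d) D" and Y: "?Y \<subseteq> C \<union> D"
  have sep: "\<exists>P k a h. P \<in> hom_part k \<and> vanish P C \<and> A a \<and> h \<in> H \<and> h a \<noteq> 0 \<and>
     poly_eval P (lookup (\<Phi> a)) \<noteq> 0"
    if cl: "closedin (zariski d) C" and sub: "\<not> ?Y \<subseteq> C" for C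
  proof -
    obtain F where F: "F \<subseteq> (\<Union>k. hom_part k)" "C = zero_locus d F"
      using cl unfolding closedin_zariski by metis
    obtain a h where a: "A a" "h \<in> H" "h a \<noteq> 0" "poly_point (\<Phi> a) \<notin> C" using sub by blast
    have pa: "poly_point (\<Phi> a) \<in> PS d" using PS a by blast
    obtain P where P: "P \<in> F" "\<not> vanish P {poly_point (\<Phi> a)}"
      using a(4) pa F(2) by (auto simp: mem_zero_locus)
    obtain k where k: "P \<in> hom_part k" using F P by blast
    have "poly_eval P (lookup (\<Phi> a)) \<noteq> 0"
      using P(2) vanish_poly_point[OF pa k] by simp
    moreover have "vanish P C" using F(2) P(1) by (auto simp: zero_locus_def vanish_def)
    ultimately show ?thesis using a k by blast
  qed
  show "?Y \<subseteq> C \<or> ?Y \<subseteq> D"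
  proof (rule ccontr)
    assume *: "\<not> (?Y \<subseteq> C \<or> ?Y \<subseteq> D)"
    obtain P j a h where P: "P \<in> hom_part j" "vanish P C" "A a" "h \<in> H" "h a \<noteq> 0"
      "poly_eval P (lookup (\<Phi> a)) \<noteq> 0"
      using sep[OF CD(1)] * by blast
    obtain Q k b where Q: "Q \<in> hom_part k" "vanish Q D" "A b"
      "poly_eval Q (lookup (\<Phi> b)) \<noteq> 0"
      using sep[OF CD(2)] * by blast
    \<comment> \<open>Along the line from \<open>a\<close> to \<open>b\<close> the two forms and \<open>h\<close> become nonzero polynomials in \<open>t\<close>,
      so some \<open>t\<close> is a root of none of them.\<close>
    define \<gamma> where "\<gamma> t = (\<lambda>j. (1 - t) * a j + t * b j)" for t
    have \<gamma>01: "\<gamma> 0 = a" "\<gamma> 1 = b" by (auto simp: \<gamma>_def)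
    obtain p where p: "\<And>t. poly_eval P (lookup (\<Phi> (\<gamma> t))) = poly p t"
      using linepoly_poly_eval[of "\<lambda>\<theta>. lookup (\<Phi> \<theta>)" P] F
      unfolding linepoly_def \<gamma>_def by blast
    obtain q where q: "\<And>t. poly_eval Q (lookup (\<Phi> (\<gamma> t))) = poly q t"
      using linepoly_poly_eval[of "\<lambda>\<theta>. lookup (\<Phi> \<theta>)" Q] F
      unfolding linepoly_def \<gamma>_def by blast
    obtain r where r: "\<And>t. h (\<gamma> t) = poly r t"
      using H[OF P(4)] unfolding linepoly_def \<gamma>_def by blast
    have "p \<noteq> 0" "q \<noteq> 0" "r \<noteq> 0"
      using p[of 0] q[of 1] r[of 0] P(5,6) Q(4) by (auto simp: \<gamma>01)
    then have "finite {t. poly (p * q * r) t = 0}" by (intro poly_roots_finite) auto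
    then obtain t where t: "poly (p * q * r) t \<noteq> 0"
      using infinite_UNIV_char_0[where 'a = complex] by (metis (mono_tags) UNIV_eq_I mem_Collect_eq)
    have "poly_point (\<Phi> (\<gamma> t)) \<in> ?Y"
      using A[OF P(3) Q(3), of t, folded \<gamma>_def] t P(4) r[of t] by (intro CollectI exI[of _ "\<gamma> t"] conjI bexI[of _ h]) auto
    then have "poly_point (\<Phi> (\<gamma> t)) \<in> C \<or> poly_point (\<Phi> (\<gamma> t)) \<in> D" using Y by blast
    then have "poly_eval P (lookup (\<Phi> (\<gamma> t))) = 0 \<or>
       poly_eval Q (lookup (\<Phi> (\<gamma> t))) = 0"
      using P(2) Q(2) self_in_poly_point by (auto simp: vanish_def)
    then show False using t p q by auto
  qed
qed

text \<open>The members of the flag need not be closed: their closures are still irreducible, and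
  the separating forms keep them distinct.\<close>

lemma krull_dim_ge:
  assumes irr: "\<And>i. i \<le> n \<Longrightarrow> irreducible_in (zariski d) (Y i)"
    and X: "\<And>i. i \<le> n \<Longrightarrow> Y i \<subseteq> X" "X \<subseteq> PS d"
    and sub: "\<And>i. i < n \<Longrightarrow> Y i \<subseteq> Y (Suc i)"
    and P: "\<And>i. i < n \<Longrightarrow> P i \<in> hom_part (k i)" "\<And>i. i < n \<Longrightarrow> vanish (P i) (Y i)"
      "\<And>i. i < n \<Longrightarrow> \<not> vanish (P i) (Y (Suc i))"
  shows "enat n \<le> krull_dim (subtopology (zariski d) X)"
proof -
  let ?T = "subtopology (zariski d) X"
  define Z where "Z i = ?T closure_of (Y i)" for i
  have YZ: "Y i \<subseteq> Z i" if "i \<le> n" for i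
    unfolding Z_def using X(1)[of i] X(2) that by (intro closure_of_subset) auto
  have "closedin ?T (Z i) \<and> irreducible_in ?T (Z i)" if "i \<le> n" for i
    unfolding Z_def
    using irreducible_in_closure irreducible_in_subtopology[OF X(1)[OF that]] irr[OF that]
    by (metis closedin_closure_of)
  moreover have "Z i \<subset> Z (Suc i)" if i: "i < n" for i
  proof
    show "Z i \<subseteq> Z (Suc i)" unfolding Z_def using sub[OF i] by (rule closure_of_mono)
    have "closedin ?T (X \<inter> zero_locus d {P i})"
      using P(1)[OF i] by (intro closedin_subtopology_Int_closed closedin_zero_locus) auto
    moreover have "Y i \<subseteq> X \<inter> zero_locus d {P i}"
      using X(1)[of i] X(2) P(2)[OF i] i by (auto simp: mem_zero_locus vanish_def)
    ultimately have "Z i \<subseteq> zero_locus d {P i}"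
      unfolding Z_def using closure_of_minimal[of "Y i" "X \<inter> zero_locus d {P i}" ?T] by blast
    moreover have "\<not> Y (Suc i) \<subseteq> zero_locus d {P i}"
      using P(3)[OF i] by (simp add: zero_locus_vanish)
    ultimately show "Z i \<noteq> Z (Suc i)" using YZ[of "Suc i"] i by auto
  qed
  ultimately show ?thesis
    unfolding krull_dim_def by (intro Sup_upper CollectI exI[of _ n] conjI refl exI[of _ Z]) auto
qed

section \<open>Linear forms are prime\<close>

lemma bil_commute: "bil u v = bil v u"
  by (simp add: bil_def mult.commute)

lemma bil_add: "bil (u + w) v = bil u v + bil w v" "bil v (u + w) = bil v u + bil v w"
  by (simp_all add: bil_def algebra_simps)

lemma bil_scale: "bil (c *s u) v = c * bil u v" "bil v (c *s u) = c * bil v u"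
  by (simp_all add: bil_def algebra_simps)

lemma bil_0 [simp]: "bil 0 v = 0" "bil v 0 = 0"
  by (simp_all add: bil_def)

lemma bil_crs [simp]: "bil u (crs u v) = 0" "bil v (crs u v) = 0"
  by (simp_all add: bil_def algebra_simps)

lemma crs_0 [simp]: "crs 0 u = 0" "crs u 0 = 0"
  by (simp_all add: vec3_eq_iff)

lemma crs_commute: "crs v u = - crs u v"
  by (simp add: vec3_eq_iff algebra_simps)

lemma crs_eq_0_commute: "crs v u = 0 \<longleftrightarrow> crs u v = 0"
  by (subst crs_commute) simp

lemma crs_lincomb:
  "crs u (a *s u + b *s w) = b *s crs u w" "crs w (a *s u + b *s w) = (- a) *s crs u w"
  "crs (a *s u + b *s w) (c *s u + d *s w) = (a * d - b * c) *s crs u w"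
  by (simp_all add: vec3_eq_iff algebra_simps)

lemma nonzero_bil:
  assumes "u \<noteq> 0"
  obtains n where "bil u n = 1"
proof -
  obtain i where i: "u $ i \<noteq> 0" using assms by (auto simp: vec_eq_iff)
  have "bil u (\<chi> j. if j = i then inverse (u $ i) else 0) = 1"
    using exhaust_3[of i] i by (auto simp: bil_def)
  then show ?thesis by (rule that)
qed

lemma crs_crs: "crs (crs u w) v = bil u v *s w - bil w v *s u"
  by (simp add: vec3_eq_iff bil_def algebra_simps)

lemma crs_eq_0_imp:
  assumes "crs u v = 0" "v \<noteq> 0"
  obtains c where "u = c *s v"
proof -
  obtain n where n: "bil v n = 1" using nonzero_bil[OF assms(2)] .
  have "bil u n *s v - bil v n *s u = 0" using crs_crs[of u v n] assms by simp
  then have "u = bil u n *s v" using n by (simp add: vec3_eq_iff)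
  then show ?thesis by (rule that)
qed

text \<open>The substitution $x \mapsto x - u(x) n$. If $u(n) = 1$, this is a ring endomorphism that
  is the identity modulo \<open>u\<close> and maps \<open>u\<close> to \<open>0\<close>, so its
  kernel is the ideal generated by \<open>u\<close>.\<close>

definition kill :: "complex ^ 3 \<Rightarrow> complex ^ 3 \<Rightarrow> S \<Rightarrow> S" where
  "kill u n = psubst (\<lambda>i. var i - con (n $ i) * lin u)"

lemma kill_lin: "kill u n (lin w) = lin w - con (bil w n) * lin u"
proof -
  have "kill u n (lin w) = con (w $ 1) * (var 1 - con (n $ 1) * lin u) +
      con (w $ 2) * (var 2 - con (n $ 2) * lin u) + con (w $ 3) * (var 3 - con (n $ 3) * lin u)"
    unfolding lin_def[of w] by (simp add: kill_def psubst_add psubst_mult)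
  also have "\<dots> = lin w - con (bil w n) * lin u"
    unfolding lin_def[of w] bil_def by (simp add: con_simps algebra_simps)
  finally show ?thesis .
qed

lemma lin_dvd_iff_kill:
  assumes "bil u n = 1"
  shows "lin u dvd P \<longleftrightarrow> kill u n P = 0"
proof
  assume "lin u dvd P"
  then obtain Q where "P = lin u * Q" ..
  then show "kill u n P = 0"
    using kill_lin[of u n u] assms by (simp add: kill_def psubst_mult)
next
  assume "kill u n P = 0"
  moreover have "lin u dvd kill u n P - P"
    unfolding kill_def by (rule psubst_cong_mod) simp
  ultimately show "lin u dvd P" by simp
qed

text \<open>The quotient by a linear form embeds into the integral domain \<open>S\<close>, as the
  image of \<open>kill\<close>.\<close>

lemma lin_prime:
  assumes "u \<noteq> 0" "lin u dvd P * Q"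
  shows "lin u dvd P \<or> lin u dvd Q"
proof -
  obtain n where n: "bil u n = 1" using nonzero_bil[OF assms(1)] .
  show ?thesis
    using assms(2) unfolding lin_dvd_iff_kill[OF n] by (simp add: kill_def psubst_mult)
qed

lemma lin_dvd_lin:
  assumes "lin u dvd lin w"
  shows "crs u w = 0"
proof -
  obtain Q where Q: "lin w = lin u * Q" using assms ..
  have "bil (crs w u) x = 0" for x
  proof -
    have "bil w (crs u x) = 0"
      using arg_cong[OF Q, of "\<lambda>P. poly_eval P (($) (crs u x))"] by (simp add: poly_eval_mult)
    then show ?thesis by (simp add: bil_def algebra_simps)
  qed
  then have "crs w u = 0" using nonzero_bil by (metis zero_neq_one)
  then show ?thesis by (simp add: crs_eq_0_commute)
qed

lemma lin_not_dvd_lin: "crs u w \<noteq> 0 \<Longrightarrow> \<not> lin u dvd lin w"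
  using lin_dvd_lin by blast

section \<open>Products of four linear forms and their multiple points\<close>

definition prod4 :: "complex ^ 3 \<Rightarrow> complex ^ 3 \<Rightarrow> complex ^ 3 \<Rightarrow> complex ^ 3 \<Rightarrow> S" where
  "prod4 u0 u1 u2 u3 = lin u0 * lin u1 * lin u2 * lin u3"

lemma prod4_swap:
  "prod4 u1 u0 u2 u3 = prod4 u0 u1 u2 u3"
  "prod4 u0 u2 u1 u3 = prod4 u0 u1 u2 u3"
  "prod4 u0 u1 u3 u2 = prod4 u0 u1 u2 u3"
  by (simp_all add: prod4_def mult_ac)

abbreviation vec4 :: "'a \<Rightarrow> 'a \<Rightarrow> 'a \<Rightarrow> 'a \<Rightarrow> nat \<Rightarrow> 'a" where
  "vec4 a b c d i \<equiv> [a, b, c, d] ! i"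

definition distinct_lines :: "(nat \<Rightarrow> complex ^ 3) \<Rightarrow> bool" where
  "distinct_lines U \<longleftrightarrow> (\<forall>i<4. \<forall>j<4. i \<noteq> j \<longrightarrow> crs (U i) (U j) \<noteq> 0)"

lemma distinct_lines_nonzero:
  assumes "distinct_lines U" "i < 4"
  shows "U i \<noteq> 0"
proof -
  have "\<exists>j<4. j \<noteq> i" by (intro exI[of _ "if i = 0 then 1 else 0"]) auto
  then obtain j where "j < 4" "i \<noteq> j" by blast
  then have "crs (U i) (U j) \<noteq> 0" using assms by (auto simp: distinct_lines_def)
  then show ?thesis by auto
qed

lemma all_less_4: "(\<forall>i<4::nat. P i) \<longleftrightarrow> P 0 \<and> P 1 \<and> P 2 \<and> P 3"
  by (auto simp: numeral_eq_Suc less_Suc_eq)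

lemma distinct_lines_vec4:
  "distinct_lines (vec4 u0 u1 u2 u3) \<longleftrightarrow> crs u0 u1 \<noteq> 0 \<and> crs u0 u2 \<noteq> 0 \<and> crs u0 u3 \<noteq> 0 \<and>
     crs u1 u2 \<noteq> 0 \<and> crs u1 u3 \<noteq> 0 \<and> crs u2 u3 \<noteq> 0"
  unfolding distinct_lines_def all_less_4 by (auto simp: crs_eq_0_commute[of u1 u0]
      crs_eq_0_commute[of u2 u0] crs_eq_0_commute[of u3 u0] crs_eq_0_commute[of u2 u1]
      crs_eq_0_commute[of u3 u1] crs_eq_0_commute[of u3 u2])

lemma prod_less_4: "(\<Prod>i<4::nat. h i) = h 0 * h 1 * h 2 * (h 3 :: 'a :: comm_monoid_mult)"
  by (simp add: numeral_eq_Suc)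

lemma prod4_conv: "prod4 u0 u1 u2 u3 = (\<Prod>i<4. lin (vec4 u0 u1 u2 u3 i))"
  unfolding prod_less_4 by (simp add: prod4_def)

lemma arrangement_poly_4_iff:
  "arrangement_poly 4 f \<longleftrightarrow>
     (\<exists>u0 u1 u2 u3. f = prod4 u0 u1 u2 u3 \<and> distinct_lines (vec4 u0 u1 u2 u3))"
proof
  assume "arrangement_poly 4 f"
  then obtain l :: "nat \<Rightarrow> S" where l: "\<forall>i<4. l i \<in> hom_part 1 \<and> l i \<noteq> 0"
    "\<forall>i<4. \<forall>j<4. i \<noteq> j \<longrightarrow> (\<nexists>c. l i = poly_scale c (l j))" "f = (\<Prod>i<4. l i)"
    unfolding arrangement_poly_def by blast
  have "\<forall>i. \<exists>u. i < 4 \<longrightarrow> l i = lin u" using l(1) hom_part_1_lin by metis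
  then obtain U where U: "\<And>i. i < 4 \<Longrightarrow> l i = lin (U i)" by metis
  have "crs (U i) (U j) \<noteq> 0" if "i < 4" "j < 4" "i \<noteq> j" for i j
  proof
    assume "crs (U i) (U j) = 0"
    moreover have "U j \<noteq> 0" using l(1) U that by auto
    ultimately obtain c where "U i = c *s U j" by (rule crs_eq_0_imp)
    then show False using l(2) U that poly_scale_lin[of c "U j"] by metis
  qed
  then have "distinct_lines (vec4 (U 0) (U 1) (U 2) (U 3))"
    unfolding distinct_lines_vec4 by auto
  moreover have "f = prod4 (U 0) (U 1) (U 2) (U 3)"
    unfolding l(3) prod_less_4 prod4_def using U by simp
  ultimately show "\<exists>u0 u1 u2 u3. f = prod4 u0 u1 u2 u3 \<and> distinct_lines (vec4 u0 u1 u2 u3)" by blast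
next
  assume "\<exists>u0 u1 u2 u3. f = prod4 u0 u1 u2 u3 \<and> distinct_lines (vec4 u0 u1 u2 u3)"
  then obtain u0 u1 u2 u3 where f: "f = prod4 u0 u1 u2 u3" and
    dl: "distinct_lines (vec4 u0 u1 u2 u3)" by blast
  let ?U = "vec4 u0 u1 u2 u3"
  have "lin (?U i) \<noteq> poly_scale c (lin (?U j))" if "i < 4" "j < 4" "i \<noteq> j" for i j c
  proof
    assume "lin (?U i) = poly_scale c (lin (?U j))"
    then have "?U i = c *s ?U j" by (simp add: poly_scale_lin lin_inj)
    then have "crs (?U i) (?U j) = 0" by (simp add: vec3_eq_iff algebra_simps)
    then show False using dl that by (auto simp: distinct_lines_def)
  qed
  moreover have "?U i \<noteq> 0" if "i < 4" for i using dl that by (rule distinct_lines_nonzero)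
  ultimately show "arrangement_poly 4 f"
    unfolding arrangement_poly_def f prod4_conv
    by (intro exI[of _ "\<lambda>i. lin (?U i)"]) (auto simp: hom_part_lin)
qed

abbreviation proj2 :: "complex ^ 3 \<Rightarrow> (complex ^ 3) set" where
  "proj2 v \<equiv> proj_point (*s) v"

lemma proj2_scale:
  assumes "c \<noteq> 0"
  shows "proj2 (c *s v) = proj2 v"
proof -
  have "(\<exists>d. w = d *s (c *s v) \<and> d \<noteq> 0) \<longleftrightarrow> (\<exists>d. w = d *s v \<and> d \<noteq> 0)" for w
  proof
    assume "\<exists>d. w = d *s (c *s v) \<and> d \<noteq> 0"
    then obtain d where "w = d *s (c *s v)" "d \<noteq> 0" by blast
    then show "\<exists>d. w = d *s v \<and> d \<noteq> 0" using assms by (intro exI[of _ "d * c"]) auto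
  next
    assume "\<exists>d. w = d *s v \<and> d \<noteq> 0"
    then obtain d where "w = d *s v" "d \<noteq> 0" by blast
    then show "\<exists>d. w = d *s (c *s v) \<and> d \<noteq> 0" using assms by (intro exI[of _ "d / c"]) auto
  qed
  then show ?thesis by (simp add: proj_point_def)
qed

lemma mem_line_of:
  assumes "v \<noteq> 0"
  shows "proj2 v \<in> line_of (lin u) \<longleftrightarrow> bil u v = 0"
proof -
  have "proj2 v \<in> P2" using assms by (auto simp: P2_def)
  then show ?thesis
    unfolding line_of_def proj_point_def
    by (auto simp: bil_scale intro: exI[of _ 1])
qed

lemma common_point:
  assumes "v \<noteq> 0" "bil u v = 0" "bil w v = 0" "crs u w \<noteq> 0"
  shows "proj2 v = proj2 (crs u w)"
proof -
  have "crs (crs u w) v = 0" using assms by (simp add: crs_crs)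
  then obtain c where c: "crs u w = c *s v" using assms(1) by (rule crs_eq_0_imp)
  then have "c \<noteq> 0" using assms(4) by auto
  then show ?thesis by (simp add: c proj2_scale)
qed

lemma line_of_eq_iff:
  assumes "u \<noteq> 0" "w \<noteq> 0"
  shows "line_of (lin u) = line_of (lin w) \<longleftrightarrow> crs u w = 0"
proof
  assume eq: "line_of (lin u) = line_of (lin w)"
  show "crs u w = 0"
  proof (rule ccontr)
    assume "crs u w \<noteq> 0"
    then obtain n where n: "bil (crs w u) n \<noteq> 0"
      by (metis crs_eq_0_commute nonzero_bil zero_neq_one)
    have w: "bil w (crs u n) \<noteq> 0" using n by (simp add: bil_def algebra_simps)
    then have "crs u n \<noteq> 0" by auto
    then show False using eq w mem_line_of[of "crs u n" u] mem_line_of[of "crs u n" w] by simp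
  qed
next
  assume "crs u w = 0"
  then obtain c where c: "u = c *s w" using assms(2) by (rule crs_eq_0_imp)
  then have "c \<noteq> 0" using assms(1) by auto
  then show "line_of (lin u) = line_of (lin w)"
    unfolding line_of_def by (auto simp: c bil_scale)
qed

text \<open>The lines through a point. Each multiple point is determined by this set, since two of
  its elements already have a unique common point.\<close>

definition inc :: "(nat \<Rightarrow> complex ^ 3) \<Rightarrow> complex ^ 3 \<Rightarrow> nat set" where
  "inc U v = {i. i < 4 \<and> bil (U i) v = 0}"

lemma lines_of_prod4:
  assumes dl: "distinct_lines (vec4 u0 u1 u2 u3)"
  shows "lines_of (prod4 u0 u1 u2 u3) = (\<lambda>i. line_of (lin (vec4 u0 u1 u2 u3 i))) ` {..<4}"
    (is "?L = ?R")
proof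
  let ?U = "vec4 u0 u1 u2 u3"
  have nz: "u0 \<noteq> 0" "u1 \<noteq> 0" "u2 \<noteq> 0" "u3 \<noteq> 0" using dl unfolding distinct_lines_vec4 by auto
  have R: "?R = {line_of (lin u0), line_of (lin u1), line_of (lin u2), line_of (lin u3)}"
    by (auto simp: numeral_eq_Suc lessThan_Suc)
  show "?L \<subseteq> ?R"
  proof
    fix L assume "L \<in> ?L"
    then obtain l where l: "L = line_of l" "l \<in> hom_part 1" "l \<noteq> 0" "l dvd prod4 u0 u1 u2 u3"
      by (auto simp: lines_of_def)
    then obtain u where u: "l = lin u" using hom_part_1_lin by metis
    then have "u \<noteq> 0" using l by auto
    then have "lin u dvd lin u0 \<or> lin u dvd lin u1 \<or> lin u dvd lin u2 \<or> lin u dvd lin u3"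
      using l(4) lin_prime unfolding u prod4_def by blast
    then show "L \<in> ?R"
      unfolding R l(1) u using lin_dvd_lin line_of_eq_iff \<open>u \<noteq> 0\<close> nz by blast
  qed
  have "lin u0 dvd prod4 u0 u1 u2 u3" "lin u1 dvd prod4 u0 u1 u2 u3"
     "lin u2 dvd prod4 u0 u1 u2 u3" "lin u3 dvd prod4 u0 u1 u2 u3"
    by (simp_all add: prod4_def dvd_mult dvd_mult2)
  then show "?R \<subseteq> ?L"
    unfolding R lines_of_def using nz hom_part_lin by (auto intro: exI[of _ "lin _"])
qed

text \<open>The sum over the multiple points becomes a sum over incidence sets, which the
  concurrency relations between the four lines determine.\<close>

lemma tjurina_prod4:
  assumes dl: "distinct_lines (vec4 u0 u1 u2 u3)"
  shows "tjurina (prod4 u0 u1 u2 u3) =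
    (\<Sum>s\<in>{inc (vec4 u0 u1 u2 u3) v | v. v \<noteq> 0 \<and> card (inc (vec4 u0 u1 u2 u3) v) \<ge> 2}. (card s - 1)\<^sup>2)"
proof -
  let ?U = "vec4 u0 u1 u2 u3" and ?f = "prod4 u0 u1 u2 u3"
  have nz: "?U i \<noteq> 0" if "i < 4" for i using dl that by (rule distinct_lines_nonzero)
  define N where "N p = {i. i < 4 \<and> p \<in> line_of (lin (?U i))}" for p
  have N: "N (proj2 v) = inc ?U v" if "v \<noteq> 0" for v
    using that by (auto simp: N_def inc_def mem_line_of)
  have inj: "inj_on (\<lambda>i. line_of (lin (?U i))) {..<4}"
    using dl nz by (auto simp: inj_on_def line_of_eq_iff distinct_lines_def)
  have mult: "mult_at ?f p = card (N p)" for p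
  proof -
    have "{L \<in> lines_of ?f. p \<in> L} = (\<lambda>i. line_of (lin (?U i))) ` N p"
      unfolding lines_of_prod4[OF dl] N_def by auto
    moreover have "inj_on (\<lambda>i. line_of (lin (?U i))) (N p)"
      by (rule inj_on_subset[OF inj]) (auto simp: N_def)
    ultimately show ?thesis by (simp add: mult_at_def card_image)
  qed
  have injN: "inj_on N {p \<in> P2. mult_at ?f p \<ge> 2}"
  proof (rule inj_onI)
    fix p q assume p: "p \<in> {p \<in> P2. mult_at ?f p \<ge> 2}" and q: "q \<in> {p \<in> P2. mult_at ?f p \<ge> 2}"
      and eq: "N p = N q"
    obtain v w where vw: "v \<noteq> 0" "p = proj2 v" "w \<noteq> 0" "q = proj2 w"
      using p q by (auto simp: P2_def)
    have "card (N p) \<ge> 2" using p mult by auto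
    then obtain i j where ij: "i \<in> N p" "j \<in> N p" "i \<noteq> j"
      by (metis One_nat_def card.empty card_1_singletonE card_le_Suc0_iff_eq card.infinite not_less_eq_eq numeral_2_eq_2 zero_le)
    have crs: "crs (?U i) (?U j) \<noteq> 0" using ij dl by (auto simp: distinct_lines_def N_def)
    have "bil (?U i) v = 0" "bil (?U j) v = 0" "bil (?U i) w = 0" "bil (?U j) w = 0"
      using ij eq N[OF vw(1)] N[OF vw(3)] unfolding vw inc_def by auto
    then show "p = q" using common_point crs vw by metis
  qed
  have "N ` {p \<in> P2. mult_at ?f p \<ge> 2} = {inc ?U v | v. v \<noteq> 0 \<and> card (inc ?U v) \<ge> 2}"
  proof (intro equalityI subsetI)
    fix s assume "s \<in> {inc ?U v | v. v \<noteq> 0 \<and> card (inc ?U v) \<ge> 2}"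
    then obtain v where "v \<noteq> 0" "s = inc ?U v" "card (inc ?U v) \<ge> 2" by blast
    then show "s \<in> N ` {p \<in> P2. mult_at ?f p \<ge> 2}"
      using N[of v] by (intro image_eqI[of _ _ "proj2 v"]) (auto simp: mult P2_def)
  qed (auto simp: P2_def mult N)
  then have "(\<Sum>s\<in>{inc ?U v | v. v \<noteq> 0 \<and> card (inc ?U v) \<ge> 2}. (card s - 1)\<^sup>2) =
     (\<Sum>p\<in>{p \<in> P2. mult_at ?f p \<ge> 2}. (card (N p) - 1)\<^sup>2)"
    using sum.reindex[OF injN, of "\<lambda>s. (card s - 1)\<^sup>2"] by (simp add: comp_def)
  then show ?thesis by (simp add: tjurina_def mult)
qed

section \<open>The three combinatorial types of four lines\<close>

lemma inc_vec4:
  "inc (vec4 u0 u1 u2 u3) v =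
     (if bil u0 v = 0 then {0} else {}) \<union> (if bil u1 v = 0 then {1} else {}) \<union>
     (if bil u2 v = 0 then {2} else {}) \<union> (if bil u3 v = 0 then {3} else {})"
proof (rule set_eqI)
  fix i :: nat
  consider "i = 0" | "i = 1" | "i = 2" | "i = 3" | "i \<ge> 4" by linarith
  then show "i \<in> inc (vec4 u0 u1 u2 u3) v \<longleftrightarrow> i \<in>
     (if bil u0 v = 0 then {0} else {}) \<union> (if bil u1 v = 0 then {1} else {}) \<union>
     (if bil u2 v = 0 then {2} else {}) \<union> (if bil u3 v = 0 then {3} else {})"
    by cases (auto simp: inc_def)
qed

lemma det3_nonzero:
  assumes "det3 u w z \<noteq> 0" "bil u v = 0" "bil w v = 0" "bil z v = 0"
  shows "v = 0"
proof (rule ccontr)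
  assume "v \<noteq> 0"
  have "crs u w \<noteq> 0" using assms(1) by (auto simp: det3_def)
  have "crs (crs u w) v = 0" using assms by (simp add: crs_crs)
  then obtain c where c: "crs u w = c *s v" using \<open>v \<noteq> 0\<close> by (rule crs_eq_0_imp)
  then have "det3 u w z = 0" using assms(4) by (simp add: det3_def bil_scale bil_commute[of v z])
  then show False using assms(1) by simp
qed

lemma det3_eq_bil: "det3 u w z = bil z (crs u w)" "det3 u w z = bil u (crs w z)"
  "det3 u w z = - bil w (crs u z)"
  by (simp_all add: det3_def bil_def algebra_simps)

lemma det3_crs_nonzero:
  assumes "det3 u w z \<noteq> 0"
  shows "crs u w \<noteq> 0" "crs u z \<noteq> 0" "crs w z \<noteq> 0"
  using assms det3_eq_bil[of u w z] by auto

definition generic4 where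
  "generic4 u0 u1 u2 u3 \<longleftrightarrow> det3 u0 u1 u2 \<noteq> 0 \<and> det3 u0 u1 u3 \<noteq> 0 \<and> det3 u0 u2 u3 \<noteq> 0 \<and> det3 u1 u2 u3 \<noteq> 0"

lemma distinct_lines_generic4: "generic4 u0 u1 u2 u3 \<Longrightarrow> distinct_lines (vec4 u0 u1 u2 u3)"
  unfolding distinct_lines_vec4 generic4_def using det3_crs_nonzero by blast

lemma tjurina_generic4:
  assumes "generic4 u0 u1 u2 u3"
  shows "tjurina (prod4 u0 u1 u2 u3) = 6"
proof -
  let ?U = "vec4 u0 u1 u2 u3"
  let ?S = "{{0, 1}, {0, 2}, {0, 3}, {1, 2}, {1, 3}, {2, 3 :: nat}}"
  have d: "det3 u0 u1 u2 \<noteq> 0" "det3 u0 u1 u3 \<noteq> 0" "det3 u0 u2 u3 \<noteq> 0" "det3 u1 u2 u3 \<noteq> 0"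
    using assms by (auto simp: generic4_def)
  have c: "crs u0 u1 \<noteq> 0" "crs u0 u2 \<noteq> 0" "crs u0 u3 \<noteq> 0" "crs u1 u2 \<noteq> 0" "crs u1 u3 \<noteq> 0" "crs u2 u3 \<noteq> 0"
    using d det3_crs_nonzero by blast+
  have "{inc ?U v | v. v \<noteq> 0 \<and> card (inc ?U v) \<ge> 2} = ?S"
  proof (intro equalityI subsetI)
    fix s assume "s \<in> {inc ?U v | v. v \<noteq> 0 \<and> card (inc ?U v) \<ge> 2}"
    then obtain v where v: "v \<noteq> 0" "card (inc ?U v) \<ge> 2" "s = inc ?U v" by blast
    note nd = det3_nonzero[OF d(1), of v] det3_nonzero[OF d(2), of v] det3_nonzero[OF d(3), of v]
      det3_nonzero[OF d(4), of v]
    show "s \<in> ?S" using v nd unfolding inc_vec4 by (simp split: if_splits) auto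
  next
    fix s assume "s \<in> ?S"
    moreover have "inc ?U (crs u0 u1) = {0, 1}" "inc ?U (crs u0 u2) = {0, 2}" "inc ?U (crs u0 u3) = {0, 3}"
       "inc ?U (crs u1 u2) = {1, 2}" "inc ?U (crs u1 u3) = {1, 3}" "inc ?U (crs u2 u3) = {2, 3}"
      using d det3_eq_bil[of u0 u1 u2] det3_eq_bil[of u0 u1 u3] det3_eq_bil[of u0 u2 u3]
        det3_eq_bil[of u1 u2 u3]
      unfolding inc_vec4 by auto
    moreover have "inc ?U v \<in> {inc ?U v | v. v \<noteq> 0 \<and> card (inc ?U v) \<ge> 2}"
      if "v \<noteq> 0" "card (inc ?U v) \<ge> 2" for v using that by blast
    note this[OF c(1)] this[OF c(2)] this[OF c(3)] this[OF c(4)] this[OF c(5)] this[OF c(6)]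
    ultimately show "s \<in> {inc ?U v | v. v \<noteq> 0 \<and> card (inc ?U v) \<ge> 2}" by auto
  qed
  then show ?thesis
    unfolding tjurina_prod4[OF distinct_lines_generic4[OF assms]]
    by (simp add: doubleton_eq_iff)
qed

definition triple4 where
  "triple4 u0 u1 a b u3 \<longleftrightarrow> det3 u0 u1 u3 \<noteq> 0 \<and> a \<noteq> 0 \<and> b \<noteq> (0::complex)"

lemma distinct_lines_triple4:
  assumes "triple4 u0 u1 a b u3"
  shows "distinct_lines (vec4 u0 u1 (a *s u0 + b *s u1) u3)"
proof -
  have d: "det3 u0 u1 u3 \<noteq> 0" "a \<noteq> 0" "b \<noteq> 0" using assms by (auto simp: triple4_def)
  have "det3 u0 (a *s u0 + b *s u1) u3 = b * det3 u0 u1 u3"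
    by (simp add: det3_def bil_def algebra_simps)
  then have "det3 u0 (a *s u0 + b *s u1) u3 \<noteq> 0" using d by simp
  then show ?thesis
    unfolding distinct_lines_vec4 using d det3_crs_nonzero by (auto simp: crs_lincomb)
qed

lemma tjurina_triple4:
  assumes "triple4 u0 u1 a b u3"
  shows "tjurina (prod4 u0 u1 (a *s u0 + b *s u1) u3) = 7"
proof -
  let ?u2 = "a *s u0 + b *s u1"
  let ?U = "vec4 u0 u1 ?u2 u3"
  let ?S = "{{0, 1, 2}, {0, 3}, {1, 3}, {2, 3 :: nat}}"
  have d: "det3 u0 u1 u3 \<noteq> 0" "a \<noteq> 0" "b \<noteq> 0" using assms by (auto simp: triple4_def)
  have d3: "det3 u0 ?u2 u3 = b * det3 u0 u1 u3" "det3 u1 ?u2 u3 = - a * det3 u0 u1 u3"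
    by (simp_all add: det3_def bil_def algebra_simps)
  have d2: "det3 u0 ?u2 u3 \<noteq> 0" "det3 u1 ?u2 u3 \<noteq> 0" using d d3 by simp_all
  have c: "crs u0 u1 \<noteq> 0" "crs u0 u3 \<noteq> 0" "crs u1 u3 \<noteq> 0" "crs ?u2 u3 \<noteq> 0"
    using d(1) d2 det3_crs_nonzero by blast+
  have bil2: "bil ?u2 v = a * bil u0 v + b * bil u1 v" for v by (simp add: bil_add bil_scale)
  have "{inc ?U v | v. v \<noteq> 0 \<and> card (inc ?U v) \<ge> 2} = ?S"
  proof (intro equalityI subsetI)
    fix s assume "s \<in> {inc ?U v | v. v \<noteq> 0 \<and> card (inc ?U v) \<ge> 2}"
    then obtain v where v: "v \<noteq> 0" "card (inc ?U v) \<ge> 2" "s = inc ?U v" by blast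
    note nd = det3_nonzero[OF d(1), of v]
    show "s \<in> ?S" using v nd d(2,3) unfolding inc_vec4 bil2 by (simp split: if_splits) auto
  next
    fix s assume "s \<in> ?S"
    moreover have "inc ?U (crs u0 u1) = {0, 1, 2}" "inc ?U (crs u0 u3) = {0, 3}"
       "inc ?U (crs u1 u3) = {1, 3}" "inc ?U (crs ?u2 u3) = {2, 3}"
    proof -
      show "inc ?U (crs u0 u1) = {0, 1, 2}" "inc ?U (crs u0 u3) = {0, 3}" "inc ?U (crs u1 u3) = {1, 3}"
        using d det3_eq_bil[of u0 u1 u3] unfolding inc_vec4 bil2 by auto
      show "inc ?U (crs ?u2 u3) = {2, 3}"
        using d2 det3_eq_bil(2)[of u0 ?u2 u3] det3_eq_bil(2)[of u1 ?u2 u3] unfolding inc_vec4 by auto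
    qed
    moreover have "inc ?U v \<in> {inc ?U v | v. v \<noteq> 0 \<and> card (inc ?U v) \<ge> 2}"
      if "v \<noteq> 0" "card (inc ?U v) \<ge> 2" for v using that by blast
    note this[OF c(1)] this[OF c(2)] this[OF c(3)] this[OF c(4)]
    ultimately show "s \<in> {inc ?U v | v. v \<noteq> 0 \<and> card (inc ?U v) \<ge> 2}" by auto
  qed
  moreover have "{0, 1, 2} \<noteq> {x, 3::nat}" for x by auto
  ultimately show ?thesis
    unfolding tjurina_prod4[OF distinct_lines_triple4[OF assms]]
    by (simp add: doubleton_eq_iff power2_eq_square)
qed

definition pencil4 where
  "pencil4 u0 u1 a b c d \<longleftrightarrow> crs u0 u1 \<noteq> 0 \<and> a \<noteq> 0 \<and> b \<noteq> 0 \<and> c \<noteq> 0 \<and> d \<noteq> 0 \<and> a * d - b * c \<noteq> (0::complex)"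

lemma distinct_lines_pencil4:
  assumes "pencil4 u0 u1 a b c d"
  shows "distinct_lines (vec4 u0 u1 (a *s u0 + b *s u1) (c *s u0 + d *s u1))"
  using assms unfolding distinct_lines_vec4 by (simp add: pencil4_def crs_lincomb)

lemma tjurina_pencil4:
  assumes "pencil4 u0 u1 a b c d"
  shows "tjurina (prod4 u0 u1 (a *s u0 + b *s u1) (c *s u0 + d *s u1)) = 9"
proof -
  let ?U = "vec4 u0 u1 (a *s u0 + b *s u1) (c *s u0 + d *s u1)"
  have h: "crs u0 u1 \<noteq> 0" "a \<noteq> 0" "b \<noteq> 0" "c \<noteq> 0" "d \<noteq> 0" "a * d - b * c \<noteq> 0"
    using assms by (auto simp: pencil4_def)
  have "{inc ?U v | v. v \<noteq> 0 \<and> card (inc ?U v) \<ge> 2} = {{0, 1, 2, 3}}"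
  proof (intro equalityI subsetI)
    fix s assume "s \<in> {inc ?U v | v. v \<noteq> 0 \<and> card (inc ?U v) \<ge> 2}"
    then obtain v where v: "v \<noteq> 0" "card (inc ?U v) \<ge> 2" "s = inc ?U v" by blast
    have 1: "bil u0 v = 0" "bil u1 v = 0"
    proof -
      have *: "x = 0 \<and> y = 0" if "a * x + b * y = 0" "c * x + d * y = 0" for x y
      proof -
        have "(a * d - b * c) * x = d * (a * x + b * y) - b * (c * x + d * y)"
          "(a * d - b * c) * y = a * (c * x + d * y) - c * (a * x + b * y)" by (simp_all add: algebra_simps)
        then show ?thesis using that h(6) by simp
      qed
      show "bil u0 v = 0" "bil u1 v = 0"
        using v(2) h(2-5) *[of "bil u0 v" "bil u1 v"] unfolding inc_vec4
        by (auto simp: bil_add bil_scale split: if_splits)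
    qed
    show "s \<in> {{0, 1, 2, 3}}" unfolding v(3) inc_vec4 by (auto simp: 1 bil_add bil_scale)
  next
    have "inc ?U (crs u0 u1) = {0, 1, 2, 3}" unfolding inc_vec4 by (auto simp: bil_add bil_scale)
    moreover fix s assume "s \<in> {{0, 1, 2, 3 :: nat}}"
    ultimately show "s \<in> {inc ?U v | v. v \<noteq> 0 \<and> card (inc ?U v) \<ge> 2}"
      using h(1) by (intro CollectI exI[of _ "crs u0 u1"]) auto
  qed
  then show ?thesis
    unfolding tjurina_prod4[OF distinct_lines_pencil4[OF assms]] by (simp add: power2_eq_square)
qed

text \<open>Cramer's rule, contracted with a vector \<open>n\<close> on which the functional $u
  \times w$ takes the value $1$.\<close>

lemma det3_eq_0_lincomb:
  assumes "det3 u w z = 0" "crs u w \<noteq> 0"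
  obtains a b where "z = a *s u + b *s w"
proof -
  obtain n where n: "bil (crs u w) n = 1" using nonzero_bil[OF assms(2)] .
  have "bil (crs u w) n *s z = bil (crs z w) n *s u + bil (crs u z) n *s w + det3 u w z *s n"
    by (simp add: vec3_eq_iff bil_def det3_def algebra_simps)
  then have "z = bil (crs z w) n *s u + bil (crs u z) n *s w" using n assms(1) by simp
  then show ?thesis by (rule that)
qed

text \<open>Distinctness of the lines makes the coefficients of the linear relations
  nonzero.\<close>

lemma classify_dependent:
  assumes dl: "distinct_lines (vec4 u0 u1 u2 u3)" and 0: "det3 u0 u1 u2 = 0"
  shows "(\<exists>a b. u2 = a *s u0 + b *s u1 \<and> triple4 u0 u1 a b u3) \<or>
    (\<exists>a b c d. u2 = a *s u0 + b *s u1 \<and> u3 = c *s u0 + d *s u1 \<and> pencil4 u0 u1 a b c d)"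
proof -
  have d: "crs u0 u1 \<noteq> 0" "crs u0 u2 \<noteq> 0" "crs u0 u3 \<noteq> 0" "crs u1 u2 \<noteq> 0" "crs u1 u3 \<noteq> 0" "crs u2 u3 \<noteq> 0"
    using dl unfolding distinct_lines_vec4 by auto
  obtain a b where ab: "u2 = a *s u0 + b *s u1" using det3_eq_0_lincomb[OF 0 d(1)] .
  have n2: "a \<noteq> 0" "b \<noteq> 0" using d by (auto simp: ab crs_lincomb)
  show ?thesis
  proof (cases "det3 u0 u1 u3 = 0")
    case True
    obtain c e where ce: "u3 = c *s u0 + e *s u1" using det3_eq_0_lincomb[OF True d(1)] .
    have "c \<noteq> 0" "e \<noteq> 0" "a * e - b * c \<noteq> 0" using d by (auto simp: ab ce crs_lincomb)
    then have "pencil4 u0 u1 a b c e" using n2 d(1) by (simp add: pencil4_def)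
    then show ?thesis using ab ce by blast
  next
    case False
    then have "triple4 u0 u1 a b u3" using n2 by (simp add: triple4_def)
    then show ?thesis using ab by blast
  qed
qed

lemma distinct_lines_swap:
  "distinct_lines (vec4 u1 u0 u2 u3) = distinct_lines (vec4 u0 u1 u2 u3)"
  "distinct_lines (vec4 u0 u2 u1 u3) = distinct_lines (vec4 u0 u1 u2 u3)"
  "distinct_lines (vec4 u0 u1 u3 u2) = distinct_lines (vec4 u0 u1 u2 u3)"
  unfolding distinct_lines_vec4
  by (auto simp: crs_eq_0_commute[of u1 u0] crs_eq_0_commute[of u2 u1] crs_eq_0_commute[of u3 u2])

text \<open>If some three of the lines are concurrent, they can be numbered first.\<close>

lemma arrangement_4_cases:
  assumes "arrangement_poly 4 f"
  obtains
    (generic) u0 u1 u2 u3 where "f = prod4 u0 u1 u2 u3" "generic4 u0 u1 u2 u3"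
  | (triple) u0 u1 a b u3 where "f = prod4 u0 u1 (a *s u0 + b *s u1) u3" "triple4 u0 u1 a b u3"
  | (pencil) u0 u1 a b c d where "f = prod4 u0 u1 (a *s u0 + b *s u1) (c *s u0 + d *s u1)"
      "pencil4 u0 u1 a b c d"
proof -
  obtain u0 u1 u2 u3 where f: "f = prod4 u0 u1 u2 u3" and dl: "distinct_lines (vec4 u0 u1 u2 u3)"
    using assms unfolding arrangement_poly_4_iff by blast
  have dep: thesis if "f = prod4 v0 v1 v2 v3" "distinct_lines (vec4 v0 v1 v2 v3)" "det3 v0 v1 v2 = 0"
    for v0 v1 v2 v3
    using classify_dependent[OF that(2,3)] that(1) triple pencil by blast
  show thesis
  proof (cases "generic4 u0 u1 u2 u3")
    case True
    then show thesis using f generic by blast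
  next
    case False
    then consider "det3 u0 u1 u2 = 0" | "det3 u0 u1 u3 = 0" | "det3 u0 u2 u3 = 0" | "det3 u1 u2 u3 = 0"
      by (auto simp: generic4_def)
    then show thesis
    proof cases
      case 1
      then show thesis using dep[OF f dl] by blast
    next
      case 2
      then show thesis using dep[of u0 u1 u3 u2] f dl by (simp add: prod4_swap distinct_lines_swap)
    next
      case 3
      moreover have "prod4 u0 u2 u3 u1 = prod4 u0 u1 u2 u3" by (simp add: prod4_def mult_ac)
      moreover have "distinct_lines (vec4 u0 u2 u3 u1)"
        using dl distinct_lines_swap(2)[of u0 u1 u2 u3] distinct_lines_swap(3)[of u0 u2 u1 u3] by blast
      ultimately show thesis using dep[of u0 u2 u3 u1] f by simp
    next
      case 4
      moreover have "prod4 u1 u2 u3 u0 = prod4 u0 u1 u2 u3" by (simp add: prod4_def mult_ac)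
      moreover have "distinct_lines (vec4 u1 u2 u3 u0)"
        using dl distinct_lines_swap(1)[of u0 u1 u2 u3] distinct_lines_swap(2)[of u1 u0 u2 u3]
          distinct_lines_swap(3)[of u1 u2 u0 u3] by blast
      ultimately show thesis using dep[of u1 u2 u3 u0] f by simp
    qed
  qed
qed

lemma arr_tau_4_I:
  assumes "distinct_lines (vec4 u0 u1 u2 u3)" "tjurina (prod4 u0 u1 u2 u3) = t"
  shows "poly_point (prod4 u0 u1 u2 u3) \<in> arr_tau 4 t"
  unfolding arr_tau_def arrangement_poly_4_iff using assms by blast

lemma arr_tau_4_6: "arr_tau 4 6 = {poly_point (prod4 u0 u1 u2 u3) | u0 u1 u2 u3. generic4 u0 u1 u2 u3}"
proof (intro equalityI subsetI)
  fix p assume "p \<in> arr_tau 4 6"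
  then obtain f where f: "p = poly_point f" "arrangement_poly 4 f" "tjurina f = 6"
    by (auto simp: arr_tau_def)
  from f(2) show "p \<in> {poly_point (prod4 u0 u1 u2 u3) | u0 u1 u2 u3. generic4 u0 u1 u2 u3}"
  proof (cases rule: arrangement_4_cases)
    case generic
    then show ?thesis using f(1) by blast
  next
    case triple
    then show ?thesis using f(3) tjurina_triple4 by auto
  next
    case pencil
    then show ?thesis using f(3) tjurina_pencil4 by auto
  qed
qed (auto intro!: arr_tau_4_I distinct_lines_generic4 tjurina_generic4)

lemma arr_tau_4_7: "arr_tau 4 7 =
    {poly_point (prod4 u0 u1 (a *s u0 + b *s u1) u3) | u0 u1 a b u3. triple4 u0 u1 a b u3}"
proof (intro equalityI subsetI)
  fix p assume "p \<in> arr_tau 4 7"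
  then obtain f where f: "p = poly_point f" "arrangement_poly 4 f" "tjurina f = 7"
    by (auto simp: arr_tau_def)
  from f(2) show "p \<in> {poly_point (prod4 u0 u1 (a *s u0 + b *s u1) u3) | u0 u1 a b u3. triple4 u0 u1 a b u3}"
  proof (cases rule: arrangement_4_cases)
    case generic
    then show ?thesis using f(3) tjurina_generic4 by auto
  next
    case triple
    then show ?thesis using f(1) by blast
  next
    case pencil
    then show ?thesis using f(3) tjurina_pencil4 by auto
  qed
qed (auto intro!: arr_tau_4_I distinct_lines_triple4 tjurina_triple4)

lemma arr_tau_4_9: "arr_tau 4 9 =
    {poly_point (prod4 u0 u1 (a *s u0 + b *s u1) (c *s u0 + d *s u1)) | u0 u1 a b c d.
       pencil4 u0 u1 a b c d}"
proof (intro equalityI subsetI)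
  fix p assume "p \<in> arr_tau 4 9"
  then obtain f where f: "p = poly_point f" "arrangement_poly 4 f" "tjurina f = 9"
    by (auto simp: arr_tau_def)
  from f(2) show "p \<in> {poly_point (prod4 u0 u1 (a *s u0 + b *s u1) (c *s u0 + d *s u1)) | u0 u1 a b c d.
       pencil4 u0 u1 a b c d}"
  proof (cases rule: arrangement_4_cases)
    case generic
    then show ?thesis using f(3) tjurina_generic4 by auto
  next
    case triple
    then show ?thesis using f(3) tjurina_triple4 by auto
  next
    case pencil
    then show ?thesis using f(1) by blast
  qed
qed (auto intro!: arr_tau_4_I distinct_lines_pencil4 tjurina_pencil4)

lemma arr_4: "arr 4 = arr_tau 4 6 \<union> arr_tau 4 7 \<union> arr_tau 4 9"
proof (intro equalityI subsetI)
  fix p assume "p \<in> arr 4"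
  then obtain f where f: "p = poly_point f" "arrangement_poly 4 f" by (auto simp: arr_def)
  from f(2) show "p \<in> arr_tau 4 6 \<union> arr_tau 4 7 \<union> arr_tau 4 9"
    by (cases rule: arrangement_4_cases)
       (use f tjurina_generic4 tjurina_triple4 tjurina_pencil4 in \<open>auto simp: arr_tau_def\<close>)
qed (auto simp: arr_tau_def arr_def)

lemma prod4_hom: "prod4 u0 u1 u2 u3 \<in> hom_part 4"
  using hom_part_mult[OF hom_part_mult[OF hom_part_mult[OF hom_part_lin[of u0] hom_part_lin[of u1]]
      hom_part_lin[of u2]] hom_part_lin[of u3]]
  by (simp add: prod4_def)

lemma prod4_nonzero:
  "distinct_lines (vec4 u0 u1 u2 u3) \<Longrightarrow> prod4 u0 u1 u2 u3 \<noteq> 0"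
  unfolding distinct_lines_vec4 by (auto simp: prod4_def)

lemma arr_4_subset_PS: "arr 4 \<subseteq> PS 4"
  unfolding arr_def PS_def arrangement_poly_4_iff using prod4_hom prod4_nonzero by fastforce

section \<open>Coefficients of products\<close>

lemma finite_mon_degree_le: "finite {m :: 3 \<Rightarrow>\<^sub>0 nat. mon_degree m \<le> d}"
proof (rule inj_on_finite)
  let ?h = "\<lambda>m :: 3 \<Rightarrow>\<^sub>0 nat. (lookup m 1, lookup m 2, lookup m 3)"
  show "inj_on ?h {m. mon_degree m \<le> d}" by (auto simp: inj_on_def intro: mon_eqI3)
  show "?h ` {m. mon_degree m \<le> d} \<subseteq> {..d} \<times> {..d} \<times> {..d}" by (auto simp: mon_degree_3)
qed auto

text \<open>The finite index set of the convolution that computes the coefficient of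
  \<open>m\<close> in a product; unlike the supports of the factors it does not vary with
  parameters.\<close>

definition splits :: "(3 \<Rightarrow>\<^sub>0 nat) \<Rightarrow> ((3 \<Rightarrow>\<^sub>0 nat) \<times> (3 \<Rightarrow>\<^sub>0 nat)) set" where
  "splits m = {(a, b). a + b = m}"

lemma finite_splits: "finite (splits m)"
proof (rule finite_subset)
  let ?M = "{a :: 3 \<Rightarrow>\<^sub>0 nat. mon_degree a \<le> mon_degree m}"
  show "splits m \<subseteq> ?M \<times> ?M" by (auto simp: splits_def mon_degree_add)
  show "finite (?M \<times> ?M)" by (intro finite_cartesian_product finite_mon_degree_le)
qed

lemma lookup_mult_splits:
  fixes P Q :: S
  shows "lookup (P * Q) m = (\<Sum>(a, b)\<in>splits m. lookup P a * lookup Q b)"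
proof -
  let ?s = "\<lambda>P m. single m (lookup P m)"
  let ?K = "keys P \<times> keys Q"
  have "P * Q = (\<Sum>a\<in>keys P. ?s P a) * (\<Sum>b\<in>keys Q. ?s Q b)"
    by (simp flip: cpoly_expand)
  also have "\<dots> = (\<Sum>(a, b)\<in>?K. single (a + b) (lookup P a * lookup Q b))"
    by (simp add: sum_product mult_single sum.cartesian_product)
  finally have "lookup (P * Q) m = (\<Sum>(a, b)\<in>?K.
      if (a, b) \<in> splits m then lookup P a * lookup Q b else 0)"
    by (simp add: lookup_sum lookup_single when_def splits_def case_prod_unfold)
  also have "\<dots> = (\<Sum>(a, b)\<in>?K \<union> splits m.
      if (a, b) \<in> splits m then lookup P a * lookup Q b else 0)"
    by (rule sum.mono_neutral_left) (auto simp: finite_splits in_keys_iff)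
  also have "\<dots> = (\<Sum>(a, b)\<in>splits m.
      if (a, b) \<in> splits m then lookup P a * lookup Q b else 0)"
    by (rule sum.mono_neutral_right) (auto simp: finite_splits)
  also have "\<dots> = (\<Sum>(a, b)\<in>splits m. lookup P a * lookup Q b)"
    by (intro sum.cong) auto
  finally show ?thesis .
qed

definition coeffs_in :: "((nat \<Rightarrow> complex) \<Rightarrow> S) \<Rightarrow> ((nat \<Rightarrow> complex) \<Rightarrow> complex) set \<Rightarrow> bool" where
  "coeffs_in F V \<longleftrightarrow> (\<forall>m. (\<lambda>\<theta>. lookup (F \<theta>) m) \<in> V)"

lemma coeffs_in_monspan_mult:
  assumes "coeffs_in F (monspan N D)" "coeffs_in G (monspan N D')"
    "finite D''" "\<And>e e'. e \<in> D \<Longrightarrow> e' \<in> D' \<Longrightarrow> (\<lambda>j. e j + e' j) \<in> D''"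
  shows "coeffs_in (\<lambda>\<theta>. F \<theta> * G \<theta>) (monspan N D'')"
  unfolding coeffs_in_def lookup_mult_splits case_prod_unfold
  using assms by (auto simp: coeffs_in_def intro!: monspan_sum monspan_mult)

lemma coeffs_in_monspan_add:
  assumes "coeffs_in F (monspan N D)" "coeffs_in G (monspan N D)"
  shows "coeffs_in (\<lambda>\<theta>. F \<theta> + G \<theta>) (monspan N D)"
  using assms by (auto simp: coeffs_in_def lookup_add intro!: monspan_add)

lemma coeffs_in_con_mult:
  assumes "g \<in> monspan N D"
  shows "coeffs_in (\<lambda>\<theta>. con (g \<theta>) * P) (monspan N D)"
  unfolding coeffs_in_def
proof
  fix m
  have "(\<lambda>\<theta>. lookup P m * g \<theta>) \<in> monspan N D" using assms by (rule monspan_scale)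
  moreover have "lookup (con (g \<theta>) * P) m = lookup P m * g \<theta>" for \<theta>
    using lookup_poly_scale[of "g \<theta>" P m] by (simp add: poly_scale_def mult.commute)
  ultimately show "(\<lambda>\<theta>. lookup (con (g \<theta>) * P) m) \<in> monspan N D" by simp
qed

section \<open>Parametrisations of the three types\<close>

definition lp :: "nat \<Rightarrow> (nat \<Rightarrow> complex) \<Rightarrow> complex ^ 3" where
  "lp k \<theta> = vector [\<theta> k, \<theta> (k + 1), \<theta> (k + 2)]"

lemma lp_nth [simp]: "lp k \<theta> $ 1 = \<theta> k" "lp k \<theta> $ 2 = \<theta> (k + 1)" "lp k \<theta> $ 3 = \<theta> (k + 2)"
  by (simp_all add: lp_def)

definition eunit :: "nat \<Rightarrow> nat \<Rightarrow> nat" where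
  "eunit j = (\<lambda>i. if i = j then 1 else 0)"

lemma monf_eunit: "j < N \<Longrightarrow> monf N (eunit j) \<theta> = \<theta> j"
proof -
  assume "j < N"
  have "monf N (eunit j) \<theta> = (\<Prod>i<N. if i = j then \<theta> j else 1)"
    unfolding monf_def eunit_def by (intro prod.cong) auto
  then show ?thesis using \<open>j < N\<close> by simp
qed

lemma coord_monspan: "finite D \<Longrightarrow> j < N \<Longrightarrow> eunit j \<in> D \<Longrightarrow> (\<lambda>\<theta>. \<theta> j) \<in> monspan N D"
  using monspan_monf[of D "eunit j" N] ext[of "monf N (eunit j)" "\<lambda>\<theta>. \<theta> j"] monf_eunit[of j N]
  by metis

lemma coeffs_in_lin_lp:
  assumes "finite D" "k + 2 < N" "eunit k \<in> D" "eunit (k + 1) \<in> D" "eunit (k + 2) \<in> D"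
  shows "coeffs_in (\<lambda>\<theta>. lin (lp k \<theta>)) (monspan N D)"
  unfolding lin_def lp_nth
  using assms by (intro coeffs_in_monspan_add coeffs_in_con_mult coord_monspan) auto

lemma coeffs_in_lin_scale_lp:
  assumes "finite D" "k + 2 < N" "j < N"
    "(\<lambda>i. eunit j i + eunit k i) \<in> D" "(\<lambda>i. eunit j i + eunit (k + 1) i) \<in> D"
    "(\<lambda>i. eunit j i + eunit (k + 2) i) \<in> D"
  shows "coeffs_in (\<lambda>\<theta>. lin (\<theta> j *s lp k \<theta>)) (monspan N D)"
proof -
  have "(\<lambda>\<theta>. \<theta> j * \<theta> i) \<in> monspan N D" if "i < N" "(\<lambda>l. eunit j l + eunit i l) \<in> D" for i
    by (rule monspan_mult[OF coord_monspan[of "{eunit j}"] coord_monspan[of "{eunit i}"]])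
       (use assms that in auto)
  then show ?thesis
    unfolding lin_def vector_smult_component lp_nth
    using assms by (intro coeffs_in_monspan_add coeffs_in_con_mult) auto
qed

text \<open>An additive family of exponent sets, indexed by multidegrees in the four lines, whose
  size is at most the \<open>n\<close>-th power of the total degree plus one.\<close>

definition exponent_grading :: "nat \<Rightarrow> (nat \<Rightarrow> nat \<Rightarrow> nat \<Rightarrow> nat \<Rightarrow> (nat \<Rightarrow> nat) set) \<Rightarrow> bool" where
  "exponent_grading n E \<longleftrightarrow> (\<lambda>_. 0) \<in> E 0 0 0 0 \<and>
     (\<forall>p0 p1 p2 p3 q0 q1 q2 q3. \<forall>e\<in>E p0 p1 p2 p3. \<forall>e'\<in>E q0 q1 q2 q3.
        (\<lambda>i. e i + e' i) \<in> E (p0 + q0) (p1 + q1) (p2 + q2) (p3 + q3)) \<and>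
     (\<forall>p0 p1 p2 p3. finite (E p0 p1 p2 p3) \<and> card (E p0 p1 p2 p3) \<le> (p0 + p1 + p2 + p3 + 1) ^ n)"

text \<open>It suffices that an exponent is determined by its entries at \<open>n\<close> places,
  each bounded by the total degree.\<close>

lemma exponent_gradingI:
  assumes 0: "(\<lambda>_. 0) \<in> E 0 0 0 0"
    and add: "\<And>p0 p1 p2 p3 q0 q1 q2 q3 e e'. e \<in> E p0 p1 p2 p3 \<Longrightarrow> e' \<in> E q0 q1 q2 q3 \<Longrightarrow>
      (\<lambda>i. e i + e' i) \<in> E (p0 + q0) (p1 + q1) (p2 + q2) (p3 + q3)"
    and inj: "\<And>p0 p1 p2 p3 e e' i. e \<in> E p0 p1 p2 p3 \<Longrightarrow> e' \<in> E p0 p1 p2 p3 \<Longrightarrow>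
      (\<forall>i\<in>set js. e i = e' i) \<Longrightarrow> e i = e' i"
    and bd: "\<And>p0 p1 p2 p3 e i. e \<in> E p0 p1 p2 p3 \<Longrightarrow> i \<in> set js \<Longrightarrow> e i \<le> p0 + p1 + p2 + p3"
  shows "exponent_grading (length js) E"
proof -
  have "finite (E p0 p1 p2 p3) \<and> card (E p0 p1 p2 p3) \<le> (p0 + p1 + p2 + p3 + 1) ^ length js"
    for p0 p1 p2 p3
  proof -
    let ?D = "E p0 p1 p2 p3" and ?B = "p0 + p1 + p2 + p3"
    have "inj_on (\<lambda>e. map e js) ?D" using inj by (auto simp: inj_on_def fun_eq_iff)
    moreover have "(\<lambda>e. map e js) ` ?D \<subseteq> exps ?B (length js)" using bd by (auto simp: exps_def)
    ultimately show ?thesis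
      using finite_exps[of ?B "length js"] card_exps[of ?B "length js"]
      by (metis inj_on_finite card_inj_on_le)
  qed
  then show ?thesis unfolding exponent_grading_def using 0 add by blast
qed

lemma exponent_gradingD:
  assumes "exponent_grading n E"
  shows "finite (E p0 p1 p2 p3)" "(\<lambda>_. 0) \<in> E 0 0 0 0"
    "card (E p0 p1 p2 p3) \<le> (p0 + p1 + p2 + p3 + 1) ^ n"
    "e \<in> E p0 p1 p2 p3 \<Longrightarrow> e' \<in> E q0 q1 q2 q3 \<Longrightarrow> (\<lambda>i. e i + e' i) \<in> E (p0 + q0) (p1 + q1) (p2 + q2) (p3 + q3)"
  using assms unfolding exponent_grading_def by blast+

lemma coeffs_in_prod4:
  assumes E: "exponent_grading n E"
    and l: "coeffs_in (\<lambda>\<theta>. lin (l0 \<theta>)) (monspan N (E 1 0 0 0))"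
      "coeffs_in (\<lambda>\<theta>. lin (l1 \<theta>)) (monspan N (E 0 1 0 0))"
      "coeffs_in (\<lambda>\<theta>. lin (l2 \<theta>)) (monspan N (E 0 0 1 0))"
      "coeffs_in (\<lambda>\<theta>. lin (l3 \<theta>)) (monspan N (E 0 0 0 1))"
  shows "coeffs_in (\<lambda>\<theta>. prod4 (l0 \<theta>) (l1 \<theta>) (l2 \<theta>) (l3 \<theta>)) (monspan N (E 1 1 1 1))"
proof -
  note fin = exponent_gradingD(1)[OF E] and add = exponent_gradingD(4)[OF E]
  have "coeffs_in (\<lambda>\<theta>. lin (l0 \<theta>) * lin (l1 \<theta>)) (monspan N (E 1 1 0 0))"
    by (rule coeffs_in_monspan_mult[OF l(1,2) fin]) (drule (1) add, simp)
  from coeffs_in_monspan_mult[OF this l(3) fin[of 1 1 1 0]]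
  have "coeffs_in (\<lambda>\<theta>. lin (l0 \<theta>) * lin (l1 \<theta>) * lin (l2 \<theta>)) (monspan N (E 1 1 1 0))"
    using add[of _ 1 1 0 0 _ 0 0 1 0] by simp
  from coeffs_in_monspan_mult[OF this l(4) fin[of 1 1 1 1]]
  show ?thesis
    unfolding prod4_def using add[of _ 1 1 1 0 _ 0 0 0 1] by simp
qed

lemma krull_dim_le_param:
  assumes E: "exponent_grading n E" and \<Phi>: "coeffs_in \<Phi> (monspan N (E 1 1 1 1))"
    and PS: "{poly_point (\<Phi> \<theta>) | \<theta>. G \<theta>} \<subseteq> PS d"
  shows "krull_dim (subtopology (zariski d) {poly_point (\<Phi> \<theta>) | \<theta>. G \<theta>}) \<le> enat n"
proof (rule krull_dim_le[OF PS])
  note D = exponent_gradingD[OF E]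
  show "\<exists>\<theta>. p = poly_point (\<Phi> \<theta>)" if "p \<in> {poly_point (\<Phi> \<theta>) | \<theta>. G \<theta>}" for p
    using that by blast
  show "finite (E k k k k)" for k by (rule D(1))
  show "(\<lambda>_. 0) \<in> E 0 0 0 0" by (rule D(2))
  show "(\<lambda>i. e i + e' i) \<in> E (j + k) (j + k) (j + k) (j + k)"
    if "e \<in> E j j j j" "e' \<in> E k k k k" for e e' j k using that by (rule D(4))
  show "card (E k k k k) \<le> (4 * k + 1) ^ n" for k
  proof -
    have "k + k + k + k + 1 = 4 * k + 1" by simp
    then show ?thesis using D(3)[of k k k k] by (simp only:)
  qed
  show "(\<lambda>\<theta>. lookup (\<Phi> \<theta>) m) \<in> monspan N (E 1 1 1 1)" for m
    using \<Phi> by (simp add: coeffs_in_def)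
qed

text \<open>The number in a name is the value of $\tau$. A line through the intersection of the
  first two lines is a combination of them.\<close>

definition \<Phi>6 :: "(nat \<Rightarrow> complex) \<Rightarrow> S" where
  "\<Phi>6 \<theta> = prod4 (lp 0 \<theta>) (lp 3 \<theta>) (lp 6 \<theta>) (lp 9 \<theta>)"

definition \<Phi>7 :: "(nat \<Rightarrow> complex) \<Rightarrow> S" where
  "\<Phi>7 \<theta> = prod4 (lp 0 \<theta>) (lp 3 \<theta>) (\<theta> 9 *s lp 0 \<theta> + \<theta> 10 *s lp 3 \<theta>) (lp 6 \<theta>)"

definition \<Phi>9 :: "(nat \<Rightarrow> complex) \<Rightarrow> S" where
  "\<Phi>9 \<theta> = prod4 (lp 0 \<theta>) (lp 3 \<theta>) (\<theta> 6 *s lp 0 \<theta> + \<theta> 7 *s lp 3 \<theta>) (\<theta> 8 *s lp 0 \<theta> + \<theta> 9 *s lp 3 \<theta>)"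

text \<open>Exponents of the monomials of multidegree \<open>(p0, p1, p2, p3)\<close>. In the
  concurrent cases the line $a u_0 + b u_1$ is made homogeneous by giving \<open>a\<close> degree
  $-1$ in $u_0$, \<open>b\<close> degree $-1$ in $u_1$, and both degree $1$ in the new line.
  Exponents of the same multidegree then differ in as many free entries as the stratum has
  dimensions.\<close>

definition E6 :: "nat \<Rightarrow> nat \<Rightarrow> nat \<Rightarrow> nat \<Rightarrow> (nat \<Rightarrow> nat) set" where
  "E6 p0 p1 p2 p3 = {e. (\<forall>i\<ge>12. e i = 0) \<and> e 0 + e 1 + e 2 = p0 \<and> e 3 + e 4 + e 5 = p1 \<and>
     e 6 + e 7 + e 8 = p2 \<and> e 9 + e 10 + e 11 = p3}"

definition E7 :: "nat \<Rightarrow> nat \<Rightarrow> nat \<Rightarrow> nat \<Rightarrow> (nat \<Rightarrow> nat) set" where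
  "E7 p0 p1 p2 p3 = {e. (\<forall>i\<ge>11. e i = 0) \<and> e 0 + e 1 + e 2 = p0 + e 9 \<and> e 3 + e 4 + e 5 = p1 + e 10 \<and>
     e 9 + e 10 = p2 \<and> e 6 + e 7 + e 8 = p3}"

definition E9 :: "nat \<Rightarrow> nat \<Rightarrow> nat \<Rightarrow> nat \<Rightarrow> (nat \<Rightarrow> nat) set" where
  "E9 p0 p1 p2 p3 = {e. (\<forall>i\<ge>10. e i = 0) \<and> e 0 + e 1 + e 2 = p0 + e 6 + e 8 \<and>
     e 3 + e 4 + e 5 = p1 + e 7 + e 9 \<and> e 6 + e 7 = p2 \<and> e 8 + e 9 = p3}"

lemma exponent_grading_E6: "exponent_grading 8 E6"
proof -
  have inj: "e i = e' i" if e: "e \<in> E6 p0 p1 p2 p3" "e' \<in> E6 p0 p1 p2 p3" and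
    eq: "\<forall>i\<in>set [0 :: nat, 1, 3, 4, 6, 7, 9, 10]. e i = e' i" for e e' i p0 p1 p2 p3
  proof -
    have "i \<in> {0, 1, 2, 3, 4, 5, 6, 7, 8, 9, 10, 11} \<or> i \<ge> 12"
      unfolding insert_iff empty_iff by presburger
    then show "e i = e' i" using e eq unfolding E6_def by auto
  qed
  have "exponent_grading (length [0 :: nat, 1, 3, 4, 6, 7, 9, 10]) E6"
    by (rule exponent_gradingI; (rule inj; assumption)?) (auto simp: E6_def)
  then show ?thesis by (simp add: numeral_eq_Suc)
qed

lemma exponent_grading_E7: "exponent_grading 7 E7"
proof -
  have inj: "e i = e' i" if e: "e \<in> E7 p0 p1 p2 p3" "e' \<in> E7 p0 p1 p2 p3" and
    eq: "\<forall>i\<in>set [0 :: nat, 1, 3, 4, 6, 7, 9]. e i = e' i" for e e' i p0 p1 p2 p3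
  proof -
    have "i \<in> {0, 1, 2, 3, 4, 5, 6, 7, 8, 9, 10} \<or> i \<ge> 11"
      unfolding insert_iff empty_iff by presburger
    then show "e i = e' i" using e eq unfolding E7_def by auto
  qed
  have "exponent_grading (length [0 :: nat, 1, 3, 4, 6, 7, 9]) E7"
    by (rule exponent_gradingI; (rule inj; assumption)?) (auto simp: E7_def)
  then show ?thesis by (simp add: numeral_eq_Suc)
qed

lemma exponent_grading_E9: "exponent_grading 6 E9"
proof -
  have inj: "e i = e' i" if e: "e \<in> E9 p0 p1 p2 p3" "e' \<in> E9 p0 p1 p2 p3" and
    eq: "\<forall>i\<in>set [0 :: nat, 1, 3, 4, 6, 8]. e i = e' i" for e e' i p0 p1 p2 p3
  proof -
    have "i \<in> {0, 1, 2, 3, 4, 5, 6, 7, 8, 9} \<or> i \<ge> 10"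
      unfolding insert_iff empty_iff by presburger
    then show "e i = e' i" using e eq unfolding E9_def by auto
  qed
  have "exponent_grading (length [0 :: nat, 1, 3, 4, 6, 8]) E9"
    by (rule exponent_gradingI; (rule inj; assumption)?) (auto simp: E9_def)
  then show ?thesis by (simp add: numeral_eq_Suc)
qed

lemma coeffs_in_\<Phi>6: "coeffs_in \<Phi>6 (monspan 12 (E6 1 1 1 1))"
  unfolding \<Phi>6_def[abs_def]
  by (rule coeffs_in_prod4[OF exponent_grading_E6]; (unfold lin_add)?;
      intro coeffs_in_monspan_add coeffs_in_lin_lp coeffs_in_lin_scale_lp;
      (rule exponent_gradingD(1)[OF exponent_grading_E6] | auto simp: E6_def eunit_def))

lemma coeffs_in_\<Phi>7: "coeffs_in \<Phi>7 (monspan 11 (E7 1 1 1 1))"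
  unfolding \<Phi>7_def[abs_def]
  by (rule coeffs_in_prod4[OF exponent_grading_E7]; (unfold lin_add)?;
      intro coeffs_in_monspan_add coeffs_in_lin_lp coeffs_in_lin_scale_lp;
      (rule exponent_gradingD(1)[OF exponent_grading_E7] | auto simp: E7_def eunit_def))

lemma coeffs_in_\<Phi>9: "coeffs_in \<Phi>9 (monspan 10 (E9 1 1 1 1))"
  unfolding \<Phi>9_def[abs_def]
  by (rule coeffs_in_prod4[OF exponent_grading_E9]; (unfold lin_add)?;
      intro coeffs_in_monspan_add coeffs_in_lin_lp coeffs_in_lin_scale_lp;
      (rule exponent_gradingD(1)[OF exponent_grading_E9] | auto simp: E9_def eunit_def))

text \<open>Functions of the parameters that do not all vanish exactly when the lines have the
  desired type. For four concurrent lines the condition that the first two are different needs the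
  three entries of a cross product.\<close>

definition H6 where "H6 = {\<lambda>\<theta>. det3 (lp 0 \<theta>) (lp 3 \<theta>) (lp 6 \<theta>) * det3 (lp 0 \<theta>) (lp 3 \<theta>) (lp 9 \<theta>) *
  det3 (lp 0 \<theta>) (lp 6 \<theta>) (lp 9 \<theta>) * det3 (lp 3 \<theta>) (lp 6 \<theta>) (lp 9 \<theta>)}"

definition H7 where "H7 = {\<lambda>\<theta>. det3 (lp 0 \<theta>) (lp 3 \<theta>) (lp 6 \<theta>) * \<theta> 9 * \<theta> 10}"

definition h9 :: "3 \<Rightarrow> (nat \<Rightarrow> complex) \<Rightarrow> complex" where
  "h9 i \<theta> = crs (lp 0 \<theta>) (lp 3 \<theta>) $ i * \<theta> 6 * \<theta> 7 * \<theta> 8 * \<theta> 9 * (\<theta> 6 * \<theta> 9 - \<theta> 7 * \<theta> 8)"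

definition H9 where "H9 = range h9"

lemma H6_iff: "(\<exists>h\<in>H6. h \<theta> \<noteq> 0) \<longleftrightarrow> generic4 (lp 0 \<theta>) (lp 3 \<theta>) (lp 6 \<theta>) (lp 9 \<theta>)"
  by (simp add: H6_def generic4_def)

lemma H7_iff: "(\<exists>h\<in>H7. h \<theta> \<noteq> 0) \<longleftrightarrow> triple4 (lp 0 \<theta>) (lp 3 \<theta>) (\<theta> 9) (\<theta> 10) (lp 6 \<theta>)"
  by (simp add: H7_def triple4_def)

lemma H9_iff: "(\<exists>h\<in>H9. h \<theta> \<noteq> 0) \<longleftrightarrow> pencil4 (lp 0 \<theta>) (lp 3 \<theta>) (\<theta> 6) (\<theta> 7) (\<theta> 8) (\<theta> 9)"
proof -
  have "(\<exists>h\<in>H9. h \<theta> \<noteq> 0) \<longleftrightarrow> (\<exists>i. h9 i \<theta> \<noteq> 0)"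
    unfolding H9_def by blast
  also have "\<dots> \<longleftrightarrow> pencil4 (lp 0 \<theta>) (lp 3 \<theta>) (\<theta> 6) (\<theta> 7) (\<theta> 8) (\<theta> 9)"
    by (auto simp: h9_def pencil4_def vec_eq_iff)
  finally show ?thesis .
qed

lemmas linepoly_intros = linepoly_add linepoly_diff linepoly_mult linepoly_coord linepoly_const

lemma linepoly_H:
  "h \<in> H6 \<Longrightarrow> linepoly h" "h \<in> H7 \<Longrightarrow> linepoly h" "h \<in> H9 \<Longrightarrow> linepoly h"
proof -
  have det: "linepoly (\<lambda>\<theta>. det3 (lp i \<theta>) (lp j \<theta>) (lp k \<theta>))" for i j k
    unfolding det3_def bil_def crs_nth lp_nth by (intro linepoly_intros)
  show "h \<in> H6 \<Longrightarrow> linepoly h" "h \<in> H7 \<Longrightarrow> linepoly h"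
    unfolding H6_def H7_def by (auto intro!: linepoly_mult det linepoly_coord)
  have "linepoly (\<lambda>\<theta>. crs (lp 0 \<theta>) (lp 3 \<theta>) $ i)" for i
    using exhaust_3[of i]
    by (elim disjE; hypsubst; unfold crs_nth lp_nth; intro linepoly_intros)
  then show "h \<in> H9 \<Longrightarrow> linepoly h"
    unfolding H9_def h9_def[abs_def] by (auto intro!: linepoly_mult linepoly_diff linepoly_coord)
qed

lemma linepoly_coeffs:
  assumes "coeffs_in F (monspan N D)"
  shows "linepoly (\<lambda>\<theta>. lookup (F \<theta>) m)"
  using assms linepoly_monspan unfolding coeffs_in_def by blast

definition pack :: "complex list \<Rightarrow> nat \<Rightarrow> complex" where
  "pack xs = (!) xs"

lemma arr_tau_4_6_param: "arr_tau 4 6 = {poly_point (\<Phi>6 \<theta>) | \<theta>. \<exists>h\<in>H6. h \<theta> \<noteq> 0}"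
proof -
  have "\<exists>\<theta>. lp 0 \<theta> = u0 \<and> lp 3 \<theta> = u1 \<and> lp 6 \<theta> = u2 \<and> lp 9 \<theta> = u3" for u0 u1 u2 u3 :: "complex ^ 3"
    by (rule exI[of _ "pack [u0 $ 1, u0 $ 2, u0 $ 3, u1 $ 1, u1 $ 2, u1 $ 3, u2 $ 1, u2 $ 2, u2 $ 3,
          u3 $ 1, u3 $ 2, u3 $ 3]"]) (simp add: pack_def vec3_eq_iff)
  then show ?thesis
    unfolding arr_tau_4_6 H6_iff \<Phi>6_def by (intro set_eqI iffI; clarsimp) metis+
qed

lemma arr_tau_4_7_param: "arr_tau 4 7 = {poly_point (\<Phi>7 \<theta>) | \<theta>. \<exists>h\<in>H7. h \<theta> \<noteq> 0}"
proof -
  have "\<exists>\<theta>. lp 0 \<theta> = u0 \<and> lp 3 \<theta> = u1 \<and> lp 6 \<theta> = u3 \<and> \<theta> 9 = a \<and> \<theta> 10 = b"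
    for u0 u1 u3 :: "complex ^ 3" and a b
    by (rule exI[of _ "pack [u0 $ 1, u0 $ 2, u0 $ 3, u1 $ 1, u1 $ 2, u1 $ 3, u3 $ 1, u3 $ 2, u3 $ 3,
          a, b]"]) (simp add: pack_def vec3_eq_iff)
  then show ?thesis
    unfolding arr_tau_4_7 H7_iff \<Phi>7_def by (intro set_eqI iffI; clarsimp) metis+
qed

lemma arr_tau_4_9_param: "arr_tau 4 9 = {poly_point (\<Phi>9 \<theta>) | \<theta>. \<exists>h\<in>H9. h \<theta> \<noteq> 0}"
proof -
  have "\<exists>\<theta>. lp 0 \<theta> = u0 \<and> lp 3 \<theta> = u1 \<and> \<theta> 6 = a \<and> \<theta> 7 = b \<and> \<theta> 8 = c \<and> \<theta> 9 = d"
    for u0 u1 :: "complex ^ 3" and a b c d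
    by (rule exI[of _ "pack [u0 $ 1, u0 $ 2, u0 $ 3, u1 $ 1, u1 $ 2, u1 $ 3, a, b, c, d]"])
       (simp add: pack_def vec3_eq_iff)
  then show ?thesis
    unfolding arr_tau_4_9 H9_iff \<Phi>9_def by (intro set_eqI iffI; clarsimp) metis+
qed

section \<open>Dimension and irreducibility of the strata\<close>

lemma prod4_PS:
  "distinct_lines (vec4 u0 u1 u2 u3) \<Longrightarrow> poly_point (prod4 u0 u1 u2 u3) \<in> PS 4"
  unfolding PS_def using prod4_hom prod4_nonzero by fastforce

lemma H6_PS: "h \<in> H6 \<Longrightarrow> h \<theta> \<noteq> 0 \<Longrightarrow> poly_point (\<Phi>6 \<theta>) \<in> PS 4"
  using H6_iff[of \<theta>] distinct_lines_generic4 prod4_PS unfolding \<Phi>6_def by blast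

lemma H7_PS: "h \<in> H7 \<Longrightarrow> h \<theta> \<noteq> 0 \<Longrightarrow> poly_point (\<Phi>7 \<theta>) \<in> PS 4"
  using H7_iff[of \<theta>] distinct_lines_triple4 prod4_PS unfolding \<Phi>7_def by blast

lemma H9_PS: "h \<in> H9 \<Longrightarrow> h \<theta> \<noteq> 0 \<Longrightarrow> poly_point (\<Phi>9 \<theta>) \<in> PS 4"
  using H9_iff[of \<theta>] distinct_lines_pencil4 prod4_PS unfolding \<Phi>9_def by blast

text \<open>The value of \<open>f\<close> at \<open>v\<close> as a linear form in the coefficients
  of \<open>f\<close>.\<close>

definition value_form :: "nat \<Rightarrow> complex ^ 3 \<Rightarrow> (3 \<Rightarrow>\<^sub>0 nat) cpoly" where
  "value_form d v = (\<Sum>m\<in>{m. mon_degree m \<le> d}. con (mon_eval m (($) v)) * var m)"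

lemma value_form_hom: "value_form d v \<in> hom_part 1"
  unfolding value_form_def by (intro hom_part_sum hom_part_con_mult hom_part_var)

lemma poly_eval_value_form:
  assumes "f \<in> hom_part (int d)"
  shows "poly_eval (value_form d v) (lookup f) = poly_eval f (($) v)"
proof -
  have "keys f \<subseteq> {m. mon_degree m \<le> d}" using assms by (auto simp: hom_part_def)
  then show ?thesis
    using poly_eval_superset[OF finite_mon_degree_le, of f d "($) v"]
    by (simp add: value_form_def poly_eval_sum poly_eval_mult mult.commute)
qed

lemma irreducible_in_flag:
  assumes F: "coeffs_in \<Phi> (monspan N D)" and H: "\<And>h. h \<in> H \<Longrightarrow> linepoly h"
    and PS: "\<And>h \<theta>. h \<in> H \<Longrightarrow> h \<theta> \<noteq> 0 \<Longrightarrow> poly_point (\<Phi> \<theta>) \<in> PS d"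
    and cond: "\<And>j a b t. j < n \<Longrightarrow> cond j a \<Longrightarrow> cond j b \<Longrightarrow> cond j (\<lambda>i. (1 - t) * a i + t * b i)"
    and wit: "\<exists>h\<in>H. h w \<noteq> 0" "\<And>j. j < n \<Longrightarrow> cond j w"
  shows "irreducible_in (zariski d)
    {poly_point (\<Phi> \<theta>) | \<theta>. (\<forall>j<n. cond j \<theta>) \<and> (\<exists>h\<in>H. h \<theta> \<noteq> 0)}"
proof -
  obtain h where h: "h \<in> H" "h w \<noteq> 0" using wit(1) by blast
  show ?thesis
    by (rule irreducible_in_param[where A = "\<lambda>\<theta>. \<forall>j<n. cond j \<theta>" and ?h0.0 = h and ?\<theta>0.0 = w])
       (use linepoly_coeffs[OF F] H PS cond wit h in blast)+
qed

text \<open>The \<open>j\<close>-th condition forces \<open>f\<close> to vanish at the point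
  \<open>pt j\<close>; the parameter \<open>wit j\<close> satisfies all earlier conditions without
  \<open>f\<close> vanishing there. So each condition cuts down the irreducible set of the
  arrangements that satisfy the previous ones.\<close>

lemma krull_dim_flag:
  assumes F: "coeffs_in \<Phi> (monspan N D)" and H: "\<And>h. h \<in> H \<Longrightarrow> linepoly h"
    and PS: "\<And>h \<theta>. h \<in> H \<Longrightarrow> h \<theta> \<noteq> 0 \<Longrightarrow> poly_point (\<Phi> \<theta>) \<in> PS d"
    and hom: "\<And>\<theta>. \<Phi> \<theta> \<in> hom_part (int d)"
    and cond: "\<And>j a b t. j < n \<Longrightarrow> cond j a \<Longrightarrow> cond j b \<Longrightarrow> cond j (\<lambda>i. (1 - t) * a i + t * b i)"
    and van: "\<And>j \<theta>. j < n \<Longrightarrow> (\<And>i. i \<le> j \<Longrightarrow> cond i \<theta>) \<Longrightarrow> poly_eval (\<Phi> \<theta>) (($) (pt j)) = 0"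
    and wit: "\<And>j. j \<le> n \<Longrightarrow> \<exists>h\<in>H. h (wit j) \<noteq> 0" "\<And>i j. j \<le> n \<Longrightarrow> i < j \<Longrightarrow> cond i (wit j)"
      "\<And>j. j < n \<Longrightarrow> poly_eval (\<Phi> (wit j)) (($) (pt j)) \<noteq> 0"
  shows "enat n \<le> krull_dim (subtopology (zariski d) {poly_point (\<Phi> \<theta>) | \<theta>. \<exists>h\<in>H. h \<theta> \<noteq> 0})"
proof -
  define Y where "Y i = {poly_point (\<Phi> \<theta>) | \<theta>. (\<forall>j<n - i. cond j \<theta>) \<and> (\<exists>h\<in>H. h \<theta> \<noteq> 0)}" for i
  have YPS: "Y i \<subseteq> PS d" for i unfolding Y_def using PS by blast
  have val: "vanish (value_form d v) {poly_point (\<Phi> \<theta>)} \<longleftrightarrow> poly_eval (\<Phi> \<theta>) (($) v) = 0"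
    if "poly_point (\<Phi> \<theta>) \<in> PS d" for v \<theta>
    using vanish_poly_point[OF that value_form_hom] poly_eval_value_form[OF hom] by simp
  show ?thesis
  proof (rule krull_dim_ge[where Y = Y and k = "\<lambda>_. 1" and P = "\<lambda>i. value_form d (pt (n - Suc i))"])
    show "irreducible_in (zariski d) (Y i)" if "i \<le> n" for i
      unfolding Y_def
      by (rule irreducible_in_flag[OF F H PS, where w = "wit (n - i)"]) (use cond wit in auto)
    show "Y i \<subseteq> {poly_point (\<Phi> \<theta>) | \<theta>. \<exists>h\<in>H. h \<theta> \<noteq> 0}" for i unfolding Y_def by blast
    show "{poly_point (\<Phi> \<theta>) | \<theta>. \<exists>h\<in>H. h \<theta> \<noteq> 0} \<subseteq> PS d" using PS by blast
    show "Y i \<subseteq> Y (Suc i)" for i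
    proof -
      have "(\<forall>j<n - i. cond j \<theta>) \<Longrightarrow> (\<forall>j<n - Suc i. cond j \<theta>)" for \<theta> by auto
      then show ?thesis unfolding Y_def by blast
    qed
    show "value_form d (pt (n - Suc i)) \<in> hom_part 1" for i by (rule value_form_hom)
    show "vanish (value_form d (pt (n - Suc i))) (Y i)" if i: "i < n" for i
    proof -
      have "vanish (value_form d (pt (n - Suc i))) {p}" if "p \<in> Y i" for p
      proof -
        obtain \<theta> where \<theta>: "p = poly_point (\<Phi> \<theta>)" "\<forall>j<n - i. cond j \<theta>" using \<open>p \<in> Y i\<close> unfolding Y_def by blast
        have "poly_eval (\<Phi> \<theta>) (($) (pt (n - Suc i))) = 0"
          by (rule van) (use \<theta> i in auto)
        then show ?thesis using val YPS \<open>p \<in> Y i\<close> \<theta>(1) by blast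
      qed
      then show ?thesis by (auto simp: vanish_def)
    qed
    show "\<not> vanish (value_form d (pt (n - Suc i))) (Y (Suc i))" if i: "i < n" for i
    proof
      let ?w = "wit (n - Suc i)"
      assume v: "vanish (value_form d (pt (n - Suc i))) (Y (Suc i))"
      have "(\<forall>j<n - Suc i. cond j ?w) \<and> (\<exists>h\<in>H. h ?w \<noteq> 0)" using wit by auto
      then have mem: "poly_point (\<Phi> ?w) \<in> Y (Suc i)" unfolding Y_def by blast
      then have "vanish (value_form d (pt (n - Suc i))) {poly_point (\<Phi> ?w)}"
        using v vanish_mono by blast
      moreover have "poly_point (\<Phi> ?w) \<in> PS d" using mem YPS by blast
      ultimately show False using val wit(3)[of "n - Suc i"] i by auto
    qed
  qed
qed

lemma lp_line: "lp k (\<lambda>i. (1 - t) * a i + t * b i) = (1 - t) *s lp k a + t *s lp k b"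
  by (simp add: vec3_eq_iff algebra_simps)

lemma bil_lp_line:
  "bil (lp k a) p = 0 \<Longrightarrow> bil (lp k b) p = 0 \<Longrightarrow> bil (lp k (\<lambda>i. (1 - t) * a i + t * b i)) p = 0"
  unfolding lp_line bil_add bil_scale by simp

lemma lp_line_eq:
  "lp k a = l \<Longrightarrow> lp k b = l \<Longrightarrow> lp k (\<lambda>i. (1 - t) * a i + t * b i) = l"
  by (simp add: lp_line vec3_eq_iff algebra_simps)

lemma poly_eval_prod4:
  "poly_eval (prod4 u0 u1 u2 u3) (($) v) = bil u0 v * bil u1 v * bil u2 v * bil u3 v"
  by (simp add: prod4_def poly_eval_mult)

lemma irreducible_arr_tau_4_7: "irreducible_in (zariski 4) (arr_tau 4 7)"
proof -
  let ?w = "pack [1, 0, 0, 0, 1, 0, 0, 0, 1, 1, 1]"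
  have "\<exists>h\<in>H7. h ?w \<noteq> 0"
    unfolding H7_iff by (simp add: triple4_def det3_def bil_def pack_def)
  then have "irreducible_in (zariski 4)
      {poly_point (\<Phi>7 \<theta>) | \<theta>. (\<forall>j<(0::nat). True) \<and> (\<exists>h\<in>H7. h \<theta> \<noteq> 0)}"
    by (intro irreducible_in_flag[OF coeffs_in_\<Phi>7 linepoly_H(2) H7_PS, where cond = "\<lambda>_ _. True"]) auto
  then show ?thesis unfolding arr_tau_4_7_param by simp
qed

lemma irreducible_arr_tau_4_9: "irreducible_in (zariski 4) (arr_tau 4 9)"
proof -
  let ?w = "pack [1, 0, 0, 0, 1, 0, 1, 1, 1, 2]"
  have "\<exists>h\<in>H9. h ?w \<noteq> 0"
    unfolding H9_iff by (simp add: pencil4_def vec3_eq_iff pack_def)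
  then have "irreducible_in (zariski 4)
      {poly_point (\<Phi>9 \<theta>) | \<theta>. (\<forall>j<(0::nat). True) \<and> (\<exists>h\<in>H9. h \<theta> \<noteq> 0)}"
    by (intro irreducible_in_flag[OF coeffs_in_\<Phi>9 linepoly_H(3) H9_PS, where cond = "\<lambda>_ _. True"]) auto
  then show ?thesis unfolding arr_tau_4_9_param by simp
qed

lemma arr_tau_subset_PS: "arr_tau 4 t \<subseteq> PS 4"
  using arr_4_subset_PS unfolding arr_tau_def arr_def by blast

lemma krull_dim_arr_tau_4_6_le: "krull_dim (subtopology (zariski 4) (arr_tau 4 6)) \<le> 8"
  using krull_dim_le_param[OF exponent_grading_E6 coeffs_in_\<Phi>6] arr_tau_subset_PS[of 6]
  unfolding arr_tau_4_6_param by (simp add: numeral_eq_enat)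

lemma krull_dim_arr_tau_4_7_le: "krull_dim (subtopology (zariski 4) (arr_tau 4 7)) \<le> 7"
  using krull_dim_le_param[OF exponent_grading_E7 coeffs_in_\<Phi>7] arr_tau_subset_PS[of 7]
  unfolding arr_tau_4_7_param by (simp add: numeral_eq_enat)

lemma krull_dim_arr_tau_4_9_le: "krull_dim (subtopology (zariski 4) (arr_tau 4 9)) \<le> 6"
  using krull_dim_le_param[OF exponent_grading_E9 coeffs_in_\<Phi>9] arr_tau_subset_PS[of 9]
  unfolding arr_tau_4_9_param by (simp add: numeral_eq_enat)

abbreviation v3 :: "complex \<Rightarrow> complex \<Rightarrow> complex \<Rightarrow> complex ^ 3" where
  "v3 a b c \<equiv> vector [a, b, c]"

lemma bounded_nat_cases:
  fixes j :: nat
  shows "j < 6 \<Longrightarrow> j = 0 \<or> j = 1 \<or> j = 2 \<or> j = 3 \<or> j = 4 \<or> j = 5"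
    "j < 7 \<Longrightarrow> j = 0 \<or> j = 1 \<or> j = 2 \<or> j = 3 \<or> j = 4 \<or> j = 5 \<or> j = 6"
    "j < 8 \<Longrightarrow> j = 0 \<or> j = 1 \<or> j = 2 \<or> j = 3 \<or> j = 4 \<or> j = 5 \<or> j = 6 \<or> j = 7"
    "j \<le> 6 \<Longrightarrow> j = 0 \<or> j = 1 \<or> j = 2 \<or> j = 3 \<or> j = 4 \<or> j = 5 \<or> j = 6"
    "j \<le> 7 \<Longrightarrow> j = 0 \<or> j = 1 \<or> j = 2 \<or> j = 3 \<or> j = 4 \<or> j = 5 \<or> j = 6 \<or> j = 7"
    "j \<le> 8 \<Longrightarrow> j = 0 \<or> j = 1 \<or> j = 2 \<or> j = 3 \<or> j = 4 \<or> j = 5 \<or> j = 6 \<or> j = 7 \<or> j = 8"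
  by linarith+

text \<open>The flag moves towards the lines $x = 0$, $y = 0$, $z = 0$, $x + y + z = 0$ one at a
  time, each line being made to pass first through one and then through a second of its points. The
  points lie on no other of the four lines. In the witness \<open>j\<close> only the line under
  consideration differs from its final position.\<close>

lemma krull_dim_arr_tau_4_6_ge: "8 \<le> krull_dim (subtopology (zariski 4) (arr_tau 4 6))"
proof -
  define pt where "pt j = [v3 0 1 1, v3 0 1 2, v3 1 0 1, v3 1 0 2, v3 1 1 0, v3 1 2 0,
     v3 1 1 (-2), v3 1 (-2) 1] ! j" for j :: nat
  define wit where "wit j = pack ([
     [1, 2, 3, 0, 1, 0, 0, 0, 1, 1, 1, 1],
     [1, 2, -2, 0, 1, 0, 0, 0, 1, 1, 1, 1],
     [1, 0, 0, 1, 2, 3, 0, 0, 1, 1, 1, 1],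
     [1, 0, 0, 1, 2, -1, 0, 0, 1, 1, 1, 1],
     [1, 0, 0, 0, 1, 0, 1, 2, 3, 1, 1, 1],
     [1, 0, 0, 0, 1, 0, 1, -1, 2, 1, 1, 1],
     [1, 0, 0, 0, 1, 0, 0, 0, 1, 1, 2, 3],
     [1, 0, 0, 0, 1, 0, 0, 0, 1, 1, 3, 2],
     [1, 0, 0, 0, 1, 0, 0, 0, 1, 1, 1, 1]] ! j)" for j :: nat
  define cond where "cond j \<theta> \<longleftrightarrow> bil (lp (3 * (j div 2)) \<theta>) (pt j) = 0" for j :: nat and \<theta>
  have "enat 8 \<le> krull_dim (subtopology (zariski 4) {poly_point (\<Phi>6 \<theta>) | \<theta>. \<exists>h\<in>H6. h \<theta> \<noteq> 0})"
  proof (rule krull_dim_flag[OF coeffs_in_\<Phi>6 linepoly_H(1) H6_PS, where cond = cond and pt = pt and wit = wit])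
    show "\<Phi>6 \<theta> \<in> hom_part (int 4)" for \<theta> using prod4_hom by (simp add: \<Phi>6_def)
    show "cond j (\<lambda>i. (1 - t) * a i + t * b i)" if "cond j a" "cond j b" for j a b t
      using that unfolding cond_def by (rule bil_lp_line)
    show "poly_eval (\<Phi>6 \<theta>) (($) (pt j)) = 0" if "j < 8" "\<And>i. i \<le> j \<Longrightarrow> cond i \<theta>" for j \<theta>
      using bounded_nat_cases(3)[OF that(1)] that(2)[OF order_refl]
      unfolding \<Phi>6_def poly_eval_prod4 cond_def by auto
    show "\<exists>h\<in>H6. h (wit j) \<noteq> 0" if "j \<le> 8" for j
      using bounded_nat_cases(6)[OF that] unfolding H6_iff
      by (elim disjE) (simp_all add: wit_def pack_def generic4_def det3_def bil_def)
    show "cond i (wit j)" if "j \<le> 8" "i < j" for i j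
      using bounded_nat_cases(6)[OF that(1)] bounded_nat_cases(3)[OF less_le_trans[OF that(2,1)]] that(2)
      by (elim disjE) (simp_all add: wit_def pack_def cond_def pt_def bil_def)
    show "poly_eval (\<Phi>6 (wit j)) (($) (pt j)) \<noteq> 0" if "j < 8" for j
      using bounded_nat_cases(3)[OF that] unfolding \<Phi>6_def poly_eval_prod4
      by (elim disjE) (simp_all add: wit_def pack_def pt_def bil_def)
  qed auto
  then show ?thesis unfolding arr_tau_4_6_param by (simp add: numeral_eq_enat)
qed

text \<open>The final position is $xy(x+y)z = 0$. The first two lines are fixed as vectors and not
  only up to a factor, so that the position of the third line, a combination of them, is a linear
  condition on its coefficients.\<close>

lemma krull_dim_arr_tau_4_7_ge: "7 \<le> krull_dim (subtopology (zariski 4) (arr_tau 4 7))"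
proof -
  define pt where "pt j = [v3 0 1 1, v3 0 1 2, v3 1 0 1, v3 1 0 2, v3 1 (-1) 1, v3 1 1 0, v3 1 2 0] ! j"
    for j :: nat
  define wit where "wit j = pack ([
     [1, 2, 3, 0, 1, 0, 0, 0, 1, 1, 1],
     [1, 2, -2, 0, 1, 0, 0, 0, 1, 1, 1],
     [1, 0, 0, 1, 2, 3, 0, 0, 1, 1, 1],
     [1, 0, 0, 2, 1, -2, 0, 0, 1, 1, 1],
     [1, 0, 0, 0, 1, 0, 0, 0, 1, 1, 2],
     [1, 0, 0, 0, 1, 0, 1, 1, 1, 1, 1],
     [1, 0, 0, 0, 1, 0, 1, -1, 1, 1, 1],
     [1, 0, 0, 0, 1, 0, 0, 0, 1, 1, 1]] ! j)" for j :: nat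
  define cond where "cond j \<theta> \<longleftrightarrow> [bil (lp 0 \<theta>) (pt 0) = 0, lp 0 \<theta> = v3 1 0 0,
     bil (lp 3 \<theta>) (pt 2) = 0, lp 3 \<theta> = v3 0 1 0, \<theta> 9 = \<theta> 10,
     bil (lp 6 \<theta>) (pt 5) = 0, bil (lp 6 \<theta>) (pt 6) = 0] ! j" for j :: nat and \<theta> :: "nat \<Rightarrow> complex"
  have "enat 7 \<le> krull_dim (subtopology (zariski 4) {poly_point (\<Phi>7 \<theta>) | \<theta>. \<exists>h\<in>H7. h \<theta> \<noteq> 0})"
  proof (rule krull_dim_flag[OF coeffs_in_\<Phi>7 linepoly_H(2) H7_PS, where cond = cond and pt = pt and wit = wit])
    show "\<Phi>7 \<theta> \<in> hom_part (int 4)" for \<theta> using prod4_hom by (simp add: \<Phi>7_def)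
    show "cond j (\<lambda>i. (1 - t) * a i + t * b i)" if "j < 7" "cond j a" "cond j b" for j a b t
      using bounded_nat_cases(2)[OF that(1)] that(2,3)
      by (elim disjE) (simp_all add: cond_def bil_lp_line lp_line_eq)
    show "poly_eval (\<Phi>7 \<theta>) (($) (pt j)) = 0" if "j < 7" "\<And>i. i \<le> j \<Longrightarrow> cond i \<theta>" for j \<theta>
    proof -
      have "lp 0 \<theta> = v3 1 0 0" if "1 \<le> j" using \<open>\<And>i. i \<le> j \<Longrightarrow> cond i \<theta>\<close>[OF that] by (simp add: cond_def)
      moreover have "lp 3 \<theta> = v3 0 1 0" if "3 \<le> j" using \<open>\<And>i. i \<le> j \<Longrightarrow> cond i \<theta>\<close>[OF that] by (simp add: cond_def)
      ultimately show ?thesis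
        using bounded_nat_cases(2)[OF \<open>j < 7\<close>] that(2)[OF order_refl]
        unfolding \<Phi>7_def poly_eval_prod4 bil_add bil_scale
        by (elim disjE) (simp_all add: cond_def, simp_all add: pt_def bil_def)
    qed
    show "\<exists>h\<in>H7. h (wit j) \<noteq> 0" if "j \<le> 7" for j
      using bounded_nat_cases(5)[OF that] unfolding H7_iff
      by (elim disjE) (simp_all add: wit_def pack_def triple4_def det3_def bil_def)
    show "cond i (wit j)" if "j \<le> 7" "i < j" for i j
      using bounded_nat_cases(5)[OF that(1)] bounded_nat_cases(2)[OF less_le_trans[OF that(2,1)]] that(2)
      by (elim disjE) (simp_all add: wit_def pack_def cond_def pt_def bil_def vec3_eq_iff)
    show "poly_eval (\<Phi>7 (wit j)) (($) (pt j)) \<noteq> 0" if "j < 7" for j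
      using bounded_nat_cases(2)[OF that] unfolding \<Phi>7_def poly_eval_prod4
      by (elim disjE) (simp_all add: wit_def pack_def pt_def bil_def)
  qed auto
  then show ?thesis unfolding arr_tau_4_7_param by (simp add: numeral_eq_enat)
qed

text \<open>The same flag as for three concurrent lines, with final position $xy(x+y)(x+2y) =
  0$.\<close>

lemma krull_dim_arr_tau_4_9_ge: "6 \<le> krull_dim (subtopology (zariski 4) (arr_tau 4 9))"
proof -
  define pt where "pt j = [v3 0 1 1, v3 0 1 2, v3 1 0 1, v3 1 0 2, v3 1 (-1) 1, v3 2 (-1) 1] ! j"
    for j :: nat
  define wit where "wit j = pack ([
     [1, 2, 3, 0, 1, 0, 1, 1, 1, 2],
     [1, 3, -3, 0, 1, 0, 1, 1, 1, 2],
     [1, 0, 0, 1, 2, 3, 1, 1, 1, 2],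
     [1, 0, 0, 2, 1, -2, 1, 1, 1, 2],
     [1, 0, 0, 0, 1, 0, 1, 3, 1, 2],
     [1, 0, 0, 0, 1, 0, 1, 1, 1, 3],
     [1, 0, 0, 0, 1, 0, 1, 1, 1, 2]] ! j)" for j :: nat
  define cond where "cond j \<theta> \<longleftrightarrow> [bil (lp 0 \<theta>) (pt 0) = 0, lp 0 \<theta> = v3 1 0 0,
     bil (lp 3 \<theta>) (pt 2) = 0, lp 3 \<theta> = v3 0 1 0, \<theta> 6 = \<theta> 7, \<theta> 9 = 2 * \<theta> 8] ! j"
    for j :: nat and \<theta> :: "nat \<Rightarrow> complex"
  have "enat 6 \<le> krull_dim (subtopology (zariski 4) {poly_point (\<Phi>9 \<theta>) | \<theta>. \<exists>h\<in>H9. h \<theta> \<noteq> 0})"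
  proof (rule krull_dim_flag[OF coeffs_in_\<Phi>9 linepoly_H(3) H9_PS, where cond = cond and pt = pt and wit = wit])
    show "\<Phi>9 \<theta> \<in> hom_part (int 4)" for \<theta> using prod4_hom by (simp add: \<Phi>9_def)
    show "cond j (\<lambda>i. (1 - t) * a i + t * b i)" if "j < 6" "cond j a" "cond j b" for j a b t
      using bounded_nat_cases(1)[OF that(1)] that(2,3)
      by (elim disjE) (simp_all add: cond_def bil_lp_line lp_line_eq)
    show "poly_eval (\<Phi>9 \<theta>) (($) (pt j)) = 0" if "j < 6" "\<And>i. i \<le> j \<Longrightarrow> cond i \<theta>" for j \<theta>
    proof -
      have "lp 0 \<theta> = v3 1 0 0" if "1 \<le> j" using \<open>\<And>i. i \<le> j \<Longrightarrow> cond i \<theta>\<close>[OF that] by (simp add: cond_def)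
      moreover have "lp 3 \<theta> = v3 0 1 0" if "3 \<le> j" using \<open>\<And>i. i \<le> j \<Longrightarrow> cond i \<theta>\<close>[OF that] by (simp add: cond_def)
      ultimately show ?thesis
        using bounded_nat_cases(1)[OF \<open>j < 6\<close>] that(2)[OF order_refl]
        unfolding \<Phi>9_def poly_eval_prod4 bil_add bil_scale
        by (elim disjE) (simp_all add: cond_def, simp_all add: pt_def bil_def)
    qed
    show "\<exists>h\<in>H9. h (wit j) \<noteq> 0" if "j \<le> 6" for j
      using bounded_nat_cases(4)[OF that] unfolding H9_iff
      by (elim disjE) (simp_all add: wit_def pack_def pencil4_def vec3_eq_iff)
    show "cond i (wit j)" if "j \<le> 6" "i < j" for i j
      using bounded_nat_cases(4)[OF that(1)] bounded_nat_cases(1)[OF less_le_trans[OF that(2,1)]] that(2)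
      by (elim disjE) (simp_all add: wit_def pack_def cond_def pt_def bil_def vec3_eq_iff)
    show "poly_eval (\<Phi>9 (wit j)) (($) (pt j)) \<noteq> 0" if "j < 6" for j
      using bounded_nat_cases(1)[OF that] unfolding \<Phi>9_def poly_eval_prod4
      by (elim disjE) (simp_all add: wit_def pack_def pt_def bil_def)
  qed auto
  then show ?thesis unfolding arr_tau_4_9_param by (simp add: numeral_eq_enat)
qed

section \<open>Generic arrangements form an open set\<close>

text \<open>The type \<open>3 + 3\<close> indexes the quadratic monomials: the left summand the
  squares, the right summand the products of two different variables, numbered by the missing one.
  \<open>op1\<close> and \<open>op2\<close> are the two factors.\<close>

fun op1 :: "3 + 3 \<Rightarrow> 3" where
  "op1 (Inl i) = i" | "op1 (Inr i) = (if i = 1 then 2 else 1)"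

fun op2 :: "3 + 3 \<Rightarrow> 3" where
  "op2 (Inl i) = i" | "op2 (Inr i) = (if i = 3 then 2 else 3)"

definition quad :: "3 + 3 \<Rightarrow> (3 \<Rightarrow>\<^sub>0 nat)" where
  "quad t = single (op1 t) 1 + single (op2 t) 1"

lemma sum_UNIV_3_3: "(\<Sum>t\<in>UNIV. h (t :: 3 + 3)) = h (Inl 1) + h (Inl 2) + h (Inl 3) +
    h (Inr 1) + h (Inr 2) + (h (Inr 3) :: 'a :: comm_monoid_add)"
  by (subst UNIV_Plus_UNIV[symmetric], subst sum.Plus) (simp_all add: sum_3 add.assoc)

lemma lookup_quad: "lookup (quad t) i = (if i = op1 t then 1 else 0) + (if i = op2 t then 1 else 0)"
  by (simp add: quad_def lookup_add lookup_single when_def)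

lemma exhaust_3_3:
  fixes t :: "3 + 3"
  shows "t = Inl 1 \<or> t = Inl 2 \<or> t = Inl 3 \<or> t = Inr 1 \<or> t = Inr 2 \<or> t = Inr 3"
  using exhaust_3 by (cases t) metis+

lemma inj_quad: "inj quad"
proof (rule injI)
  fix s t assume "quad s = quad t"
  then have "\<And>i. lookup (quad s) i = lookup (quad t) i" by simp
  note this[of 1] this[of 2] this[of 3]
  then show "s = t"
    unfolding lookup_quad using exhaust_3_3[of s] exhaust_3_3[of t] by (elim disjE) simp_all
qed

lemma range_quad: "mon_degree m = 2 \<Longrightarrow> m \<in> range quad"
proof -
  assume "mon_degree m = 2"
  then have "lookup m 1 + lookup m 2 + lookup m 3 = 2"
    by (simp add: mon_degree_3)
  then have "(lookup m 1, lookup m 2, lookup m 3) \<in>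
      {(2, 0, 0), (0, 2, 0), (0, 0, 2), (0, 1, 1), (1, 0, 1), (1, 1, 0)}"
    by simp presburger
  then have "m = quad (Inl 1) \<or> m = quad (Inl 2) \<or> m = quad (Inl 3) \<or> m = quad (Inr 1) \<or>
      m = quad (Inr 2) \<or> m = quad (Inr 3)"
  proof (elim insertE emptyE)
    assume "(lookup m 1, lookup m 2, lookup m 3) = (2, 0, 0)"
    then have "m = quad (Inl 1)" by (intro mon_eqI3) (simp_all add: lookup_quad)
    then show ?thesis by blast
  next
    assume "(lookup m 1, lookup m 2, lookup m 3) = (0, 2, 0)"
    then have "m = quad (Inl 2)" by (intro mon_eqI3) (simp_all add: lookup_quad)
    then show ?thesis by blast
  next
    assume "(lookup m 1, lookup m 2, lookup m 3) = (0, 0, 2)"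
    then have "m = quad (Inl 3)" by (intro mon_eqI3) (simp_all add: lookup_quad)
    then show ?thesis by blast
  next
    assume "(lookup m 1, lookup m 2, lookup m 3) = (0, 1, 1)"
    then have "m = quad (Inr 1)" by (intro mon_eqI3) (simp_all add: lookup_quad)
    then show ?thesis by blast
  next
    assume "(lookup m 1, lookup m 2, lookup m 3) = (1, 0, 1)"
    then have "m = quad (Inr 2)" by (intro mon_eqI3) (simp_all add: lookup_quad)
    then show ?thesis by blast
  next
    assume "(lookup m 1, lookup m 2, lookup m 3) = (1, 1, 0)"
    then have "m = quad (Inr 3)" by (intro mon_eqI3) (simp_all add: lookup_quad)
    then show ?thesis by blast
  qed
  then show ?thesis by blast
qed

lemma poly_eval_quadric:
  assumes "P \<in> hom_part 2"
  shows "poly_eval P x = (\<Sum>t\<in>UNIV. lookup P (quad t) * (x (op1 t) * x (op2 t)))"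
proof -
  have "keys P \<subseteq> range quad" using assms range_quad by (auto simp: hom_part_def)
  moreover have "mon_eval (quad t) x = x (op1 t) * x (op2 t)" for t
    unfolding quad_def mon_eval_add by (simp add: mon_eval_def)
  ultimately show ?thesis
    by (subst poly_eval_superset[of "range quad"]) (simp_all add: sum.reindex[OF inj_quad])
qed

definition pd2 :: "3 + 3 \<Rightarrow> S \<Rightarrow> S" where
  "pd2 s f = pd (op1 s) (pd (op2 s) f)"

text \<open>The catalecticant matrix: its rows are the second partial derivatives of a
  quartic.\<close>

definition catmat :: "S \<Rightarrow> complex ^ (3 + 3) ^ (3 + 3)" where
  "catmat f = (\<chi> s t. lookup (pd2 s f) (quad t))"

text \<open>The same matrix over the coordinate ring of the space of quartics. Differentiation turns
  a coefficient into an integer multiple of another one, so the entries are linear forms.\<close>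

definition catform_mat :: "(3 \<Rightarrow>\<^sub>0 nat) cpoly ^ (3 + 3) ^ (3 + 3)" where
  "catform_mat = (\<chi> s t. let m = quad t; i = op1 s; j = op2 s; m' = m + single i 1 in
     con (of_nat (Suc (lookup m i)) * of_nat (Suc (lookup m' j))) *
     var (m' + single j 1))"

definition catform :: "(3 \<Rightarrow>\<^sub>0 nat) cpoly" where
  "catform = det catform_mat"

lemma poly_eval_catform: "poly_eval catform (lookup f) = det (catmat f)"
proof -
  have entry: "poly_eval (catform_mat $ s $ t) (lookup f) = catmat f $ s $ t" for s t
    unfolding catform_mat_def catmat_def pd2_def
    by (simp add: Let_def poly_eval_mult lookup_pd mult.assoc del: of_nat_Suc)
  have sgn: "poly_eval (of_int (sign p)) x = of_int (sign p)" for p :: "3 + 3 \<Rightarrow> 3 + 3" and x :: "(3 \<Rightarrow>\<^sub>0 nat) \<Rightarrow> complex"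
    by (simp add: sign_def poly_eval_uminus)
  show ?thesis
    unfolding catform_def det_def
    by (simp add: poly_eval_sum poly_eval_mult poly_eval_prod entry sgn)
qed

lemma catform_hom: "catform \<in> hom_part 6"
proof -
  have "(\<Prod>i\<in>A. catform_mat $ i $ p i) \<in> hom_part (int (card A))" if "finite A" for A p
    using that
  proof induction
    case (insert i A)
    have "catform_mat $ i $ p i \<in> hom_part 1"
      unfolding catform_mat_def Let_def by (simp del: of_nat_Suc) (intro hom_part_con_mult hom_part_var)
    from hom_part_mult[OF this insert.IH] show ?case using insert by simp
  qed (simp add: one_in_hom_part)
  from this[of UNIV] have *: "(\<Prod>i\<in>UNIV. catform_mat $ i $ p i) \<in> hom_part 6" for p by simp
  show ?thesis
    unfolding catform_def det_def
  proof (intro hom_part_sum)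
    fix p
    show "of_int (sign p) * (\<Prod>i\<in>UNIV. catform_mat $ i $ p i) \<in> hom_part 6"
      using * hom_part_uminus[OF *] by (simp add: sign_def)
  qed
qed

lemma det_eq_0_iff:
  fixes A :: "complex ^ 'n ^ 'n"
  shows "det A = 0 \<longleftrightarrow> (\<exists>x. x \<noteq> 0 \<and> A *v x = 0)"
  using invertible_det_nz[of A] invertible_left_inverse[of A] matrix_left_invertible_ker[of A] by auto

lemma pd2_hom: "f \<in> hom_part 4 \<Longrightarrow> pd2 s f \<in> hom_part 2"
  unfolding pd2_def using hom_part_pd[OF hom_part_pd, of f 4] by simp

lemma poly_eval_pd_pd_prod4:
  "poly_eval (pd i (pd j (prod4 u0 u1 u2 u3))) (($) v) =
     (u0 $ i * u1 $ j + u0 $ j * u1 $ i) * bil u2 v * bil u3 v +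
     (u0 $ i * u2 $ j + u0 $ j * u2 $ i) * bil u1 v * bil u3 v +
     (u0 $ i * u3 $ j + u0 $ j * u3 $ i) * bil u1 v * bil u2 v +
     (u1 $ i * u2 $ j + u1 $ j * u2 $ i) * bil u0 v * bil u3 v +
     (u1 $ i * u3 $ j + u1 $ j * u3 $ i) * bil u0 v * bil u2 v +
     (u2 $ i * u3 $ j + u2 $ j * u3 $ i) * bil u0 v * bil u1 v"
  unfolding prod4_def
  by (simp add: pd_mult pd_add poly_eval_add poly_eval_mult algebra_simps)

text \<open>The quadratic monomials evaluated at the triple point form a vector in the
  kernel.\<close>

lemma catmat_singular_triple_point:
  assumes "v \<noteq> 0" "bil u0 v = 0" "bil u1 v = 0" "bil u2 v = 0"
  shows "det (catmat (prod4 u0 u1 u2 u3)) = 0"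
proof -
  define x :: "complex ^ (3 + 3)" where "x = (\<chi> t. v $ op1 t * v $ op2 t)"
  obtain i where "v $ i \<noteq> 0" using assms(1) by (auto simp: vec_eq_iff)
  then have "x $ Inl i \<noteq> 0" by (simp add: x_def)
  then have "x \<noteq> 0" by (metis zero_index)
  moreover have "catmat (prod4 u0 u1 u2 u3) *v x = 0"
  proof (rule vec_eq_iff[THEN iffD2], rule allI)
    fix s
    have "(catmat (prod4 u0 u1 u2 u3) *v x) $ s = poly_eval (pd2 s (prod4 u0 u1 u2 u3)) (($) v)"
      by (simp add: poly_eval_quadric[OF pd2_hom[OF prod4_hom]] catmat_def matrix_vector_mult_def x_def)
    also have "\<dots> = 0" unfolding pd2_def poly_eval_pd_pd_prod4 by (simp add: assms)
    finally show "(catmat (prod4 u0 u1 u2 u3) *v x) $ s = 0 $ s" by simp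
  qed
  ultimately show ?thesis unfolding det_eq_0_iff by blast
qed

text \<open>A vector in the kernel of the transpose is a second order operator with constant
  coefficients that annihilates \<open>f\<close>. Evaluated at the intersection of two of the lines,
  this says that the symmetric bilinear form \<open>B\<close> of the operator vanishes on the two
  lines. So each of $u_0, u_1, u_2$ is orthogonal to three independent covectors, and $B =
  0$.\<close>

lemma catmat_nonsingular_generic4:
  assumes "generic4 u0 u1 u2 u3"
  shows "det (catmat (prod4 u0 u1 u2 u3)) \<noteq> 0"
proof
  let ?f = "prod4 u0 u1 u2 u3"
  have d: "det3 u0 u1 u2 \<noteq> 0" "det3 u0 u1 u3 \<noteq> 0" "det3 u0 u2 u3 \<noteq> 0" "det3 u1 u2 u3 \<noteq> 0"
    using assms by (auto simp: generic4_def)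
  assume "det (catmat ?f) = 0"
  then have "det (transpose (catmat ?f)) = 0" by (simp add: det_transpose)
  then obtain c where c: "c \<noteq> 0" "transpose (catmat ?f) *v c = 0" unfolding det_eq_0_iff by blast
  have c0: "(\<Sum>s\<in>UNIV. c $ s * lookup (pd2 s ?f) (quad t)) = 0" for t
    using arg_cong[OF c(2), of "\<lambda>x. x $ t"]
    by (simp add: matrix_vector_mult_def transpose_def catmat_def mult.commute)
  have apolar: "(\<Sum>s\<in>UNIV. c $ s * poly_eval (pd2 s ?f) (($) v)) = 0" for v
  proof -
    have "(\<Sum>s\<in>UNIV. c $ s * poly_eval (pd2 s ?f) (($) v)) =
        (\<Sum>s\<in>UNIV. \<Sum>t\<in>UNIV. c $ s * lookup (pd2 s ?f) (quad t) * (v $ op1 t * v $ op2 t))"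
      by (simp add: poly_eval_quadric[OF pd2_hom[OF prod4_hom]] sum_distrib_left mult.assoc)
    also have "\<dots> = (\<Sum>t\<in>UNIV. (\<Sum>s\<in>UNIV. c $ s * lookup (pd2 s ?f) (quad t)) * (v $ op1 t * v $ op2 t))"
      by (subst sum.swap) (simp add: sum_distrib_right)
    also have "\<dots> = 0" by (simp add: c0)
    finally show ?thesis .
  qed
  define n1 where "n1 = (vector [2 * c $ Inl 1, c $ Inr 3, c $ Inr 2] :: complex ^ 3)"
  define n2 where "n2 = (vector [c $ Inr 3, 2 * c $ Inl 2, c $ Inr 1] :: complex ^ 3)"
  define n3 where "n3 = (vector [c $ Inr 2, c $ Inr 1, 2 * c $ Inl 3] :: complex ^ 3)"
  define N where "N u = (vector [bil u n1, bil u n2, bil u n3] :: complex ^ 3)" for u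
  define B where "B u w = (\<Sum>s\<in>UNIV. c $ s * (u $ op1 s * w $ op2 s + u $ op2 s * w $ op1 s))" for u w :: "complex ^ 3"
  have BN: "B u w = bil w (N u)" for u w
    unfolding B_def sum_UNIV_3_3 N_def bil_def n1_def n2_def n3_def by (simp add: algebra_simps)
  have B: "B ua ub * (bil uc v * bil ud v) = 0"
    if "\<And>i j. poly_eval (pd i (pd j ?f)) (($) v) = (ua $ i * ub $ j + ua $ j * ub $ i) * (bil uc v * bil ud v)"
    for ua ub uc ud v
    using apolar[of v] unfolding pd2_def that B_def by (simp add: sum_distrib_right mult.assoc)
  have nz: "bil w (crs u v) \<noteq> 0" if "det3 u v w \<noteq> 0" for u v w
    using that det3_eq_bil by metis
  have perm: "det3 u1 u3 u2 \<noteq> 0" "det3 u1 u3 u0 \<noteq> 0" "det3 u2 u3 u0 \<noteq> 0" "det3 u2 u3 u1 \<noteq> 0"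
    "det3 u0 u3 u1 \<noteq> 0" "det3 u0 u3 u2 \<noteq> 0" "det3 u1 u2 u0 \<noteq> 0" "det3 u0 u2 u1 \<noteq> 0"
    using d by (simp_all add: det3_def bil_def algebra_simps)
  have B01: "B u0 u1 = 0"
    using B[of "crs u0 u1" u0 u1 u2 u3] nz d by (simp add: poly_eval_pd_pd_prod4)
  have B02: "B u0 u2 = 0"
    using B[of "crs u0 u2" u0 u2 u1 u3] nz d perm by (simp add: poly_eval_pd_pd_prod4)
  have B03: "B u0 u3 = 0"
    using B[of "crs u0 u3" u0 u3 u1 u2] nz d perm by (simp add: poly_eval_pd_pd_prod4)
  have B12: "B u1 u2 = 0"
    using B[of "crs u1 u2" u1 u2 u0 u3] nz d perm by (simp add: poly_eval_pd_pd_prod4)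
  have B13: "B u1 u3 = 0"
    using B[of "crs u1 u3" u1 u3 u0 u2] nz d perm by (simp add: poly_eval_pd_pd_prod4)
  have B23: "B u2 u3 = 0"
    using B[of "crs u2 u3" u2 u3 u0 u1] nz d perm by (simp add: poly_eval_pd_pd_prod4)
  have sym: "B w u = B u w" for u w unfolding B_def by (simp add: algebra_simps)
  have N0: "N u0 = 0" using B01 B02 B03 unfolding BN by (intro det3_nonzero[OF d(4)])
  have N1: "N u1 = 0" using B01 B12 B13 sym[of u1 u0] unfolding BN by (intro det3_nonzero[OF d(3)]) simp_all
  have N2: "N u2 = 0" using B02 B12 B23 sym[of u2 u0] sym[of u2 u1]
    unfolding BN by (intro det3_nonzero[OF d(2)]) simp_all
  have "n1 = 0" "n2 = 0" "n3 = 0"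
    using N0 N1 N2 unfolding N_def vec3_eq_iff[of "vector _"]
    by (simp_all add: det3_nonzero[OF d(1)])
  then have "c $ t = 0" for t
    using exhaust_3_3[of t] by (auto simp: n1_def n2_def n3_def vec3_eq_iff)
  then show False using c(1) by (simp add: vec_eq_iff)
qed

lemma openin_arr_tau_4_6: "openin (subtopology (zariski 4) (arr 4)) (arr_tau 4 6)"
proof -
  let ?U = "PS 4 - zero_locus 4 {catform}"
  have mem: "poly_point (prod4 u0 u1 u2 u3) \<in> ?U \<longleftrightarrow> det (catmat (prod4 u0 u1 u2 u3)) \<noteq> 0"
    if "distinct_lines (vec4 u0 u1 u2 u3)" for u0 u1 u2 u3
    using prod4_PS[OF that] vanish_poly_point[OF prod4_PS[OF that] catform_hom]
    by (simp add: mem_zero_locus poly_eval_catform)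
  have 6: "arr_tau 4 6 \<subseteq> ?U"
    unfolding arr_tau_4_6 using mem distinct_lines_generic4 catmat_nonsingular_generic4 by blast
  have 7: "arr_tau 4 7 \<inter> ?U = {}"
  proof -
    have "poly_point (prod4 u0 u1 (a *s u0 + b *s u1) u3) \<notin> ?U" if "triple4 u0 u1 a b u3" for u0 u1 a b u3
    proof -
      have "crs u0 u1 \<noteq> 0" using that det3_crs_nonzero by (auto simp: triple4_def)
      then have "det (catmat (prod4 u0 u1 (a *s u0 + b *s u1) u3)) = 0"
        by (rule catmat_singular_triple_point) (simp_all add: bil_add bil_scale)
      then show ?thesis using mem[OF distinct_lines_triple4[OF that]] by simp
    qed
    then show ?thesis unfolding arr_tau_4_7 by blast
  qed
  have 9: "arr_tau 4 9 \<inter> ?U = {}"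
  proof -
    have "poly_point (prod4 u0 u1 (a *s u0 + b *s u1) (c *s u0 + d *s u1)) \<notin> ?U"
      if "pencil4 u0 u1 a b c d" for u0 u1 a b c d
    proof -
      have "crs u0 u1 \<noteq> 0" using that by (auto simp: pencil4_def)
      then have "det (catmat (prod4 u0 u1 (a *s u0 + b *s u1) (c *s u0 + d *s u1))) = 0"
        by (rule catmat_singular_triple_point) (simp_all add: bil_add bil_scale)
      then show ?thesis using mem[OF distinct_lines_pencil4[OF that]] by simp
    qed
    then show ?thesis unfolding arr_tau_4_9 by blast
  qed
  have "zariski_open 4 ?U"
    unfolding zariski_open_def using catform_hom by (intro exI[of _ "{catform}"]) auto
  moreover have "arr_tau 4 6 = ?U \<inter> arr 4" unfolding arr_4 using 6 7 9 by blast
  ultimately show ?thesis unfolding openin_subtopology openin_zariski by blast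
qed

section \<open>Derivations killing a product of linear forms\<close>

definition der :: "S ^ 3 \<Rightarrow> S \<Rightarrow> S" where
  "der v P = v $ 1 * pd 1 P + v $ 2 * pd 2 P + v $ 3 * pd 3 P"

lemma AR_der: "AR f = {v. der v f = 0}"
  by (simp add: AR_def der_def)

lemma der_mult: "der v (P * Q) = der v P * Q + P * der v Q"
  by (simp add: der_def pd_mult algebra_simps)

lemma der_lin: "der v (lin u) = con (u $ 1) * v $ 1 + con (u $ 2) * v $ 2 + con (u $ 3) * v $ 3"
  by (simp add: der_def mult.commute)

lemma der_lin_lincomb: "der v (lin (a *s u + b *s w)) = con a * der v (lin u) + con b * der v (lin w)"
  by (simp add: der_lin con_simps algebra_simps)

lemma der_prod4: "der v (prod4 u0 u1 u2 u3) =
    der v (lin u0) * (lin u1 * lin u2 * lin u3) + der v (lin u1) * (lin u0 * lin u2 * lin u3) +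
    der v (lin u2) * (lin u0 * lin u1 * lin u3) + der v (lin u3) * (lin u0 * lin u1 * lin u2)"
  by (simp add: prod4_def der_mult algebra_simps)

text \<open>In $\sum_i v(l_i) \prod_{j \ne i} l_j = 0$ the prime $l_i$ divides all summands but one,
  and none of the other factors of that one.\<close>

lemma der_prod4_eq_0_iff:
  assumes "distinct_lines (vec4 u0 u1 u2 u3)"
  shows "der v (prod4 u0 u1 u2 u3) = 0 \<longleftrightarrow> (\<exists>g0 g1 g2 g3. der v (lin u0) = lin u0 * g0 \<and>
    der v (lin u1) = lin u1 * g1 \<and> der v (lin u2) = lin u2 * g2 \<and> der v (lin u3) = lin u3 * g3 \<and>
    g0 + g1 + g2 + g3 = 0)" (is "?L \<longleftrightarrow> ?R")
proof
  have d: "crs u0 u1 \<noteq> 0" "crs u0 u2 \<noteq> 0" "crs u0 u3 \<noteq> 0" "crs u1 u2 \<noteq> 0" "crs u1 u3 \<noteq> 0" "crs u2 u3 \<noteq> 0"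
    "crs u1 u0 \<noteq> 0" "crs u2 u0 \<noteq> 0" "crs u3 u0 \<noteq> 0" "crs u2 u1 \<noteq> 0" "crs u3 u1 \<noteq> 0" "crs u3 u2 \<noteq> 0"
    using assms crs_eq_0_commute unfolding distinct_lines_vec4 by blast+
  then have nz: "u0 \<noteq> 0" "u1 \<noteq> 0" "u2 \<noteq> 0" "u3 \<noteq> 0" by auto
  have sum: "der v (prod4 u0 u1 u2 u3) = prod4 u0 u1 u2 u3 * (g0 + g1 + g2 + g3)"
    if "der v (lin u0) = lin u0 * g0" "der v (lin u1) = lin u1 * g1" "der v (lin u2) = lin u2 * g2"
      "der v (lin u3) = lin u3 * g3" for g0 g1 g2 g3
    unfolding der_prod4 unfolding that prod4_def by (simp add: algebra_simps)
  have prime: "lin u dvd W" if "u \<noteq> 0" "lin u dvd W * (lin x * lin y * lin z)"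
    "crs u x \<noteq> 0" "crs u y \<noteq> 0" "crs u z \<noteq> 0" for u x y z W
    using that lin_prime lin_not_dvd_lin by metis
  show ?R if ?L
  proof -
    let ?D = "\<lambda>u. der v (lin u)"
    have "?D u0 * (lin u1 * lin u2 * lin u3) =
        lin u0 * - (?D u1 * lin u2 * lin u3 + ?D u2 * lin u1 * lin u3 + ?D u3 * lin u1 * lin u2)"
      "?D u1 * (lin u0 * lin u2 * lin u3) =
        lin u1 * - (?D u0 * lin u2 * lin u3 + ?D u2 * lin u0 * lin u3 + ?D u3 * lin u0 * lin u2)"
      "?D u2 * (lin u0 * lin u1 * lin u3) =
        lin u2 * - (?D u0 * lin u1 * lin u3 + ?D u1 * lin u0 * lin u3 + ?D u3 * lin u0 * lin u1)"
      "?D u3 * (lin u0 * lin u1 * lin u2) =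
        lin u3 * - (?D u0 * lin u1 * lin u2 + ?D u1 * lin u0 * lin u2 + ?D u2 * lin u0 * lin u1)"
      using that unfolding der_prod4 by algebra+
    then have "lin u0 dvd ?D u0" "lin u1 dvd ?D u1" "lin u2 dvd ?D u2" "lin u3 dvd ?D u3"
      using prime nz d by (metis dvd_triv_left)+
    then obtain g0 g1 g2 g3 where g: "?D u0 = lin u0 * g0" "?D u1 = lin u1 * g1"
      "?D u2 = lin u2 * g2" "?D u3 = lin u3 * g3" by (elim dvdE)
    moreover have "g0 + g1 + g2 + g3 = 0"
      using sum[OF g] that prod4_nonzero[OF assms] by simp
    ultimately show ?R by blast
  qed
  show ?L if ?R
  proof -
    obtain g0 g1 g2 g3 where g: "der v (lin u0) = lin u0 * g0" "der v (lin u1) = lin u1 * g1"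
      "der v (lin u2) = lin u2 * g2" "der v (lin u3) = lin u3 * g3" "g0 + g1 + g2 + g3 = 0"
      using \<open>?R\<close> by blast
    show ?L unfolding sum[OF g(1-4)] g(5) by simp
  qed
qed

definition cvec :: "complex ^ 3 \<Rightarrow> S ^ 3" where
  "cvec n = (\<chi> i. con (n $ i))"

lemma cvec_nth [simp]: "cvec n $ i = con (n $ i)"
  by (simp add: cvec_def)

definition dual_frame where
  "dual_frame u0 u1 u2 n0 n1 n2 \<longleftrightarrow>
     bil u0 n0 = 1 \<and> bil u0 n1 = 0 \<and> bil u0 n2 = 0 \<and>
     bil u1 n0 = 0 \<and> bil u1 n1 = 1 \<and> bil u1 n2 = 0 \<and>
     bil u2 n0 = 0 \<and> bil u2 n1 = 0 \<and> bil u2 n2 = 1 \<and>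
     (\<forall>v. v = bil u0 v *s n0 + bil u1 v *s n1 + bil u2 v *s n2)"

lemma dual_basis:
  assumes "det3 u0 u1 u2 \<noteq> 0"
  obtains n0 n1 n2 where "dual_frame u0 u1 u2 n0 n1 n2"
proof -
  define \<delta> where "\<delta> = det3 u0 u1 u2"
  have \<delta>: "\<delta> \<noteq> 0" using assms by (simp add: \<delta>_def)
  define n0 where "n0 = inverse \<delta> *s crs u1 u2"
  define n1 where "n1 = inverse \<delta> *s crs u2 u0"
  define n2 where "n2 = inverse \<delta> *s crs u0 u1"
  have 1: "bil u0 (crs u1 u2) = \<delta>" "bil u1 (crs u2 u0) = \<delta>" "bil u2 (crs u0 u1) = \<delta>"
    by (simp_all add: \<delta>_def det3_def bil_def algebra_simps)
  have dual: "bil u0 n0 = 1" "bil u0 n1 = 0" "bil u0 n2 = 0"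
    "bil u1 n0 = 0" "bil u1 n1 = 1" "bil u1 n2 = 0"
    "bil u2 n0 = 0" "bil u2 n1 = 0" "bil u2 n2 = 1"
    using \<delta> by (simp_all add: n0_def n1_def n2_def bil_scale 1)
  have "v = bil u0 v *s n0 + bil u1 v *s n1 + bil u2 v *s n2" for v
  proof -
    define x where "x = v - (bil u0 v *s n0 + bil u1 v *s n1 + bil u2 v *s n2)"
    have minus: "bil u (y - z) = bil u y - bil u z" for u y z by (simp add: bil_def algebra_simps)
    have "bil u0 x = 0" "bil u1 x = 0" "bil u2 x = 0"
      by (simp_all add: x_def minus bil_add bil_scale dual)
    then have "x = 0" by (rule det3_nonzero[OF assms])
    then show ?thesis by (simp add: x_def)
  qed
  then have "dual_frame u0 u1 u2 n0 n1 n2" using dual unfolding dual_frame_def by blast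
  then show ?thesis by (rule that)
qed

lemma der_lin_combination:
  "der (P *s cvec n0 + Q *s cvec n1 + R *s cvec n2) (lin u) =
     con (bil u n0) * P + con (bil u n1) * Q + con (bil u n2) * R"
  unfolding der_lin by (simp add: bil_def con_simps algebra_simps)

text \<open>A derivation is determined by its values on three independent linear forms.\<close>

lemma derivation_expand:
  assumes "dual_frame u0 u1 u2 n0 n1 n2"
  shows "v = der v (lin u0) *s cvec n0 + der v (lin u1) *s cvec n1 + der v (lin u2) *s cvec n2"
proof -
  have exp: "v = bil u0 v *s n0 + bil u1 v *s n1 + bil u2 v *s n2" for v
    using assms unfolding dual_frame_def by blast
  define E :: "3 \<Rightarrow> complex ^ 3" where "E i = (\<chi> j. if j = i then 1 else 0)" for i
  have e: "u0 $ i * n0 $ j + u1 $ i * n1 $ j + u2 $ i * n2 $ j = (if j = i then 1 else 0)" for i j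
  proof -
    have "bil u (E i) = u $ i" for u
      using exhaust_3[of i] by (auto simp: bil_def E_def)
    then show ?thesis using arg_cong[OF exp[of "E i"], of "\<lambda>x. x $ j"] by (simp add: E_def)
  qed
  have "(der v (lin u0) *s cvec n0 + der v (lin u1) *s cvec n1 + der v (lin u2) *s cvec n2) $ j =
      con (u0 $ 1 * n0 $ j + u1 $ 1 * n1 $ j + u2 $ 1 * n2 $ j) * v $ 1 +
      con (u0 $ 2 * n0 $ j + u1 $ 2 * n1 $ j + u2 $ 2 * n2 $ j) * v $ 2 +
      con (u0 $ 3 * n0 $ j + u1 $ 3 * n1 $ j + u2 $ 3 * n2 $ j) * v $ 3" for j
    unfolding der_lin by (simp add: con_simps algebra_simps)
  also have "\<dots> j = v $ j" for j
    unfolding e using exhaust_3[of j] by auto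
  finally show ?thesis by (simp add: vec_eq_iff)
qed

section \<open>Graded module homomorphisms\<close>

lemma module_scalar_mult: "module ((*s) :: S \<Rightarrow> S ^ 'n \<Rightarrow> S ^ 'n)"
  by unfold_locales (simp_all add: vec_eq_iff algebra_simps)

lemma module_homI:
  fixes \<phi> :: "S ^ 'n \<Rightarrow> S ^ 'm"
  assumes "\<And>v w. \<phi> (v + w) = \<phi> v + \<phi> w" "\<And>c v. \<phi> (c *s v) = c *s \<phi> v"
  shows "module_hom (*s) (*s) \<phi>"
  using module_scalar_mult[where 'n = 'n] module_scalar_mult[where 'n = 'm] assms
  by (simp add: module_hom_def module_hom_axioms_def)

text \<open>The homogeneous component of degree \<open>k\<close>.\<close>

definition hcomp :: "int \<Rightarrow> S \<Rightarrow> S" where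
  "hcomp k P = (\<Sum>m\<in>{m \<in> keys P. int (mon_degree m) = k}.
     single m (lookup P m))"

lemma lookup_hcomp:
  "lookup (hcomp k P) m = (if int (mon_degree m) = k then lookup P m else 0)"
  by (simp add: hcomp_def lookup_sum lookup_single when_def in_keys_iff)

lemma hcomp_hom: "hcomp k P \<in> hom_part k"
  by (auto simp: hom_part_def in_keys_iff lookup_hcomp split: if_splits)

lemma hcomp_id: "P \<in> hom_part k \<Longrightarrow> hcomp k P = P"
  by (rule poly_mapping_eqI) (auto simp: lookup_hcomp hom_part_def in_keys_iff)

lemma hcomp_add: "hcomp k (P + Q) = hcomp k P + hcomp k Q"
  by (rule poly_mapping_eqI) (simp add: lookup_hcomp lookup_add)

lemma hcomp_mult:
  assumes "Q \<in> hom_part e"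
  shows "hcomp k (P * Q) = hcomp (k - e) P * Q"
proof (rule poly_mapping_eqI)
  fix m
  have "(\<Sum>(a, b)\<in>splits m. lookup (hcomp (k - e) P) a * lookup Q b) =
     (\<Sum>(a, b)\<in>splits m. if int (mon_degree m) = k then lookup P a * lookup Q b else 0)"
  proof (intro sum.cong refl, clarify)
    fix a b assume ab: "(a, b) \<in> splits m"
    show "lookup (hcomp (k - e) P) a * lookup Q b =
       (if int (mon_degree m) = k then lookup P a * lookup Q b else 0)"
    proof (cases "lookup Q b = 0")
      case False
      then have "int (mon_degree b) = e" using assms by (auto simp: hom_part_def in_keys_iff)
      moreover have "mon_degree m = mon_degree a + mon_degree b"
        using ab by (auto simp: splits_def mon_degree_add)
      ultimately show ?thesis by (auto simp: lookup_hcomp)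
    qed simp
  qed
  then show "lookup (hcomp k (P * Q)) m = lookup (hcomp (k - e) P * Q) m"
    unfolding lookup_hcomp[of k "P * Q"] lookup_mult_splits by (simp add: case_prod_unfold)
qed

text \<open>If two homogeneous elements form a basis of $AR(f)$, the isomorphism they define is
  automatically graded: the homogeneous components of the coefficients represent the homogeneous
  component of the element.\<close>

lemma free_arrI:
  fixes \<theta>1 \<theta>2 :: "S ^ 3"
  assumes d: "d1 \<le> d2" and h: "\<And>i. \<theta>1 $ i \<in> hom_part (int d1)" "\<And>i. \<theta>2 $ i \<in> hom_part (int d2)"
    and inj: "\<And>s t s' t'. s *s \<theta>1 + t *s \<theta>2 = s' *s \<theta>1 + t' *s \<theta>2 \<Longrightarrow> s = s' \<and> t = t'"
    and AR: "AR f = {s *s \<theta>1 + t *s \<theta>2 | s t. True}"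
  shows "free_arr f d1 d2"
proof -
  define \<phi> :: "S ^ 2 \<Rightarrow> S ^ 3" where "\<phi> v = v $ 1 *s \<theta>1 + v $ 2 *s \<theta>2" for v
  have v2: "\<phi> (vector [s, t]) = s *s \<theta>1 + t *s \<theta>2" for s t by (simp add: \<phi>_def)
  have "module_hom (*s) (*s) \<phi>"
    by (rule module_homI) (simp_all add: \<phi>_def vec_eq_iff algebra_simps)
  moreover have "bij_betw \<phi> UNIV (AR f)"
  proof (rule bij_betw_imageI)
    show "inj \<phi>"
    proof (rule injI)
      fix v w assume "\<phi> v = \<phi> w"
      then have "v $ 1 = w $ 1 \<and> v $ 2 = w $ 2" unfolding \<phi>_def by (rule inj)
      then show "v = w" by (simp add: vec_eq_iff forall_2)
    qed
    show "range \<phi> = AR f"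
    proof (intro equalityI subsetI)
      fix w assume "w \<in> AR f"
      then obtain s t where "w = \<phi> (vector [s, t])" unfolding AR v2 by blast
      then show "w \<in> range \<phi>" by blast
    qed (auto simp: AR \<phi>_def)
  qed
  moreover have "\<phi> ` twisted_part (vector [int d1, int d2]) k = AR_part f k" for k
  proof (intro equalityI subsetI)
    fix w assume "w \<in> \<phi> ` twisted_part (vector [int d1, int d2]) k"
    then obtain v where v: "w = \<phi> v" "v $ 1 \<in> hom_part (k - int d1)" "v $ 2 \<in> hom_part (k - int d2)"
      by (auto simp: twisted_part_def forall_2)
    have "w $ i \<in> hom_part k" for i
      using hom_part_add[OF hom_part_mult[OF v(2) h(1)[of i], unfolded diff_add_cancel]
          hom_part_mult[OF v(3) h(2)[of i], unfolded diff_add_cancel]]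
      by (simp add: v(1) \<phi>_def)
    moreover have "w \<in> AR f" unfolding AR v(1) \<phi>_def by blast
    ultimately show "w \<in> AR_part f k" by (simp add: AR_part_def)
  next
    fix w assume w: "w \<in> AR_part f k"
    then obtain s t where st: "w = s *s \<theta>1 + t *s \<theta>2" by (auto simp: AR_part_def AR)
    let ?v = "vector [hcomp (k - int d1) s, hcomp (k - int d2) t] :: S ^ 2"
    have "w $ i = \<phi> ?v $ i" for i
    proof -
      have "w $ i = hcomp k (w $ i)" using w hcomp_id by (auto simp: AR_part_def)
      also have "\<dots> = \<phi> ?v $ i"
        by (simp add: st hcomp_add hcomp_mult[OF h(1)] hcomp_mult[OF h(2)] \<phi>_def)
      finally show ?thesis .
    qed
    then have "w = \<phi> ?v" by (simp add: vec_eq_iff)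
    moreover have "?v \<in> twisted_part (vector [int d1, int d2]) k"
      by (simp add: twisted_part_def forall_2 hcomp_hom)
    ultimately show "w \<in> \<phi> ` twisted_part (vector [int d1, int d2]) k" by blast
  qed
  ultimately show ?thesis unfolding free_arr_def using d by blast
qed

section \<open>Three concurrent lines: exponents one and two\<close>

lemma con_cancel: "c \<noteq> 0 \<Longrightarrow> con c * P = Q \<Longrightarrow> P = con (inverse c) * Q"
  by (metis con_inverse_mult mult.assoc mult.left_neutral)

text \<open>The Koszul relations are the only ones between two independent linear forms. The
  constants are carried along because the relations arise from lines in the combinations $a u_0 + b
  u_1$.\<close>

lemma two_form_syzygy:
  assumes "crs u w \<noteq> 0" "a \<noteq> 0" "b \<noteq> 0" "con a * lin u * P + con b * lin w * Q = 0"
  obtains R where "P = - con b * lin w * R" "Q = con a * lin u * R"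
proof -
  have u: "u \<noteq> 0" "w \<noteq> 0" using assms(1) by auto
  have "lin w * (con b * Q) = lin u * (- con a * P)" using assms(4) by algebra
  then have "lin u dvd lin w * (con b * Q)" by simp
  then have "lin u dvd con b * Q" using lin_prime[OF u(1)] lin_not_dvd_lin[OF assms(1)] by blast
  then obtain T where T: "con b * Q = lin u * T" ..
  define R where "R = con (inverse a) * con (inverse b) * T"
  have "lin u * (lin w * T) = lin u * (- con a * P)" using assms(4) T by algebra
  then have "lin w * T = - con a * P" using u by (simp only: mult_cancel_left lin_eq_0_iff) simp
  then have "con a * P = - (lin w * T)" by simp
  then have P: "P = con (inverse a) * - (lin w * T)" by (rule con_cancel[OF assms(2)])
  have Q: "Q = con (inverse b) * (lin u * T)" by (rule con_cancel[OF assms(3) T])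
  note inv = con_inverse_mult[OF assms(2)] con_inverse_mult[OF assms(3)]
  have "con b * R = con (inverse a) * ((con (inverse b) * con b) * T)"
    unfolding R_def by (simp only: mult_ac)
  then have "con b * R = con (inverse a) * T" unfolding inv by simp
  then have "P = - con b * lin w * R" unfolding P by algebra
  moreover have "con a * R = con (inverse b) * ((con (inverse a) * con a) * T)"
    unfolding R_def by (simp only: mult_ac)
  then have "con a * R = con (inverse b) * T" unfolding inv by simp
  then have "Q = con a * lin u * R" unfolding Q by algebra
  ultimately show ?thesis by (rule that)
qed

text \<open>Write $m = a l_0 + b l_1$ for the third concurrent line. Evaluating \<open>v\<close> on
  this relation gives $a l_0 (g_0 - g_2) + b l_1 (g_1 - g_2) = 0$, so $g_0 = g_2 - b l_1 t$ and $g_1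
  = g_2 + a l_0 t$, and $g_3$ follows from the sum. The free parameters $s = g_2$ and
  \<open>t\<close> are the coefficients of the two generators.\<close>

lemma free_triple4:
  assumes "triple4 u0 u1 a b u3"
  shows "free_arr (prod4 u0 u1 (a *s u0 + b *s u1) u3) 1 2"
proof -
  have d: "det3 u0 u1 u3 \<noteq> 0" "a \<noteq> 0" "b \<noteq> 0" using assms by (auto simp: triple4_def)
  obtain n0 n1 n2 where ex: "dual_frame u0 u1 u3 n0 n1 n2"
    using dual_basis[OF d(1)] .
  then have n: "bil u0 n0 = 1" "bil u0 n1 = 0" "bil u0 n2 = 0"
    "bil u1 n0 = 0" "bil u1 n1 = 1" "bil u1 n2 = 0"
    "bil u3 n0 = 0" "bil u3 n1 = 0" "bil u3 n2 = 1"
    by (auto simp: dual_frame_def)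
  let ?m = "a *s u0 + b *s u1"
  let ?f = "prod4 u0 u1 ?m u3"
  have c: "crs u0 u1 \<noteq> 0" using d(1) det3_crs_nonzero by blast
  have u: "u0 \<noteq> 0" "u1 \<noteq> 0" "u3 \<noteq> 0" using d(1) by (auto simp: det3_def)
  have m0: "?m \<noteq> 0" using distinct_lines_triple4[OF assms] unfolding distinct_lines_vec4 by auto
  have m: "lin ?m = con a * lin u0 + con b * lin u1" by (simp add: lin_add lin_scale)
  define \<theta>1 where "\<theta>1 = lin u0 *s cvec n0 + lin u1 *s cvec n1 + (con (-3) * lin u3) *s cvec n2"
  define \<theta>2 where "\<theta>2 = (con (-b) * (lin u0 * lin u1)) *s cvec n0 + (con a * (lin u0 * lin u1)) *s cvec n1 +
    (con b * (lin u3 * lin u1) + con (-a) * (lin u3 * lin u0)) *s cvec n2"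
  have w: "der (s *s \<theta>1 + t *s \<theta>2) (lin u0) = lin u0 * (s - con b * lin u1 * t)"
    "der (s *s \<theta>1 + t *s \<theta>2) (lin u1) = lin u1 * (s + con a * lin u0 * t)"
    "der (s *s \<theta>1 + t *s \<theta>2) (lin u3) = lin u3 * (con (-3) * s + (con b * lin u1 - con a * lin u0) * t)" for s t
  proof -
    have "s *s \<theta>1 + t *s \<theta>2 = (lin u0 * (s - con b * lin u1 * t)) *s cvec n0 +
      (lin u1 * (s + con a * lin u0 * t)) *s cvec n1 +
      (lin u3 * (con (-3) * s + (con b * lin u1 - con a * lin u0) * t)) *s cvec n2"
      unfolding \<theta>1_def \<theta>2_def by (simp add: vec_eq_iff con_simps algebra_simps)
    then show "der (s *s \<theta>1 + t *s \<theta>2) (lin u0) = lin u0 * (s - con b * lin u1 * t)"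
      "der (s *s \<theta>1 + t *s \<theta>2) (lin u1) = lin u1 * (s + con a * lin u0 * t)"
      "der (s *s \<theta>1 + t *s \<theta>2) (lin u3) = lin u3 * (con (-3) * s + (con b * lin u1 - con a * lin u0) * t)"
      by (simp_all add: der_lin_combination n)
  qed
  have con3: "con (-3) = (-3 :: S)" by (simp add: con_uminus)
  show ?thesis
  proof (rule free_arrI)
    note hl = hom_part_lin[of u0] hom_part_lin[of u1] hom_part_lin[of u3]
    note hll = hom_part_mult[OF hl(1) hl(2)] hom_part_mult[OF hl(3) hl(2)] hom_part_mult[OF hl(3) hl(1)]
    have hc: "P \<in> hom_part k \<Longrightarrow> (P *s cvec n) $ i \<in> hom_part k" for P k n i
      using hom_part_con_mult[of P k "n $ i"] by (simp add: mult.commute)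
    show "\<theta>1 $ i \<in> hom_part (int 1)" for i
      unfolding \<theta>1_def vector_add_component
      using hl by (intro hom_part_add hc hom_part_con_mult) auto
    show "\<theta>2 $ i \<in> hom_part (int 2)" for i
      unfolding \<theta>2_def vector_add_component
      using hll by (intro hom_part_add hc hom_part_con_mult) auto
    show "s = s' \<and> t = t'" if "s *s \<theta>1 + t *s \<theta>2 = s' *s \<theta>1 + t' *s \<theta>2" for s t s' t'
    proof -
      have "lin u0 * (s - con b * lin u1 * t) = lin u0 * (s' - con b * lin u1 * t')"
        "lin u1 * (s + con a * lin u0 * t) = lin u1 * (s' + con a * lin u0 * t')"
        using w(1,2)[of s t] w(1,2)[of s' t'] that by metis+
      then have e: "s - con b * lin u1 * t = s' - con b * lin u1 * t'"
        "s + con a * lin u0 * t = s' + con a * lin u0 * t'"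
        using u(1,2) by (metis mult_left_cancel lin_eq_0_iff)+
      then have "lin ?m * (t - t') = 0" unfolding m by algebra
      then have "t = t'" using m0 by simp
      then show ?thesis using e by simp
    qed
    show "AR ?f = {s *s \<theta>1 + t *s \<theta>2 | s t. True}"
    proof (intro equalityI subsetI)
      fix v assume "v \<in> AR ?f"
      then have "der v ?f = 0" by (simp add: AR_der)
      then obtain g0 g1 g2 g3 where g: "der v (lin u0) = lin u0 * g0" "der v (lin u1) = lin u1 * g1"
        "der v (lin ?m) = lin ?m * g2" "der v (lin u3) = lin u3 * g3" "g0 + g1 + g2 + g3 = 0"
        unfolding der_prod4_eq_0_iff[OF distinct_lines_triple4[OF assms]] by blast
      have "con a * (lin u0 * g0) + con b * (lin u1 * g1) = (con a * lin u0 + con b * lin u1) * g2"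
        using g(3) unfolding der_lin_lincomb unfolding m g(1,2) .
      then have "con a * lin u0 * (g0 - g2) + con b * lin u1 * (g1 - g2) = 0" by algebra
      then obtain t where t: "g0 - g2 = - con b * lin u1 * t" "g1 - g2 = con a * lin u0 * t"
        using two_form_syzygy[OF c d(2,3)] by metis
      have "der v (lin u0) = der (g2 *s \<theta>1 + t *s \<theta>2) (lin u0)"
        unfolding w g using t by algebra
      moreover have "der v (lin u1) = der (g2 *s \<theta>1 + t *s \<theta>2) (lin u1)"
        unfolding w g using t by algebra
      moreover have "der v (lin u3) = der (g2 *s \<theta>1 + t *s \<theta>2) (lin u3)"
        unfolding w g(4) con3 using t g(5) by algebra
      ultimately have "v = g2 *s \<theta>1 + t *s \<theta>2"
        using derivation_expand[OF ex, of v] derivation_expand[OF ex, of "g2 *s \<theta>1 + t *s \<theta>2"] by metis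
      then show "v \<in> {s *s \<theta>1 + t *s \<theta>2 | s t. True}" by blast
    next
      fix v assume "v \<in> {s *s \<theta>1 + t *s \<theta>2 | s t. True}"
      then obtain s t where v: "v = s *s \<theta>1 + t *s \<theta>2" by blast
      have "der v (lin ?m) = lin ?m * s"
        unfolding der_lin_lincomb unfolding v w m by algebra
      moreover have "(s - con b * lin u1 * t) + (s + con a * lin u0 * t) + s +
          (con (-3) * s + (con b * lin u1 - con a * lin u0) * t) = 0"
        unfolding con3 by algebra
      ultimately have "der v ?f = 0"
        unfolding der_prod4_eq_0_iff[OF distinct_lines_triple4[OF assms]] using w[of s t] v by blast
      then show "v \<in> AR ?f" by (simp add: AR_der)
    qed
  qed simp
qed

section \<open>Four concurrent lines: exponents zero and three\<close>

text \<open>Here \<open>f\<close> is a binary form in $l_0, l_1$, with partial derivatives $F_0,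
  F_1$ in these two variables. The generators are the derivation along the common point, which kills
  both forms, and the Hamiltonian derivation $(F_1, -F_0)$. Both concurrency relations have syzygies
  as above, with parameters \<open>A\<close> and \<open>B\<close>; comparing them yields $q B = m
  A$, so that both are determined by one polynomial.\<close>

lemma free_pencil4:
  assumes "pencil4 u0 u1 a b c d"
  shows "free_arr (prod4 u0 u1 (a *s u0 + b *s u1) (c *s u0 + d *s u1)) 0 3"
proof -
  have h: "crs u0 u1 \<noteq> 0" "a \<noteq> 0" "b \<noteq> 0" "c \<noteq> 0" "d \<noteq> 0" "a * d - b * c \<noteq> 0"
    using assms by (auto simp: pencil4_def)
  obtain z where "bil (crs u0 u1) z = 1" using nonzero_bil[OF h(1)] .
  then have dz: "det3 u0 u1 z \<noteq> 0" by (simp add: det3_def)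
  obtain n0 n1 n2 where ex: "dual_frame u0 u1 z n0 n1 n2"
    using dual_basis[OF dz] .
  then have n: "bil u0 n0 = 1" "bil u0 n1 = 0" "bil u0 n2 = 0"
    "bil u1 n0 = 0" "bil u1 n1 = 1" "bil u1 n2 = 0"
    "bil z n0 = 0" "bil z n1 = 0" "bil z n2 = 1"
    by (auto simp: dual_frame_def)
  let ?m = "a *s u0 + b *s u1" and ?q = "c *s u0 + d *s u1"
  let ?f = "prod4 u0 u1 ?m ?q"
  have dl: "distinct_lines (vec4 u0 u1 ?m ?q)" by (rule distinct_lines_pencil4[OF assms])
  then have cr: "crs u1 ?m \<noteq> 0" "crs u1 ?q \<noteq> 0" "crs ?m ?q \<noteq> 0" unfolding distinct_lines_vec4 by auto
  have u: "u0 \<noteq> 0" "u1 \<noteq> 0" using h(1) by auto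
  have mq0: "?m \<noteq> 0" "?q \<noteq> 0" using cr(3) by auto
  have m: "lin ?m = con a * lin u0 + con b * lin u1" "lin ?q = con c * lin u0 + con d * lin u1"
    by (simp_all add: lin_add lin_scale)
  define F0 where "F0 = lin u1 * (lin ?m * lin ?q + con a * (lin u0 * lin ?q) + con c * (lin u0 * lin ?m))"
  define F1 where "F1 = lin u0 * (lin ?m * lin ?q + con b * (lin u1 * lin ?q) + con d * (lin u1 * lin ?m))"
  have der_f: "der v ?f = der v (lin u0) * F0 + der v (lin u1) * F1" for v
    unfolding der_prod4 der_lin_lincomb unfolding F0_def F1_def m by algebra
  have F1: "F1 \<noteq> 0"
  proof
    assume "F1 = 0"
    then have "lin ?m * lin ?q + con b * (lin u1 * lin ?q) + con d * (lin u1 * lin ?m) = 0"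
      using u by (simp add: F1_def)
    then have "lin ?m * lin ?q = lin u1 * - (con b * lin ?q + con d * lin ?m)" by algebra
    then have "lin u1 dvd lin ?m * lin ?q" by simp
    then show False using lin_prime[OF u(2)] lin_not_dvd_lin cr by blast
  qed
  define \<theta>1 where "\<theta>1 = cvec n2"
  define \<theta>2 where "\<theta>2 = F1 *s cvec n0 + (- F0) *s cvec n1"
  have w: "der (s *s \<theta>1 + t *s \<theta>2) (lin u0) = t * F1" "der (s *s \<theta>1 + t *s \<theta>2) (lin u1) = - t * F0"
    "der (s *s \<theta>1 + t *s \<theta>2) (lin z) = s" for s t
  proof -
    have "s *s \<theta>1 + t *s \<theta>2 = (t * F1) *s cvec n0 + (- t * F0) *s cvec n1 + s *s cvec n2"
      unfolding \<theta>1_def \<theta>2_def by (simp add: vec_eq_iff algebra_simps)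
    then show "der (s *s \<theta>1 + t *s \<theta>2) (lin u0) = t * F1" "der (s *s \<theta>1 + t *s \<theta>2) (lin u1) = - t * F0"
      "der (s *s \<theta>1 + t *s \<theta>2) (lin z) = s"
      by (simp_all add: der_lin_combination n)
  qed
  show ?thesis
  proof (rule free_arrI)
    have lll: "lin x * (lin y * lin y') \<in> hom_part 3" for x y y'
      using hom_part_mult[OF hom_part_lin[of x] hom_part_mult[OF hom_part_lin[of y] hom_part_lin[of y']]] by simp
    have F: "F0 \<in> hom_part 3" "F1 \<in> hom_part 3"
    proof -
      have "F0 = lin u1 * (lin ?m * lin ?q) + con a * (lin u1 * (lin u0 * lin ?q)) + con c * (lin u1 * (lin u0 * lin ?m))"
        "F1 = lin u0 * (lin ?m * lin ?q) + con b * (lin u0 * (lin u1 * lin ?q)) + con d * (lin u0 * (lin u1 * lin ?m))"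
        unfolding F0_def F1_def by (simp_all add: algebra_simps)
      then show "F0 \<in> hom_part 3" "F1 \<in> hom_part 3"
        by (simp_all only:) (intro hom_part_add hom_part_con_mult lll)+
    qed
    show "\<theta>1 $ i \<in> hom_part (int 0)" for i by (simp add: \<theta>1_def hom_part_con)
    show "\<theta>2 $ i \<in> hom_part (int 3)" for i
      using hom_part_diff[OF hom_part_con_mult[OF F(2), of "n0 $ i"] hom_part_con_mult[OF F(1), of "n1 $ i"]]
      by (simp add: \<theta>2_def mult.commute)
    show "s = s' \<and> t = t'" if "s *s \<theta>1 + t *s \<theta>2 = s' *s \<theta>1 + t' *s \<theta>2" for s t s' t'
    proof -
      have "t * F1 = t' * F1" "s = s'" using w(1,3)[of s t] w(1,3)[of s' t'] that by metis+
      then show ?thesis using F1 by simp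
    qed
    show "AR ?f = {s *s \<theta>1 + t *s \<theta>2 | s t. True}"
    proof (intro equalityI subsetI)
      fix v assume "v \<in> AR ?f"
      then have "der v ?f = 0" by (simp add: AR_der)
      then obtain g0 g1 g2 g3 where g: "der v (lin u0) = lin u0 * g0" "der v (lin u1) = lin u1 * g1"
        "der v (lin ?m) = lin ?m * g2" "der v (lin ?q) = lin ?q * g3" "g0 + g1 + g2 + g3 = 0"
        unfolding der_prod4_eq_0_iff[OF dl] by blast
      have "con a * (lin u0 * g0) + con b * (lin u1 * g1) = (con a * lin u0 + con b * lin u1) * g2"
        using g(3) unfolding der_lin_lincomb unfolding m g(1,2) .
      then have "con a * lin u0 * (g0 - g2) + con b * lin u1 * (g1 - g2) = 0" by algebra
      then obtain A where A: "g0 - g2 = - con b * lin u1 * A" "g1 - g2 = con a * lin u0 * A"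
        using two_form_syzygy[OF h(1-3)] by metis
      have "con c * (lin u0 * g0) + con d * (lin u1 * g1) = (con c * lin u0 + con d * lin u1) * g3"
        using g(4) unfolding der_lin_lincomb unfolding m g(1,2) .
      then have "con c * lin u0 * (g0 - g3) + con d * lin u1 * (g1 - g3) = 0" by algebra
      then obtain B where B: "g0 - g3 = - con d * lin u1 * B" "g1 - g3 = con c * lin u0 * B"
        using two_form_syzygy[OF h(1,4,5)] by metis
      have AB: "lin ?q * B = lin ?m * A" unfolding m using A B by algebra
      have "lin ?m dvd lin ?q * B" using AB by simp
      then have "lin ?m dvd B" using lin_prime[OF mq0(1)] lin_not_dvd_lin[OF cr(3)] by blast
      then obtain r where r: "B = lin ?m * r" ..
      have "lin ?m * A = lin ?m * (lin ?q * r)" using AB r by algebra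
      then have A': "A = lin ?q * r" using mq0 by simp
      \<comment> \<open>The $g_i$ have sum zero, so $4 g_0$ is the sum of the differences $g_0 - g_i$.\<close>
      define t where "t = con (- (1 / 4)) * r"
      have "4 * con (1 / 4) = (1 :: S)"
        using con_mult[of 4 "1 / 4"] by simp
      then have t4: "4 * t = - r" unfolding t_def con_uminus by algebra
      have "g0 - g1 = - ((con a * lin u0 + con b * lin u1) * A)" using A by algebra
      then have D: "g0 - g1 = - (lin ?m * (lin ?q * r))" unfolding m(1)[symmetric] A' .
      have "4 * g0 = (g0 - g1) + (g0 - g2) + (g0 - g3)" using g(5) by algebra
      then have "4 * (lin u0 * g0) = 4 * (t * F1)"
        unfolding D A B F1_def A' r using t4 by algebra
      moreover have "4 * g1 = - (g0 - g1) + (g1 - g2) + (g1 - g3)" using g(5) by algebra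
      then have "4 * (lin u1 * g1) = 4 * (- t * F0)"
        unfolding D A B F0_def A' r using t4 by algebra
      ultimately have "der v (lin u0) = t * F1" "der v (lin u1) = - t * F0"
        unfolding g(1,2) by (metis mult_left_cancel zero_neq_numeral)+
      then have "v = der v (lin z) *s \<theta>1 + t *s \<theta>2"
        using derivation_expand[OF ex, of v] derivation_expand[OF ex, of "der v (lin z) *s \<theta>1 + t *s \<theta>2"]
        unfolding w by metis
      then show "v \<in> {s *s \<theta>1 + t *s \<theta>2 | s t. True}" by blast
    next
      fix v assume "v \<in> {s *s \<theta>1 + t *s \<theta>2 | s t. True}"
      then obtain s t where v: "v = s *s \<theta>1 + t *s \<theta>2" by blast
      have "der v ?f = 0" unfolding der_f v w by algebra
      then show "v \<in> AR ?f" by (simp add: AR_der)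
    qed
  qed simp
qed

section \<open>Generic arrangements: nearly free with exponents two and two\<close>

definition scross :: "S ^ 3 \<Rightarrow> S ^ 3 \<Rightarrow> S ^ 3" where
  "scross l q = vector [l $ 2 * q $ 3 - l $ 3 * q $ 2, l $ 3 * q $ 1 - l $ 1 * q $ 3, l $ 1 * q $ 2 - l $ 2 * q $ 1]"

lemma scross_nth [simp]:
  "scross l q $ 1 = l $ 2 * q $ 3 - l $ 3 * q $ 2"
  "scross l q $ 2 = l $ 3 * q $ 1 - l $ 1 * q $ 3"
  "scross l q $ 3 = l $ 1 * q $ 2 - l $ 2 * q $ 1"
  by (simp_all add: scross_def)

text \<open>Exactness of the Koszul complex in the middle: a vector parallel to $(l_0, l_1, l_2)$ is
  a multiple of it.\<close>

lemma koszul_exact_2: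
  assumes "crs u0 u1 \<noteq> 0" and q: "scross (vector [lin u0, lin u1, l2]) q = 0"
  obtains s where "q = s *s vector [lin u0, lin u1, l2]"
proof -
  have u: "u0 \<noteq> 0" using assms(1) by auto
  have e: "lin u0 * q $ 2 = lin u1 * q $ 1" "l2 * q $ 1 = lin u0 * q $ 3"
    using arg_cong[OF q, of "\<lambda>v. v $ 3"] arg_cong[OF q, of "\<lambda>v. v $ 2"] by simp_all
  have "lin u0 dvd lin u1 * q $ 1" using e(1) by (metis dvd_triv_left)
  then have "lin u0 dvd q $ 1" using lin_prime[OF u] lin_not_dvd_lin[OF assms(1)] by blast
  then obtain s where s: "q $ 1 = lin u0 * s" ..
  have "lin u0 * q $ 2 = lin u0 * (lin u1 * s)" "lin u0 * q $ 3 = lin u0 * (l2 * s)"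
    using e s by algebra+
  then have "q $ 2 = lin u1 * s" "q $ 3 = l2 * s" using u by (metis mult_left_cancel lin_eq_0_iff)+
  then have "q = s *s vector [lin u0, lin u1, l2]"
    using s by (simp add: vec3_eq_iff mult.commute)
  then show ?thesis by (rule that)
qed

text \<open>Exactness of the Koszul complex at the syzygies. Killing $l_0$ and then $l_1$ leaves
  $l_2$ unchanged, so the last entry lies in the ideal $(l_0, l_1)$; removing it leaves a syzygy of
  two forms.\<close>

lemma koszul_exact_1:
  assumes d: "det3 u0 u1 u2 \<noteq> 0"
    and p: "lin u0 * p $ 1 + lin u1 * p $ 2 + lin u2 * p $ 3 = 0"
  obtains q where "p = scross (vector [lin u0, lin u1, lin u2]) q"
proof -
  obtain n0 n1 n2 where "dual_frame u0 u1 u2 n0 n1 n2" using dual_basis[OF d] .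
  then have n: "bil u0 n0 = 1" "bil u1 n0 = 0" "bil u2 n0 = 0" "bil u1 n1 = 1" "bil u2 n1 = 0"
    by (auto simp: dual_frame_def)
  have c: "crs u0 u1 \<noteq> 0" using d det3_crs_nonzero by blast
  have u: "u0 \<noteq> 0" "u1 \<noteq> 0" "u2 \<noteq> 0" using d by (auto simp: det3_def)
  let ?k0 = "kill u0 n0" and ?k1 = "kill u1 n1"
  have k_add: "kill w n (P + Q) = kill w n P + kill w n Q" for w n P Q
    by (simp add: kill_def psubst_add)
  have k_mult: "kill w n (P * Q) = kill w n P * kill w n Q" for w n P Q
    by (simp add: kill_def psubst_mult)
  have k_0: "kill w n 0 = 0" for w n by (simp add: kill_def)
  have "?k1 (?k0 (lin u0 * p $ 1 + lin u1 * p $ 2 + lin u2 * p $ 3)) = 0" by (simp add: p k_0)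
  then have "lin u2 * ?k1 (?k0 (p $ 3)) = 0"
    by (simp add: k_add k_mult kill_lin n k_0)
  then have "?k1 (?k0 (p $ 3)) = 0" using u by simp
  then have "lin u1 dvd ?k0 (p $ 3)" by (simp add: lin_dvd_iff_kill[OF n(4)])
  then obtain b where b: "?k0 (p $ 3) = lin u1 * b" ..
  have "lin u0 dvd ?k0 (p $ 3) - p $ 3" unfolding kill_def by (rule psubst_cong_mod) simp
  then obtain a' where a': "?k0 (p $ 3) - p $ 3 = lin u0 * a'" ..
  define a where "a = - a'"
  have p3: "p $ 3 = lin u0 * a + lin u1 * b" using a' b by (simp add: a_def algebra_simps)
  have "lin u1 * (p $ 2 + b * lin u2) = lin u0 * - (p $ 1 + a * lin u2)" using p p3 by algebra
  then have "lin u0 dvd lin u1 * (p $ 2 + b * lin u2)" by simp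
  then have "lin u0 dvd p $ 2 + b * lin u2" using lin_prime[OF u(1)] lin_not_dvd_lin[OF c] by blast
  then obtain r where r: "p $ 2 + b * lin u2 = lin u0 * r" ..
  have "lin u0 * (p $ 1 + a * lin u2) = lin u0 * - (lin u1 * r)" using p p3 r by algebra
  then have "p $ 1 + a * lin u2 = - (lin u1 * r)" using u(1) by (metis mult_left_cancel lin_eq_0_iff)
  then have "p = scross (vector [lin u0, lin u1, lin u2]) (vector [- b, a, - r])"
    using p3 r by (simp add: vec3_eq_iff) (simp add: algebra_simps eq_diff_eq)
  then show ?thesis by (rule that)
qed

text \<open>Minimality of the resolution thus becomes the vanishing, at the origin, of all entries
  of the image vectors.\<close>

lemma lookup_0_eq_eval: "lookup P 0 = poly_eval P (\<lambda>_. 0)"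
proof -
  have "mon_eval m (\<lambda>_. 0) = (if m = 0 then 1 else 0)" for m :: "'a \<Rightarrow>\<^sub>0 nat"
    by (auto simp: mon_eval_def poly_mapping_eq_iff fun_eq_iff in_keys_iff)
  then show ?thesis
    by (simp add: poly_eval_def in_keys_iff if_distrib[of "(*) _"] cong: if_cong)
qed

lemma poly_eval_hom_0: "P \<in> hom_part k \<Longrightarrow> k \<noteq> 0 \<Longrightarrow> poly_eval P (\<lambda>_. 0) = 0"
  unfolding lookup_0_eq_eval[symmetric]
  by (metis (mono_tags, lifting) hom_part_def in_keys_iff mem_Collect_eq mon_degree_eq_0_iff of_nat_0)

lemma nearly_free_arrI:
  fixes \<psi> :: "S ^ 1 \<Rightarrow> S ^ 3" and \<phi> :: "S ^ 3 \<Rightarrow> S ^ 3"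
  assumes f: "f \<in> hom_part 4"
    and lin3: "\<And>v w. \<psi> (v + w) = \<psi> v + \<psi> w" "\<And>c v. \<psi> (c *s v) = c *s \<psi> v"
    and lin2: "\<And>v w. \<phi> (v + w) = \<phi> v + \<phi> w" "\<And>c v. \<phi> (c *s v) = c *s \<phi> v"
    and deg3: "\<And>k v i. v $ 1 \<in> hom_part k \<Longrightarrow> \<psi> v $ i \<in> hom_part (k + 1)"
    and deg2: "\<And>k v i. (\<And>j. v $ j \<in> hom_part k) \<Longrightarrow> \<phi> v $ i \<in> hom_part (k + 2)"
    and min: "\<And>v i. poly_eval (\<psi> v $ i) (\<lambda>_. 0) = 0" "\<And>v i. poly_eval (\<phi> v $ i) (\<lambda>_. 0) = 0"
    and ex: "inj \<psi>" "range \<psi> = {v. \<phi> v = 0}" "range \<phi> = AR f"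
  shows "nearly_free_arr 4 f 2 2"
proof -
  have pd3: "pd i f \<in> hom_part 3" for i using hom_part_pd[OF f] by simp
  have jac: "jac_map f v = vector [der v f]" for v by (simp add: jac_map_def der_def)
  have jac0: "{v. jac_map f v = 0} = AR f"
    by (auto simp: jac AR_der vec_eq_iff)
  have 3: "graded_hom (vector [6] :: int ^ 1) (vector [5, 5, 5] :: int ^ 3) \<psi>"
    unfolding graded_hom_def
  proof (intro conjI allI subsetI module_homI lin3)
    fix k w assume "w \<in> \<psi> ` twisted_part (vector [6]) k"
    then obtain v where v: "w = \<psi> v" "v $ 1 \<in> hom_part (k - 6)" by (auto simp: twisted_part_def)
    then show "w \<in> twisted_part (vector [5, 5, 5]) k"
      using deg3[OF v(2)] by (auto simp: twisted_part_def forall_3)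
  qed
  have 2: "graded_hom (vector [5, 5, 5] :: int ^ 3) (vector [3, 3, 3] :: int ^ 3) \<phi>"
    unfolding graded_hom_def
  proof (intro conjI allI subsetI module_homI lin2)
    fix k w assume "w \<in> \<phi> ` twisted_part (vector [5, 5, 5]) k"
    then obtain v where v: "w = \<phi> v" "\<forall>j. v $ j \<in> hom_part (k - 5)"
      by (auto simp: twisted_part_def forall_3)
    then show "w \<in> twisted_part (vector [3, 3, 3]) k"
    proof -
      have "\<phi> v $ i \<in> hom_part (k - 5 + 2)" for i by (rule deg2) (use v(2) in blast)
      then show ?thesis by (simp add: v(1) twisted_part_def forall_3)
    qed
  qed
  have 1: "graded_hom (vector [3, 3, 3] :: int ^ 3) (vector [0] :: int ^ 1) (jac_map f)"
    unfolding graded_hom_def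
  proof (intro conjI allI subsetI module_homI)
    show "jac_map f (v + w) = jac_map f v + jac_map f w" for v w
      by (simp add: jac_map_def vec_eq_iff algebra_simps)
    show "jac_map f (c *s v) = c *s jac_map f v" for c v
      by (simp add: jac_map_def vec_eq_iff algebra_simps)
    fix k w assume "w \<in> jac_map f ` twisted_part (vector [3, 3, 3]) k"
    then obtain v where v: "w = jac_map f v" "\<forall>j. v $ j \<in> hom_part (k - 3)"
      by (auto simp: twisted_part_def forall_3)
    have "v $ j * pd j f \<in> hom_part k" for j
      using hom_part_mult[OF v(2)[rule_format] pd3, of j j] by simp
    then show "w \<in> twisted_part (vector [0]) k"
      by (simp add: twisted_part_def v(1) jac_map_def hom_part_add)
  qed
  have "minimal_map \<psi>" "minimal_map \<phi>"
    using min by (simp_all add: minimal_map_def lookup_0_eq_eval)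
  moreover have "minimal_map (jac_map f)"
    using poly_eval_hom_0[OF pd3]
    by (simp add: minimal_map_def lookup_0_eq_eval jac_map_def poly_eval_add poly_eval_mult)
  ultimately show ?thesis
    unfolding nearly_free_arr_def Let_def
    using 3 2 1 ex jac0 by auto
qed

lemma AR_con_mult: "c \<noteq> 0 \<Longrightarrow> AR (con c * f) = AR f"
proof -
  have "der v (con c * f) = con c * der v f" for v
    by (simp add: der_mult) (simp add: der_def)
  then show "c \<noteq> 0 \<Longrightarrow> AR (con c * f) = AR f" by (simp add: AR_der)
qed

text \<open>With $p_i = g_i - g_3$ the condition on $l_3 = l_0 + l_1 + l_2$ is $\sum_i p_i l_i = 0$,
  and $\sum_i g_i = 0$ recovers $g_3 = -(p_0 + p_1 + p_2)/4$. So $AR(f)$ is the module of syzygies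
  of three independent linear forms, shifted by one degree, and the Koszul complex provides three
  generators of degree two with one linear relation.\<close>

lemma nearly_free_sum4:
  assumes d: "det3 u0 u1 u2 \<noteq> 0" and f: "f \<in> hom_part 4"
    and ARf: "AR f = AR (prod4 u0 u1 u2 (u0 + u1 + u2))"
  shows "nearly_free_arr 4 f 2 2"
proof -
  let ?u3 = "u0 + u1 + u2"
  let ?g = "prod4 u0 u1 u2 ?u3"
  let ?l = "vector [lin u0, lin u1, lin u2] :: S ^ 3"
  have dets: "det3 u0 u1 ?u3 = det3 u0 u1 u2" "det3 u0 u2 ?u3 = - det3 u0 u1 u2"
     "det3 u1 u2 ?u3 = det3 u0 u1 u2"
    by (simp_all add: det3_def bil_def algebra_simps)
  then have dl: "distinct_lines (vec4 u0 u1 u2 ?u3)"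
    using d by (intro distinct_lines_generic4) (simp add: generic4_def)
  have c: "crs u0 u1 \<noteq> 0" using d det3_crs_nonzero by blast
  have u: "u0 \<noteq> 0" "u1 \<noteq> 0" "u2 \<noteq> 0" using d by (auto simp: det3_def)
  obtain n0 n1 n2 where fr: "dual_frame u0 u1 u2 n0 n1 n2" using dual_basis[OF d] .
  then have n: "bil u0 n0 = 1" "bil u0 n1 = 0" "bil u0 n2 = 0"
    "bil u1 n0 = 0" "bil u1 n1 = 1" "bil u1 n2 = 0"
    "bil u2 n0 = 0" "bil u2 n1 = 0" "bil u2 n2 = 1"
    by (auto simp: dual_frame_def)
  define G where "G q = con (1 / 4) * (scross ?l q $ 1 + scross ?l q $ 2 + scross ?l q $ 3)" for q
  have con4: "4 * con (1 / 4) = (1 :: S)" using con_mult[of 4 "1 / 4"] by simp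
  have G4: "scross ?l q $ 1 + scross ?l q $ 2 + scross ?l q $ 3 = 4 * G q" for q
    unfolding G_def using con4 by algebra
  define \<phi>2 where "\<phi>2 q = (lin u0 * (scross ?l q $ 1 - G q)) *s cvec n0 +
    (lin u1 * (scross ?l q $ 2 - G q)) *s cvec n1 + (lin u2 * (scross ?l q $ 3 - G q)) *s cvec n2" for q
  define \<phi>3 :: "S ^ 1 \<Rightarrow> S ^ 3" where "\<phi>3 s = s $ 1 *s ?l" for s
  have w: "der (\<phi>2 q) (lin u0) = lin u0 * (scross ?l q $ 1 - G q)"
    "der (\<phi>2 q) (lin u1) = lin u1 * (scross ?l q $ 2 - G q)"
    "der (\<phi>2 q) (lin u2) = lin u2 * (scross ?l q $ 3 - G q)" for q
    unfolding \<phi>2_def der_lin_combination by (simp_all add: n)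
  have der3: "der v (lin ?u3) = der v (lin u0) + der v (lin u1) + der v (lin u2)" for v
    unfolding der_lin by (simp add: con_simps algebra_simps)
  have m3: "lin ?u3 = lin u0 + lin u1 + lin u2" by (simp add: lin_add)
  have koszul: "lin u0 * scross ?l q $ 1 + lin u1 * scross ?l q $ 2 + lin u2 * scross ?l q $ 3 = 0" for q
    by (simp add: algebra_simps)
  show ?thesis
  proof (rule nearly_free_arrI[OF f, where \<psi> = \<phi>3 and \<phi> = \<phi>2])
    show "\<phi>3 (v + w) = \<phi>3 v + \<phi>3 w" "\<phi>3 (r *s v) = r *s \<phi>3 v" for v w r
      by (simp_all add: \<phi>3_def vec_eq_iff algebra_simps)
    have S: "scross ?l (v + w) $ i = scross ?l v $ i + scross ?l w $ i"
      "scross ?l (r *s v) $ i = r * scross ?l v $ i" for v w r i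
      using exhaust_3[of i] by (auto simp: algebra_simps)
    have G: "G (v + w) = G v + G w" "G (r *s v) = r * G v" for v w r
      unfolding G_def S by (simp_all add: algebra_simps)
    show "\<phi>2 (v + w) = \<phi>2 v + \<phi>2 w" "\<phi>2 (r *s v) = r *s \<phi>2 v" for v w r
      unfolding \<phi>2_def S G by (simp_all add: vec_eq_iff algebra_simps)
    show "\<phi>3 v $ i \<in> hom_part (k + 1)" if "v $ 1 \<in> hom_part k" for v k i
      using exhaust_3[of i] hom_part_mult[OF that hom_part_lin] by (auto simp: \<phi>3_def)
    show "\<phi>2 v $ i \<in> hom_part (k + 2)" if v: "\<And>j. v $ j \<in> hom_part k" for v k i
    proof -
      have lm: "lin x * P \<in> hom_part (k + 1)" if "P \<in> hom_part k" for x P and k :: int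
        using hom_part_mult[OF hom_part_lin[of x] that] by (simp add: add.commute)
      have s: "scross ?l v $ j \<in> hom_part (k + 1)" for j
        using exhaust_3[of j] by (auto intro!: hom_part_diff lm v)
      have g: "G v \<in> hom_part (k + 1)"
        unfolding G_def by (intro hom_part_con_mult hom_part_add s)
      have "lin x * (scross ?l v $ j - G v) \<in> hom_part (k + 2)" for x j
        using lm[OF hom_part_diff[OF s g]] by (simp add: add.assoc)
      then show ?thesis
        unfolding \<phi>2_def by (simp del: scross_nth add: mult.commute[of _ "con _"] hom_part_add hom_part_con_mult)
    qed
    have ev: "poly_eval (lin x) (\<lambda>_. 0) = 0" for x by (rule poly_eval_hom_0[OF hom_part_lin]) simp
    show "poly_eval (\<phi>3 v $ i) (\<lambda>_. 0) = 0" for v i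
      using exhaust_3[of i] by (auto simp: \<phi>3_def poly_eval_mult ev)
    show "poly_eval (\<phi>2 v $ i) (\<lambda>_. 0) = 0" for v i
      by (simp add: \<phi>2_def poly_eval_mult poly_eval_add ev del: scross_nth)
    show "inj \<phi>3"
      by (rule injI) (use u in \<open>auto simp: \<phi>3_def vec_eq_iff forall_3\<close>)
    show "range \<phi>3 = {v. \<phi>2 v = 0}"
    proof (intro equalityI subsetI)
      fix q assume "q \<in> range \<phi>3"
      then obtain s where "q = \<phi>3 s" by blast
      then have s: "scross ?l q = 0" by (simp add: \<phi>3_def vec3_eq_iff algebra_simps)
      then have "G q = 0" by (simp add: G_def del: scross_nth)
      then show "q \<in> {v. \<phi>2 v = 0}" using s by (simp add: \<phi>2_def vec_eq_iff del: scross_nth)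
    next
      fix q assume "q \<in> {v. \<phi>2 v = 0}"
      then have z: "\<phi>2 q = 0" by simp
      have "der (\<phi>2 q) (lin x) = 0" for x unfolding z by (simp add: der_def)
      then have e: "scross ?l q $ 1 = G q" "scross ?l q $ 2 = G q" "scross ?l q $ 3 = G q"
        using w[of q] u by simp_all
      have "3 * G q = 4 * G q" using G4[of q] unfolding e by simp
      then have "G q = 0" by simp
      then have "scross ?l q = 0" using e by (simp add: vec3_eq_iff del: scross_nth)
      then obtain s where "q = s *s ?l" using koszul_exact_2[OF c] by blast
      then have "q = \<phi>3 (vector [s])" by (simp add: \<phi>3_def)
      then show "q \<in> range \<phi>3" by blast
    qed
    show "range \<phi>2 = AR f"
      unfolding ARf
    proof (intro equalityI subsetI)
      fix v assume "v \<in> range \<phi>2"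
      then obtain q where v: "v = \<phi>2 q" by blast
      have "der v (lin ?u3) = lin ?u3 * - G q"
        unfolding der3 unfolding v w m3 using koszul[of q] by algebra
      moreover have "(scross ?l q $ 1 - G q) + (scross ?l q $ 2 - G q) + (scross ?l q $ 3 - G q) + - G q = 0"
        using G4[of q] by algebra
      ultimately have "der v ?g = 0"
        unfolding der_prod4_eq_0_iff[OF dl] v using w[of q] by blast
      then show "v \<in> AR ?g" by (simp add: AR_der)
    next
      fix v assume "v \<in> AR ?g"
      then have "der v ?g = 0" by (simp add: AR_der)
      then obtain g0 g1 g2 g3 where g: "der v (lin u0) = lin u0 * g0" "der v (lin u1) = lin u1 * g1"
        "der v (lin u2) = lin u2 * g2" "der v (lin ?u3) = lin ?u3 * g3" "g0 + g1 + g2 + g3 = 0"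
        unfolding der_prod4_eq_0_iff[OF dl] by blast
      define p :: "S ^ 3" where "p = vector [g0 - g3, g1 - g3, g2 - g3]"
      have "lin u0 * g0 + lin u1 * g1 + lin u2 * g2 = (lin u0 + lin u1 + lin u2) * g3"
        using g(4) unfolding der3 unfolding g(1-3) m3 .
      then have "lin u0 * p $ 1 + lin u1 * p $ 2 + lin u2 * p $ 3 = 0"
        by (simp add: p_def algebra_simps)
      then obtain q where q: "p = scross ?l q" using koszul_exact_1[OF d] by blast
      have "4 * G q = 4 * (- g3)"
        unfolding G4[symmetric] q[symmetric] p_def using g(5) by (simp add: algebra_simps) algebra
      then have Gq: "G q = - g3" by simp
      have p: "scross ?l q $ 1 = g0 - g3" "scross ?l q $ 2 = g1 - g3" "scross ?l q $ 3 = g2 - g3"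
        unfolding q[symmetric] by (simp_all add: p_def)
      have "der v (lin u0) = der (\<phi>2 q) (lin u0)" "der v (lin u1) = der (\<phi>2 q) (lin u1)"
        "der v (lin u2) = der (\<phi>2 q) (lin u2)"
        unfolding w g(1-3) p Gq by simp_all
      then have "v = \<phi>2 q"
        using derivation_expand[OF fr, of v] derivation_expand[OF fr, of "\<phi>2 q"] by metis
      then show "v \<in> range \<phi>2" by blast
    qed
  qed
qed

text \<open>Rescaling the first three linear forms turns the fourth one into their sum and
  \<open>f\<close> into a multiple.\<close>

lemma nearly_free_generic4:
  assumes "generic4 u0 u1 u2 u3"
  shows "nearly_free_arr 4 (prod4 u0 u1 u2 u3) 2 2"
proof -
  have d: "det3 u0 u1 u2 \<noteq> 0" "det3 u0 u1 u3 \<noteq> 0" "det3 u0 u2 u3 \<noteq> 0" "det3 u1 u2 u3 \<noteq> 0"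
    using assms by (auto simp: generic4_def)
  let ?\<delta> = "det3 u0 u1 u2"
  define \<alpha> where "\<alpha> = det3 u1 u2 u3 / ?\<delta>"
  define \<beta> where "\<beta> = - det3 u0 u2 u3 / ?\<delta>"
  define \<gamma> where "\<gamma> = det3 u0 u1 u3 / ?\<delta>"
  have nz: "\<alpha> \<noteq> 0" "\<beta> \<noteq> 0" "\<gamma> \<noteq> 0" using d by (auto simp: \<alpha>_def \<beta>_def \<gamma>_def)
  have "?\<delta> *s u3 = det3 u1 u2 u3 *s u0 + (- det3 u0 u2 u3) *s u1 + det3 u0 u1 u3 *s u2"
    by (simp add: vec3_eq_iff det3_def bil_def algebra_simps)
  then have u3: "u3 = \<alpha> *s u0 + \<beta> *s u1 + \<gamma> *s u2"
  proof -
    assume *: "?\<delta> *s u3 = det3 u1 u2 u3 *s u0 + (- det3 u0 u2 u3) *s u1 + det3 u0 u1 u3 *s u2"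
    have "u3 = inverse ?\<delta> *s (?\<delta> *s u3)" using d(1) by simp
    also have "\<dots> = \<alpha> *s u0 + \<beta> *s u1 + \<gamma> *s u2"
      unfolding * by (simp add: vec3_eq_iff \<alpha>_def \<beta>_def \<gamma>_def divide_inverse algebra_simps)
    finally show ?thesis .
  qed
  have "det3 (\<alpha> *s u0) (\<beta> *s u1) (\<gamma> *s u2) = \<alpha> * \<beta> * \<gamma> * ?\<delta>"
    by (simp add: det3_def bil_def algebra_simps)
  then have "det3 (\<alpha> *s u0) (\<beta> *s u1) (\<gamma> *s u2) \<noteq> 0" using d nz by simp
  moreover have "prod4 (\<alpha> *s u0) (\<beta> *s u1) (\<gamma> *s u2) u3 = con (\<alpha> * \<beta> * \<gamma>) * prod4 u0 u1 u2 u3"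
    by (simp only: prod4_def lin_scale con_mult mult_ac)
  then have "AR (prod4 u0 u1 u2 u3) = AR (prod4 (\<alpha> *s u0) (\<beta> *s u1) (\<gamma> *s u2) u3)"
    using AR_con_mult[of "\<alpha> * \<beta> * \<gamma>"] nz by simp
  ultimately show ?thesis
    using nearly_free_sum4[OF _ prod4_hom] u3 by simp
qed

section \<open>The classification\<close>

lemma poly_point_eq_scale:
  assumes "poly_point f = poly_point g"
  obtains c where "c \<noteq> 0" "f = con c * g"
proof -
  have "f \<in> poly_point g" using self_in_poly_point[of f] assms by simp
  then show ?thesis using that by (auto simp: proj_point_def poly_scale_def)
qed

lemma prod4_scale: "con c * prod4 u0 u1 u2 u3 = prod4 (c *s u0) u1 u2 u3"
  by (simp add: prod4_def lin_scale mult_ac)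

lemma nearly_free_of_arr_tau_4_6:
  assumes "poly_point f \<in> arr_tau 4 6"
  shows "nearly_free_arr 4 f 2 2"
proof -
  obtain u0 u1 u2 u3 where "poly_point f = poly_point (prod4 u0 u1 u2 u3)" and g: "generic4 u0 u1 u2 u3"
    using assms unfolding arr_tau_4_6 by blast
  then obtain c where c: "c \<noteq> 0" "f = con c * prod4 u0 u1 u2 u3" using poly_point_eq_scale by metis
  have "det3 (c *s u) v w = c * det3 u v w" for u v w by (simp add: det3_def bil_def algebra_simps)
  then have "generic4 (c *s u0) u1 u2 u3" using g c(1) by (simp add: generic4_def)
  then show ?thesis unfolding c(2) prod4_scale by (rule nearly_free_generic4)
qed

lemma free_of_arr_tau_4_7:
  assumes "poly_point f \<in> arr_tau 4 7"
  shows "free_arr f 1 2"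
proof -
  obtain u0 u1 a b u3 where "poly_point f = poly_point (prod4 u0 u1 (a *s u0 + b *s u1) u3)"
    and t: "triple4 u0 u1 a b u3"
    using assms unfolding arr_tau_4_7 by blast
  then obtain c where c: "c \<noteq> 0" "f = con c * prod4 u0 u1 (a *s u0 + b *s u1) u3"
    using poly_point_eq_scale by metis
  have "det3 (c *s u) v w = c * det3 u v w" for u v w by (simp add: det3_def bil_def algebra_simps)
  then have "triple4 (c *s u0) u1 (a / c) b u3" using t c(1) by (simp add: triple4_def)
  moreover have "a *s u0 = (a / c) *s (c *s u0)" using c(1) by simp
  ultimately show ?thesis unfolding c(2) prod4_scale using free_triple4 by metis
qed

lemma free_of_arr_tau_4_9:
  assumes "poly_point f \<in> arr_tau 4 9"
  shows "free_arr f 0 3"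
proof -
  obtain u0 u1 a b c d where
    "poly_point f = poly_point (prod4 u0 u1 (a *s u0 + b *s u1) (c *s u0 + d *s u1))"
    and p: "pencil4 u0 u1 a b c d"
    using assms unfolding arr_tau_4_9 by blast
  then obtain r where r: "r \<noteq> 0" "f = con r * prod4 u0 u1 (a *s u0 + b *s u1) (c *s u0 + d *s u1)"
    using poly_point_eq_scale by metis
  have "crs (r *s u0) u1 = r *s crs u0 u1" by (simp add: vec3_eq_iff algebra_simps)
  moreover have "(a / r) * d - b * (c / r) = (a * d - b * c) / r" by (simp add: diff_divide_distrib)
  ultimately have "pencil4 (r *s u0) u1 (a / r) b (c / r) d"
    using p r(1) by (simp add: pencil4_def)
  moreover have "a *s u0 = (a / r) *s (r *s u0)" "c *s u0 = (c / r) *s (r *s u0)" using r(1) by simp_all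
  ultimately show ?thesis unfolding r(2) prod4_scale using free_pencil4 by metis
qed

theorem proposition5p2:
  shows
    \<comment> \<open>completeness of the list\<close>
    "(\<forall>f. poly_point f \<in> arr 4 \<longrightarrow>
        (\<exists>d1 d2. free_arr f d1 d2) \<or> (\<exists>d1 d2. nearly_free_arr 4 f d1 d2) \<longrightarrow>
        poly_point f \<in> arr_tau 4 6 \<union> arr_tau 4 7 \<union> arr_tau 4 9) \<and>
     (openin (subtopology (zariski 4) (arr 4)) (arr_tau 4 6) \<and>
      krull_dim (subtopology (zariski 4) (arr_tau 4 6)) = 8 \<and>
      (\<forall>f. poly_point f \<in> arr_tau 4 6 \<longrightarrow> nearly_free_arr 4 f 2 2)) \<and>
     (irreducible_in (zariski 4) (arr_tau 4 7) \<and>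
      krull_dim (subtopology (zariski 4) (arr_tau 4 7)) = 7 \<and>
      (\<forall>f. poly_point f \<in> arr_tau 4 7 \<longrightarrow> free_arr f 1 2)) \<and>
     (irreducible_in (zariski 4) (arr_tau 4 9) \<and>
      krull_dim (subtopology (zariski 4) (arr_tau 4 9)) = 6 \<and>
      (\<forall>f. poly_point f \<in> arr_tau 4 9 \<longrightarrow> free_arr f 0 3))"
  using openin_arr_tau_4_6 nearly_free_of_arr_tau_4_6
    antisym[OF krull_dim_arr_tau_4_6_le krull_dim_arr_tau_4_6_ge]
    irreducible_arr_tau_4_7 free_of_arr_tau_4_7
    antisym[OF krull_dim_arr_tau_4_7_le krull_dim_arr_tau_4_7_ge]
    irreducible_arr_tau_4_9 free_of_arr_tau_4_9
    antisym[OF krull_dim_arr_tau_4_9_le krull_dim_arr_tau_4_9_ge]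
  unfolding arr_4 by blast

end
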